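(* Let $d\ge5$ and $0<\delta<1$. There exist integers $s>r\ge2$ and $J\ge0$ and constants $c_0,c_1,c_2>0$, depending only on $d$ and $\delta$, such that for every $0<\gamma<d-2$ there is $\mathfrak c=\mathfrak c(d,\delta,\gamma)>0$ for which property (P) of the context holds and, with $p_N=N^{-\gamma}$, $\Omega_N\subseteq Q_N$ the binomial random subset with retention probability $p_N$, and $\mathcal Q=\{r^js^{J-j}:0\le j\le J\}$, the following holds. For all sufficiently large $N$, with probability at least $1-\exp(-\mathfrak cN^{d-\gamma})$, every subset $B\subseteq\Omega_N$ satisfying $|B|\ge\delta|\Omega_N|$ satisfies $$D^2(B)\cap\{r^{2j}s^{2(J-j)}\lambda:0\le j\le J\}\ne\varnothing$$ for every integer $\lambda$ with $c_1p_N^{-2/(d-2)}\le\lambda\le c_2N^2$; equivalently, $D^2(B)\cap\{q^2\lambda:q\in\mathcal Q\}\neq\varnothing$ for every such $\lambda$.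
   Context: $Q_N=[-N,N]^d\cap\mathbb Z^d$; $S_\lambda=\{\mathbf v\in\mathbb Z^d:|\mathbf v|^2=\lambda\}$; $A_\lambda^{(q)}f(\mathbf x)=\frac1{|S_\lambda|}\sum_{\mathbf v\in S_\lambda}f(\mathbf x+q\mathbf v)$; $D^2(B)=\{|\mathbf x-\mathbf y|^2:\mathbf x,\mathbf y\in B\}$ is the squared-distance set. The binomial random subset of $Q_N$ with retention probability $p$ retains each point independently with probability $p$. Property (P) for $(d,\delta,\gamma;r,s,J,c_0,c_1,c_2,\mathfrak c)$: for all sufficiently large $N$, with probability at least $1-\exp(-\mathfrak cN^{d-\gamma})$, every $B\subseteq\Omega_N$ with $|B|\ge\delta|\Omega_N|$ satisfies $$\frac1{|Q_N|}\sum_{\mathbf x\in\mathbb Z^d}\mathbf 1_B(\mathbf x)\sum_{j=0}^JA^{(r^j)}_{s^{2(J-j)}\lambda}\mathbf 1_B(\mathbf x)\ge c_0p_N^2$$ for every integer $\lambda$ with $c_1p_N^{-2/(d-2)}\le\lambda\le c_2N^2$. *)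

theory Defs
  imports "HOL-Probability.Probability" "HOL-Probability.Product_PMF"
begin

text \<open>
  Points of the integer lattice of dimension \<open>d\<close> are vectors of type \<open>int ^ 'd\<close>
  with \<open>d = CARD('d)\<close>.
\<close>

definition norm_sq :: "int ^ 'd::finite \<Rightarrow> int" where
  "norm_sq v = (\<Sum>i\<in>UNIV. (v $ i)\<^sup>2)"

definition lattice_box :: "nat \<Rightarrow> (int ^ 'd::finite) set" where
  "lattice_box N = {x. \<forall>i. - int N \<le> x $ i \<and> x $ i \<le> int N}"

definition lattice_sphere :: "int \<Rightarrow> (int ^ 'd::finite) set" where
  "lattice_sphere l = {v. norm_sq v = l}"

definition sphere_avg :: "nat \<Rightarrow> int \<Rightarrow> (int ^ 'd::finite \<Rightarrow> real) \<Rightarrow> int ^ 'd \<Rightarrow> real" where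
  "sphere_avg q l f x =
     1 / real (card (lattice_sphere l :: (int ^ 'd) set)) *
     (\<Sum>v\<in>lattice_sphere l. f (x + int q *s v))"

definition sq_dist_set :: "(int ^ 'd::finite) set \<Rightarrow> int set" where
  "sq_dist_set B = {norm_sq (x - y) | x y. x \<in> B \<and> y \<in> B}"

definition binomial_subset_pmf :: "'a set \<Rightarrow> real \<Rightarrow> 'a set pmf" where
  "binomial_subset_pmf A p =
     map_pmf (\<lambda>f. {x \<in> A. f x}) (Pi_pmf A False (\<lambda>_. bernoulli_pmf p))"

definition retention_prob :: "real \<Rightarrow> nat \<Rightarrow> real" where
  "retention_prob \<gamma> N = real N powr (- \<gamma>)"

definition admissible_radius :: "nat \<Rightarrow> real \<Rightarrow> real \<Rightarrow> real \<Rightarrow> nat \<Rightarrow> int \<Rightarrow> bool" where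
  "admissible_radius d \<gamma> c1 c2 N l \<longleftrightarrow>
     c1 * retention_prob \<gamma> N powr (- 2 / (real d - 2)) \<le> real_of_int l \<and>
     real_of_int l \<le> c2 * (real N)\<^sup>2"

text \<open>
  In the next definition the sum over all of the lattice has only finitely many nonzero terms,
  because \<open>B\<close> is contained in a box. The \<open>itself\<close> argument carries the dimension.
\<close>

definition property_P ::
    "'d::finite itself \<Rightarrow> real \<Rightarrow> real \<Rightarrow> nat \<Rightarrow> nat \<Rightarrow> nat \<Rightarrow> real \<Rightarrow> real \<Rightarrow> real \<Rightarrow> real \<Rightarrow> bool" where
  "property_P _ \<delta> \<gamma> r s J c0 c1 c2 c \<longleftrightarrow>
     (\<forall>\<^sub>F N in sequentially.
        measure_pmf.prob
          (binomial_subset_pmf (lattice_box N :: (int ^ 'd) set) (retention_prob \<gamma> N))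
          {\<Omega>. \<forall>B \<subseteq> \<Omega>. real (card B) \<ge> \<delta> * real (card \<Omega>) \<longrightarrow>
             (\<forall>l. admissible_radius CARD('d) \<gamma> c1 c2 N l \<longrightarrow>
                1 / real (card (lattice_box N :: (int ^ 'd) set)) *
                (\<Sum>\<^sub>\<infinity>x\<in>UNIV. indicator B x *
                   (\<Sum>j=0..J. sphere_avg (r ^ j) (int s ^ (2 * (J - j)) * l) (indicator B) x))
                \<ge> c0 * (retention_prob \<gamma> N)\<^sup>2)}
        \<ge> 1 - exp (- c * real N powr (real CARD('d) - \<gamma>)))"

end

theory Submission
  imports Defs
begin

text \<open>
  Give the pair \<open>(x, y)\<close> the weight \<open>w x y\<close>, the sum over \<open>j \<le> J\<close>
  of the probability that a uniform step \<open>v\<close> of the \<open>j\<close>-th lattice sphere satisfies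
  \<open>x + r ^ j v = y\<close>. The theorem says that every subset of relative density
  \<open>\<delta>\<close> of the random set carries about as much weight as a random set of that size should.
  It is obtained by transference from the same statement for dense subsets of the box.

  Dense sets (\<open>dense_supersaturation\<close>). By Parseval, the weight inside \<open>B\<close> is the
  integral of the energy spectrum of \<open>B\<close> against \<open>m\<^sub>0 + \<dots> + m\<^sub>J\<close>,
  where \<open>m\<^sub>j\<close> is the multiplier of the \<open>j\<close>-th average and
  \<open>\<rho>\<^sub>j = s ^ (J - j) sqrt \<lambda>\<close> is the radius of its sphere. If \<open>r ^ j
  \<xi>\<close> lies within a small multiple of \<open>1 / \<rho>\<^sub>j\<close> of the integer lattice, then
  \<open>m\<^sub>j \<xi>\<close> has real part at least \<open>1 / 2\<close>; call \<open>\<xi>\<close> good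
  for \<open>j\<close>. The circle method (\<open>sphere_sum_small\<close>) shows that \<open>m\<^sub>j
  \<xi>\<close> is negligible unless every coordinate of \<open>r ^ j \<xi>\<close> is within \<open>O(1 /
  \<rho>\<^sub>j)\<close> of a rational with bounded denominator. Now \<open>r\<close> is chosen divisible by
  all these denominators and \<open>s\<close> much larger than \<open>r\<close>: passing from \<open>j\<close>
  to \<open>j + 1\<close> clears the denominator and enlarges the error by the factor \<open>r\<close>, while
  the permitted error grows by the factor \<open>s\<close>. So a frequency whose multiplier is not negligible
  at \<open>j\<close> is good at all later scales, and it is neither good nor negligible for at most one
  \<open>j\<close>. The sum over \<open>j\<close> of the real parts is therefore at least about
  \<open>-1\<close> everywhere and at least \<open>(J + 1) / 2\<close> on the frequencies near
  \<open>0\<close>, which carry a proportion of the energy bounded below in terms of the density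
  (\<open>low_frequency_energy\<close>). A large \<open>J\<close> makes the gain win.

  Sparse random sets (\<open>sparse_supersaturation\<close>). A set \<open>B\<close> of small weight contains
  a small fingerprint \<open>T\<close> such that, up to few exceptions, the rest of \<open>B\<close> lies in a
  set determined by \<open>T\<close> alone which spans little weight (\<open>container_exists\<close>); by the
  dense statement this container has small density. A random set is unlikely to put a proportion
  \<open>\<delta> / 4\<close> of its expected size into a given container, and the number of fingerprints is
  small enough for a union bound with failure probability exponential in the expected size of the random set.
  The fingerprints are this small because a single weight is at most a small multiple of \<open>p\<close>.
  This is where \<open>\<lambda> \<ge> c1 p powr (-2 / (d - 2))\<close> enters, together with the lower bound
  \<open>c \<lambda> powr ((d - 2) / 2)\<close> for the number of points of the sphere
  (\<open>card_lattice_sphere_lower_bound\<close>). Finally the admissible \<open>\<lambda>\<close> are only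
  polynomially many in \<open>N\<close>, and the failure probability of each of them is smaller than any power
  of \<open>N\<close>.
\<close>

section \<open>Lattice boxes and lattice spheres\<close>

lemma abs_le_of_square_le: "i\<^sup>2 \<le> (n::int) \<Longrightarrow> \<bar>i\<bar> \<le> n"
proof -
  assume a: "i\<^sup>2 \<le> n"
  have "\<bar>i\<bar> \<le> i\<^sup>2"
  proof (cases "i = 0")
    case False
    then have "1 \<le> \<bar>i\<bar>" by simp
    then have "\<bar>i\<bar> * 1 \<le> \<bar>i\<bar> * \<bar>i\<bar>" by (intro mult_left_mono) auto
    then show ?thesis by (simp add: power2_eq_square)
  qed simp
  then show ?thesis using a by simp
qed

text \<open>
  A product of coordinate sums expands to a sum over dependent functions (\<open>prod_sum_PiE\<close>); this
  bijection turns it into a sum over vectors.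
\<close>

lemma bij_betw_vec_lambda:
  "bij_betw vec_lambda (PiE UNIV (\<lambda>_. S)) {v :: 'a ^ 'd::finite. \<forall>i. v $ i \<in> S}"
  by (rule bij_betwI[where g = vec_nth]) auto

lemma finite_vec_set: "finite S \<Longrightarrow> finite {v :: 'a ^ 'd::finite. \<forall>i. v $ i \<in> S}"
  using bij_betw_finite[OF bij_betw_vec_lambda[where 'd = 'd, of S]] finite_PiE[of "UNIV :: 'd set" "\<lambda>_. S"] by simp

lemma card_vec_set:
  "finite S \<Longrightarrow> card {v :: 'a ^ 'd::finite. \<forall>i. v $ i \<in> S} = card S ^ CARD('d)"
  using bij_betw_same_card[OF bij_betw_vec_lambda[where 'd = 'd, of S]] by (simp add: card_PiE)

lemma component_sq_le_norm_sq: "(v $ i)\<^sup>2 \<le> norm_sq (v :: int ^ 'd::finite)"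
  unfolding norm_sq_def by (rule member_le_sum) auto

lemma lattice_box_eq: "lattice_box N = {v :: int ^ 'd::finite. \<forall>i. v $ i \<in> {- int N..int N}}"
  by (auto simp: lattice_box_def)

lemma finite_lattice_box [simp]: "finite (lattice_box N :: (int ^ 'd::finite) set)"
  unfolding lattice_box_eq by (rule finite_vec_set) simp

lemma card_lattice_box: "card (lattice_box N :: (int ^ 'd::finite) set) = (2 * N + 1) ^ CARD('d)"
proof -
  have "card {- int N..int N} = 2 * N + 1" by simp
  then show ?thesis unfolding lattice_box_eq by (simp only: card_vec_set finite_atLeastAtMost_int)
qed

lemma finite_lattice_sphere [simp]: "finite (lattice_sphere l :: (int ^ 'd::finite) set)"
proof (rule finite_subset[OF _ finite_vec_set])
  show "(lattice_sphere l :: (int ^ 'd) set) \<subseteq> {v. \<forall>i. v $ i \<in> {-l..l}}"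
  proof (rule subsetI, rule CollectI, rule allI)
    fix v :: "int ^ 'd" and i assume "v \<in> lattice_sphere l"
    then have "(v $ i)\<^sup>2 \<le> l" using component_sq_le_norm_sq[of v i] by (simp add: lattice_sphere_def)
    from abs_le_of_square_le[OF this] show "v $ i \<in> {-l..l}" by auto
  qed
qed simp

section \<open>Four squares and the size of lattice spheres\<close>

lemma sum_eq_0_if_sign_reversing:
  fixes f :: "'a \<Rightarrow> int"
  assumes "\<And>x. x \<in> A \<Longrightarrow> \<phi> x \<in> A" "\<And>x. x \<in> A \<Longrightarrow> \<phi> (\<phi> x) = x"
    and "\<And>x. x \<in> A \<Longrightarrow> f (\<phi> x) = - f x"
  shows "sum f A = 0"
proof -
  have "sum f A = (\<Sum>x\<in>A. - f x)"
    by (rule sum.reindex_bij_witness[of A \<phi> \<phi>]) (use assms in auto)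
  then show ?thesis by (simp add: sum_negf)
qed

lemma odd_square_mod_8: "odd (i::int) \<Longrightarrow> i\<^sup>2 mod 8 = 1"
proof -
  assume "odd i"
  then obtain k where k: "i = 2 * k + 1" by (elim oddE)
  have "even (k * (k + 1))" by simp
  then obtain m where "k * (k + 1) = 2 * m" by (elim evenE)
  then have "i\<^sup>2 = 8 * m + 1" using k by (simp add: power2_eq_square algebra_simps)
  then show ?thesis by simp
qed

text \<open>
  The set on which Zagier's involution for representations by \<open>i\<^sup>2 + 4 d e\<close> acts.
\<close>

definition zagier_set :: "int \<Rightarrow> (int \<times> int \<times> int) set" where
  "zagier_set n = {(i, d, e). 0 < d \<and> 0 < e \<and> i\<^sup>2 + 4 * d * e = n}"

definition quads :: "int \<Rightarrow> (int \<times> int \<times> int \<times> int) set" where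
  "quads m = {(a, b, c, e). a\<^sup>2 + b\<^sup>2 + c\<^sup>2 + e\<^sup>2 = m}"

lemma finite_quads: "finite (quads n)"
proof (rule finite_subset)
  show "quads n \<subseteq> {-n..n} \<times> {-n..n} \<times> {-n..n} \<times> {-n..n}"
  proof clarsimp
    fix a b c e assume "(a, b, c, e) \<in> quads n"
    then have d: "a\<^sup>2 + b\<^sup>2 + c\<^sup>2 + e\<^sup>2 = n" by (auto simp: quads_def)
    have "a\<^sup>2 \<ge> 0" "b\<^sup>2 \<ge> 0" "c\<^sup>2 \<ge> 0" "e\<^sup>2 \<ge> 0" by simp_all
    then have "a\<^sup>2 \<le> n" "b\<^sup>2 \<le> n" "c\<^sup>2 \<le> n" "e\<^sup>2 \<le> n" using d by linarith+
    then show "- n \<le> a \<and> a \<le> n \<and> - n \<le> b \<and> b \<le> n \<and> - n \<le> c \<and> c \<le> n \<and> - n \<le> e \<and> e \<le> n"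
      using abs_le_of_square_le by (smt (verit))
  qed
qed auto

definition odd_quads :: "int \<Rightarrow> (int \<times> int \<times> int \<times> int) set" where
  "odd_quads m = {(a, b, c, e). odd a \<and> odd b \<and> odd c \<and> odd e \<and> a\<^sup>2 + b\<^sup>2 + c\<^sup>2 + e\<^sup>2 = m}"

definition divisor_pairs :: "int \<Rightarrow> (int \<times> int) set" where
  "divisor_pairs m = {(d, e). 0 < d \<and> 0 < e \<and> 4 * d * e = m}"

lemma finite_zagier_set: "finite (zagier_set n)"
proof (rule finite_subset)
  show "zagier_set n \<subseteq> {-n..n} \<times> {0..n} \<times> {0..n}"
  proof clarsimp
    fix i d e assume "(i, d, e) \<in> zagier_set n"
    then have d: "0 < d" "0 < e" "i\<^sup>2 + 4 * d * e = n" by (auto simp: zagier_set_def)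
    have "d * 1 \<le> d * e" "1 * e \<le> d * e" using d by (intro mult_mono; simp)+
    moreover have "0 < d * e" using d by simp
    moreover have "i\<^sup>2 \<ge> 0" by simp
    moreover have "i\<^sup>2 \<le> n" using d(3) \<open>0 < d * e\<close> by simp
    moreover note abs_le_of_square_le[OF this]
    ultimately show "- n \<le> i \<and> i \<le> n \<and> 0 \<le> d \<and> d \<le> n \<and> 0 \<le> e \<and> e \<le> n"
      using d unfolding mult.assoc by linarith
  qed
qed auto

lemma finite_odd_quads: "finite (odd_quads n)"
  by (rule finite_subset[OF _ finite_quads[of n]]) (auto simp: odd_quads_def quads_def)

lemma finite_odd_roots: "finite {i::int. odd i \<and> i\<^sup>2 \<le> n}"
  by (rule finite_subset[of _ "{-n..n}"]) (use abs_le_of_square_le in \<open>force+\<close>)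

lemma zagier_set_parity:
  assumes "n mod 8 = 5" "(i, d, e) \<in> zagier_set n"
  shows "odd i" "odd d" "odd e"
proof -
  have n: "i\<^sup>2 + 4 * (d * e) = n" using assms by (auto simp: zagier_set_def mult.assoc)
  show "odd i"
  proof
    assume "even i"
    then obtain j where "i\<^sup>2 = 2 * j" by (auto elim!: evenE simp: power2_eq_square)
    then have "2 * j + 4 * (d * e) = n" using n by simp
    then show False using assms(1) by presburger
  qed
  then have "i\<^sup>2 mod 8 = 1" by (rule odd_square_mod_8)
  moreover define y z where "y = i\<^sup>2" "z = d * e"
  moreover have "y + 4 * z = n" using n y_z_def by simp
  ultimately have "y mod 8 = 1" "y + 4 * z = n" by simp_all
  then have "odd z" using assms(1) by presburger
  then have "odd (d * e)" using y_z_def by simp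
  then show "odd d" "odd e" by auto
qed

text \<open>
  Since \<open>n - 5 i\<^sup>2 = 4 (d e - i\<^sup>2)\<close> on the set, the sum is four times that of \<open>g = d (d e - i\<^sup>2)\<close>.
  Exchanging \<open>d\<close> and \<open>e\<close> and negating \<open>i\<close> interchanges the halves \<open>e - d > i\<close> and \<open>e - d < i\<close>
  (equality is excluded by parity), so the sum of \<open>g\<close> is that of \<open>(d + e) (d e - i\<^sup>2)\<close> over the
  first half. This polynomial equals \<open>(d + e) (e - i) (d + i) + i (d - e) (d + e)\<close>. The first term
  changes sign under the involution \<open>(i, d, e) \<mapsto> (- i - 2 d, d, e - i - d)\<close> of that half. The second
  changes sign under \<open>i \<mapsto> - i\<close> on the part where \<open>e - d > |i|\<close>, and under the exchange of \<open>d\<close> and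
  \<open>e\<close> on the rest.
\<close>

lemma zagier_divisor_recurrence:
  fixes n :: int
  assumes n: "n mod 8 = 5"
  shows "(\<Sum>(i, d, e)\<in>zagier_set n. (n - 5 * i\<^sup>2) * d) = 0"
proof -
  define T1 where "T1 = {(i, d, e) \<in> zagier_set n. e - d > i}"
  define T2 where "T2 = {(i, d, e) \<in> zagier_set n. e - d < i}"
  define g where "g = (\<lambda>(i::int, d::int, e::int). d * (d * e - i\<^sup>2))"
  define P where "P = (\<lambda>(i::int, d::int, e::int). (d + e) * (e - i) * (d + i))"
  define h where "h = (\<lambda>(i::int, d::int, e::int). i * (d - e) * (d + e))"
  define A where "A = {(i, d, e) \<in> zagier_set n. e - d > \<bar>i\<bar>}"
  define B where "B = {(i, d, e) \<in> zagier_set n. i < - \<bar>e - d\<bar>}"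
  note par = zagier_set_parity[OF n]
  have fin: "finite T1" "finite T2" "finite A" "finite B"
    unfolding T1_def T2_def A_def B_def
    by (rule finite_subset[OF _ finite_zagier_set[of n]], blast)+
  have ne: "e - d \<noteq> i" "e - d \<noteq> - i" if "(i, d, e) \<in> zagier_set n" for i d e
    using par[OF that] by presburger+
  have split: "zagier_set n = T1 \<union> T2" "T1 \<inter> T2 = {}"
    unfolding T1_def T2_def using ne by (auto simp: neq_iff)
  have split1: "T1 = A \<union> B" "A \<inter> B = {}"
  proof -
    have "i < e - d \<longleftrightarrow> \<bar>i\<bar> < e - d \<or> i < - \<bar>e - d\<bar>" if "(i, d, e) \<in> zagier_set n" for i d e
      using ne[OF that] by linarith
    then show "T1 = A \<union> B" unfolding T1_def A_def B_def by auto
    show "A \<inter> B = {}" unfolding A_def B_def by auto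
  qed
  have "(\<Sum>(i, d, e)\<in>zagier_set n. (n - 5 * i\<^sup>2) * d) = (\<Sum>x\<in>zagier_set n. 4 * g x)"
    by (intro sum.cong refl) (auto simp: g_def zagier_set_def algebra_simps)
  also have "\<dots> = 4 * (sum g T1 + sum g T2)"
    unfolding sum_distrib_left[symmetric] split(1)
    using fin split(2) by (simp add: sum.union_disjoint)
  also have "sum g T2 = (\<Sum>(i, d, e)\<in>T1. g (- i, e, d))"
    by (rule sum.reindex_bij_witness[of _ "\<lambda>(i, d, e). (- i, e, d)" "\<lambda>(i, d, e). (- i, e, d)"])
       (auto simp: T1_def T2_def zagier_set_def algebra_simps)
  also have "sum g T1 + \<dots> = (\<Sum>x\<in>T1. P x + h x)"
    unfolding sum.distrib[symmetric]
    by (intro sum.cong refl) (auto simp: g_def P_def h_def algebra_simps power2_eq_square)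
  also have "\<dots> = sum P T1 + (sum h A + sum h B)"
    unfolding sum.distrib using fin split1 by (simp add: sum.union_disjoint)
  also have "sum P T1 = 0"
    by (rule sum_eq_0_if_sign_reversing[of _ "\<lambda>(i, d, e). (- i - 2 * d, d, e - i - d)"])
       (auto simp: T1_def P_def zagier_set_def algebra_simps power2_eq_square)
  also have "sum h A = 0"
    by (rule sum_eq_0_if_sign_reversing[of _ "\<lambda>(i, d, e). (- i, d, e)"])
       (auto simp: A_def h_def zagier_set_def)
  also have "sum h B = 0"
    by (rule sum_eq_0_if_sign_reversing[of _ "\<lambda>(i, d, e). (i, e, d)"])
       (auto simp: B_def h_def zagier_set_def algebra_simps abs_minus_commute)
  finally show ?thesis by simp
qed

lemma finite_divisor_pairs: "finite (divisor_pairs m)"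
proof (rule finite_subset)
  show "divisor_pairs m \<subseteq> snd ` zagier_set m"
    by (force simp: divisor_pairs_def zagier_set_def image_iff)
  show "finite (snd ` zagier_set m)" by (intro finite_imageI finite_zagier_set)
qed

text \<open>
  The previous identity, grouped by \<open>i\<close>: a recurrence for the sum of the divisors of
  \<open>(n - i\<^sup>2) / 4\<close>.
\<close>

lemma divisor_sum_recurrence:
  fixes n :: int
  assumes n: "n mod 8 = 5"
  shows "(\<Sum>i | odd i \<and> i\<^sup>2 \<le> n. (n - 5 * i\<^sup>2) * (\<Sum>(d, e)\<in>divisor_pairs (n - i\<^sup>2). d)) = 0"
proof -
  have "(\<Sum>i | odd i \<and> i\<^sup>2 \<le> n. (n - 5 * i\<^sup>2) * (\<Sum>(d, e)\<in>divisor_pairs (n - i\<^sup>2). d))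
      = (\<Sum>i | odd i \<and> i\<^sup>2 \<le> n. \<Sum>y\<in>divisor_pairs (n - i\<^sup>2). (n - 5 * i\<^sup>2) * fst y)"
    by (simp add: sum_distrib_left case_prod_unfold)
  also have "\<dots> = (\<Sum>(i, y)\<in>Sigma {i. odd i \<and> i\<^sup>2 \<le> n} (\<lambda>i. divisor_pairs (n - i\<^sup>2)). (n - 5 * i\<^sup>2) * fst y)"
    by (rule sum.Sigma) (auto simp: finite_odd_roots finite_divisor_pairs)
  also have "Sigma {i. odd i \<and> i\<^sup>2 \<le> n} (\<lambda>i. divisor_pairs (n - i\<^sup>2)) = zagier_set n"
  proof -
    have "i\<^sup>2 \<le> n" if "(i, d, e) \<in> zagier_set n" for i d e
    proof -
      have "0 < d * e" "i\<^sup>2 + 4 * (d * e) = n" using that by (auto simp: zagier_set_def mult.assoc)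
      then show ?thesis by simp
    qed
    then show ?thesis using zagier_set_parity(1)[OF n]
      by (auto simp: divisor_pairs_def zagier_set_def)
  qed
  finally show ?thesis using zagier_divisor_recurrence[OF n] by (simp add: case_prod_unfold)
qed

text \<open>
  Sum \<open>n - 5 i\<^sup>2\<close> over all representations of \<open>n\<close> by five odd squares, \<open>i\<close> being the first root.
  By symmetry every root contributes the same total of squares, and the five totals add up to that
  of \<open>n\<close>.
\<close>

lemma odd_quads_recurrence:
  fixes n :: int
  shows "(\<Sum>i | odd i \<and> i\<^sup>2 \<le> n. (n - 5 * i\<^sup>2) * int (card (odd_quads (n - i\<^sup>2)))) = 0"
proof -
  define Q where "Q = Sigma {i. odd i \<and> i\<^sup>2 \<le> n} (\<lambda>i. odd_quads (n - i\<^sup>2))"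
  have Q: "(i, a, b, c, e) \<in> Q \<longleftrightarrow> odd i \<and> odd a \<and> odd b \<and> odd c \<and> odd e \<and> i\<^sup>2 + a\<^sup>2 + b\<^sup>2 + c\<^sup>2 + e\<^sup>2 = n"
    for i a b c e
  proof -
    have "a\<^sup>2 + b\<^sup>2 + c\<^sup>2 + e\<^sup>2 \<ge> 0" by simp
    then have "i\<^sup>2 + a\<^sup>2 + b\<^sup>2 + c\<^sup>2 + e\<^sup>2 = n \<Longrightarrow> i\<^sup>2 \<le> n" by linarith
    then show ?thesis by (auto simp: Q_def odd_quads_def)
  qed
  define s where "s k = (\<Sum>(i, a, b, c, e)\<in>Q. (k i a b c e)\<^sup>2)" for k :: "int \<Rightarrow> int \<Rightarrow> int \<Rightarrow> int \<Rightarrow> int \<Rightarrow> int"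
  have swap:
    "s (\<lambda>i a b c e. a) = s (\<lambda>i a b c e. i)" "s (\<lambda>i a b c e. b) = s (\<lambda>i a b c e. i)"
    "s (\<lambda>i a b c e. c) = s (\<lambda>i a b c e. i)" "s (\<lambda>i a b c e. e) = s (\<lambda>i a b c e. i)"
    unfolding s_def
    subgoal by (rule sum.reindex_bij_witness[of _ "\<lambda>(i,a,b,c,e). (a,i,b,c,e)" "\<lambda>(i,a,b,c,e). (a,i,b,c,e)"]) (auto simp: Q)
    subgoal by (rule sum.reindex_bij_witness[of _ "\<lambda>(i,a,b,c,e). (b,a,i,c,e)" "\<lambda>(i,a,b,c,e). (b,a,i,c,e)"]) (auto simp: Q)
    subgoal by (rule sum.reindex_bij_witness[of _ "\<lambda>(i,a,b,c,e). (c,a,b,i,e)" "\<lambda>(i,a,b,c,e). (c,a,b,i,e)"]) (auto simp: Q)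
    subgoal by (rule sum.reindex_bij_witness[of _ "\<lambda>(i,a,b,c,e). (e,a,b,c,i)" "\<lambda>(i,a,b,c,e). (e,a,b,c,i)"]) (auto simp: Q)
    done
  have "(\<Sum>i | odd i \<and> i\<^sup>2 \<le> n. (n - 5 * i\<^sup>2) * int (card (odd_quads (n - i\<^sup>2))))
      = (\<Sum>i | odd i \<and> i\<^sup>2 \<le> n. \<Sum>y\<in>odd_quads (n - i\<^sup>2). n - 5 * i\<^sup>2)"
    by (intro sum.cong refl) (simp add: mult.commute)
  also have "\<dots> = (\<Sum>(i, y)\<in>Q. n - 5 * i\<^sup>2)"
    unfolding Q_def by (rule sum.Sigma) (auto simp: finite_odd_roots finite_odd_quads)
  also have "\<dots> = (\<Sum>(i,a,b,c,e)\<in>Q. (i\<^sup>2 + a\<^sup>2 + b\<^sup>2 + c\<^sup>2 + e\<^sup>2) - 5 * i\<^sup>2)"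
    by (intro sum.cong refl) (auto simp: Q)
  also have "\<dots> = s (\<lambda>i a b c e. i) + s (\<lambda>i a b c e. a) + s (\<lambda>i a b c e. b) + s (\<lambda>i a b c e. c)
      + s (\<lambda>i a b c e. e) - 5 * s (\<lambda>i a b c e. i)"
    unfolding s_def sum_distrib_left sum.distrib[symmetric] sum_subtractf[symmetric]
    by (intro sum.cong refl) (auto simp: case_prod_unfold)
  finally show ?thesis unfolding swap by simp
qed

text \<open>
  A form of Jacobi's four-square theorem. Both sides satisfy the same recurrence, in which the
  value at \<open>n - 1\<close> has the nonzero coefficient \<open>2 (n - 5)\<close> for \<open>n > 5\<close>, and all other terms are
  values at smaller arguments.
\<close>

lemma card_odd_quads:
  fixes k :: int
  assumes "odd k" "0 < k"
  shows "int (card (odd_quads (4 * k))) =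
    int (card (odd_quads 4)) * (\<Sum>(d, e)\<in>divisor_pairs (4 * k). d)"
proof -
  define u where "u m = int (card (odd_quads m)) -
    int (card (odd_quads 4)) * (\<Sum>(d, e)\<in>divisor_pairs m. d)" for m
  have neg: "u m = 0" if "m \<le> 0" for m
  proof -
    have "odd_quads m = {}"
    proof -
      have False if "(a,b,c,e) \<in> odd_quads m" for a b c e
      proof -
        have "odd a" "a\<^sup>2 + b\<^sup>2 + c\<^sup>2 + e\<^sup>2 = m" using that by (auto simp: odd_quads_def)
        moreover have "a \<noteq> 0" using \<open>odd a\<close> by auto
        then have "a\<^sup>2 > 0" by simp
        moreover have "b\<^sup>2 + c\<^sup>2 + e\<^sup>2 \<ge> 0" by simp
        ultimately show False using \<open>m \<le> 0\<close> by linarith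
      qed
      then show ?thesis by auto
    qed
    moreover have "divisor_pairs m = {}"
    proof -
      have False if "(d,e) \<in> divisor_pairs m" for d e
      proof -
        have "0 < d * e" "4 * (d * e) = m" using that by (auto simp: divisor_pairs_def mult.assoc)
        then show False using \<open>m \<le> 0\<close> by simp
      qed
      then show ?thesis by auto
    qed
    ultimately show ?thesis by (simp add: u_def)
  qed
  have rec: "(\<Sum>i | odd i \<and> i\<^sup>2 \<le> n. (n - 5 * i\<^sup>2) * u (n - i\<^sup>2)) = 0" if "n mod 8 = 5" for n
  proof -
    have "(\<Sum>i | odd i \<and> i\<^sup>2 \<le> n. (n - 5 * i\<^sup>2) * u (n - i\<^sup>2))
      = (\<Sum>i | odd i \<and> i\<^sup>2 \<le> n. (n - 5 * i\<^sup>2) * int (card (odd_quads (n - i\<^sup>2))))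
       - int (card (odd_quads 4)) * (\<Sum>i | odd i \<and> i\<^sup>2 \<le> n. (n - 5 * i\<^sup>2) * (\<Sum>(d, e)\<in>divisor_pairs (n - i\<^sup>2). d))"
      unfolding sum_distrib_left[of "int (card (odd_quads 4))"] sum_subtractf[symmetric]
      by (intro sum.cong refl) (simp add: u_def algebra_simps)
    then show ?thesis using odd_quads_recurrence[of n] divisor_sum_recurrence[OF that] by simp
  qed
  have "u (4 * int j) = 0" if "odd j" for j :: nat
    using that
  proof (induction j rule: less_induct)
    case (less j)
    show ?case
    proof (cases "j = 1")
      case True
      have "divisor_pairs 4 = {(1, 1)}"
      proof -
        have "d = 1 \<and> e = 1" if "0 < d" "0 < e" "d * e = 1" for d e :: int
          using that by (simp add: pos_zmult_eq_1_iff)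
        then show ?thesis by (auto simp: divisor_pairs_def)
      qed
      then show ?thesis using True by (simp add: u_def)
    next
      case False
      define n where "n = 4 * int j + 1"
      have j: "j \<ge> 3" using False less.prems by (metis One_nat_def Suc_1 eval_nat_numeral(3) even_zero le_antisym not_less_eq_eq one_add_one odd_one even_add nat_le_linear le_SucE le0)
      have n8: "n mod 8 = 5" using less.prems unfolding n_def by presburger
      have other: "(n - 5 * i\<^sup>2) * u (n - i\<^sup>2) = 0" if "odd i" "i \<noteq> 1" "i \<noteq> -1" for i
      proof -
        have "\<bar>i\<bar> \<ge> 3" using that by presburger
        then have "\<bar>i\<bar>\<^sup>2 \<ge> 3\<^sup>2" by (intro power_mono) auto
        then have i9: "i\<^sup>2 \<ge> 9" by simp
        show ?thesis
        proof (cases "n - i\<^sup>2 \<le> 0")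
          case True then show ?thesis using neg by simp
        next
          case pos: False
          define k' where "k' = nat ((n - i\<^sup>2) div 4)"
          have "i\<^sup>2 mod 8 = 1" using odd_square_mod_8 that by simp
          then have m: "(n - i\<^sup>2) mod 8 = 4" using n8 by presburger
          then have k': "n - i\<^sup>2 = 4 * int k'" using pos unfolding k'_def by simp presburger
          have "odd k'" using k' m by presburger
          moreover have "k' < j" using k' i9 unfolding n_def by simp
          ultimately have "u (4 * int k') = 0" using less.IH by blast
          then show ?thesis using k' by simp
        qed
      qed
      have "(\<Sum>i | odd i \<and> i\<^sup>2 \<le> n. (n - 5 * i\<^sup>2) * u (n - i\<^sup>2)) = (\<Sum>i\<in>{1,-1}. (n - 5 * i\<^sup>2) * u (n - i\<^sup>2))"
        by (rule sum.mono_neutral_right) (use other j in \<open>auto simp: finite_odd_roots n_def\<close>)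
      then have "2 * ((n - 5) * u (n - 1)) = 0" using rec[OF n8] by auto
      moreover have "n - 5 \<noteq> 0" using j by (simp add: n_def)
      ultimately show ?thesis by (simp add: n_def)
    qed
  qed
  from this[of "nat k"] assms have "u (4 * k) = 0" by (simp add: even_nat_iff)
  then show ?thesis by (simp add: u_def)
qed

text \<open>
  At least half of the representations of \<open>4 k\<close> by odd squares have \<open>a + b + c + e\<close> divisible by 4,
  as changing the sign of \<open>e\<close> changes that residue. For these, the orthogonal matrix with entries
  \<open>\<plusminus> 1 / 2\<close>, followed by halving, gives distinct integral representations of \<open>k\<close>.
\<close>

lemma card_quads_ge:
  fixes k :: int
  assumes "odd k" "0 < k"
  shows "k \<le> 2 * int (card (quads k))"
proof -
  define E where "E = {(a, b, c, e) \<in> odd_quads (4 * k). 4 dvd a + b + c + e}"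
  define E' where "E' = {(a, b, c, e) \<in> odd_quads (4 * k). \<not> 4 dvd a + b + c + e}"
  have finE: "finite E" "finite E'" unfolding E_def E'_def
    by (rule finite_subset[OF _ finite_odd_quads[of "4 * k"]], blast)+
  have "k * 1 \<le> (\<Sum>(d, e)\<in>divisor_pairs (4 * k). d)"
  proof -
    have "(\<Sum>(d, e)\<in>{(k, 1 :: int)}. d) \<le> (\<Sum>(d, e)\<in>divisor_pairs (4 * k). d)"
      by (rule sum_mono2[OF finite_divisor_pairs]) (use assms in \<open>auto simp: divisor_pairs_def\<close>)
    then show ?thesis by simp
  qed
  moreover have "1 \<le> int (card (odd_quads 4))"
  proof -
    have "(1,1,1,1) \<in> odd_quads 4" by (simp add: odd_quads_def)
    then have "card (odd_quads 4) > 0" using finite_odd_quads card_gt_0_iff by blast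
    then show ?thesis by simp
  qed
  ultimately have "1 * k \<le> int (card (odd_quads 4)) * (\<Sum>(d, e)\<in>divisor_pairs (4 * k). d)"
    using assms by (intro mult_mono) auto
  also have "\<dots> = int (card (odd_quads (4 * k)))" by (rule card_odd_quads[OF assms, symmetric])
  also have "card (odd_quads (4 * k)) \<le> card E + card E'"
    using finE by (intro order.trans[OF card_mono card_Un_le]) (auto simp: E_def E'_def)
  also have "card E' \<le> card E"
  proof (rule card_inj_on_le[of "\<lambda>(a, b, c, e). (a, b, c, - e)"])
    show "inj_on (\<lambda>(a, b, c, e). (a, b, c, - e)) E'" by (auto simp: inj_on_def)
    show "(\<lambda>(a, b, c, e). (a, b, c, - e)) ` E' \<subseteq> E"
    proof clarsimp
      fix a b c e assume "(a, b, c, e) \<in> E'"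
      then have *: "(a, b, c, e) \<in> odd_quads (4 * k)" "\<not> 4 dvd a + b + c + e" by (auto simp: E'_def)
      then have "odd a" "odd b" "odd c" "odd e" by (auto simp: odd_quads_def)
      then have "4 dvd a + b + c - e" using *(2) by presburger
      then show "(a, b, c, - e) \<in> E" using * by (auto simp: E_def odd_quads_def)
    qed
  qed (use finE in auto)
  also have "card E \<le> card (quads k)"
  proof (rule card_inj_on_le[of "\<lambda>(a, b, c, e). ((a+b+c+e) div 4, (a+b-c-e) div 4, (a-b+c-e) div 4, (a-b-c+e) div 4)"])
    have ex: "\<exists>w x y z. a+b+c+e = 4*w \<and> a+b-c-e = 4*x \<and> a-b+c-e = 4*y \<and> a-b-c+e = 4*z"
      if "(a,b,c,e) \<in> E" for a b c e
    proof -
      have "odd a" "odd b" "odd c" "odd e" "4 dvd a+b+c+e" using that by (auto simp: E_def odd_quads_def)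
      then have "4 dvd a+b+c+e" "4 dvd a+b-c-e" "4 dvd a-b+c-e" "4 dvd a-b-c+e" by presburger+
      then show ?thesis by (auto elim!: dvdE)
    qed
    show "inj_on (\<lambda>(a, b, c, e). ((a+b+c+e) div 4, (a+b-c-e) div 4, (a-b+c-e) div 4, (a-b-c+e) div 4)) E"
    proof (rule inj_onI, clarsimp)
      fix a b c e a' b' c' e'
      assume "(a,b,c,e) \<in> E" "(a',b',c',e') \<in> E"
      note ex[OF this(1)] ex[OF this(2)]
      moreover assume "(a+b+c+e) div 4 = (a'+b'+c'+e') div 4" "(a+b-c-e) div 4 = (a'+b'-c'-e') div 4"
        "(a-b+c-e) div 4 = (a'-b'+c'-e') div 4" "(a-b-c+e) div 4 = (a'-b'-c'+e') div 4"
      ultimately show "a = a' \<and> b = b' \<and> c = c' \<and> e = e'" by auto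
    qed
    show "(\<lambda>(a, b, c, e). ((a+b+c+e) div 4, (a+b-c-e) div 4, (a-b+c-e) div 4, (a-b-c+e) div 4)) ` E \<subseteq> quads k"
    proof clarsimp
      fix a b c e assume E: "(a,b,c,e) \<in> E"
      then obtain w x y z where wx: "a+b+c+e = 4*w" "a+b-c-e = 4*x" "a-b+c-e = 4*y" "a-b-c+e = 4*z" using ex by blast
      then have abc: "a = w + x + y + z" "b = w + x - y - z" "c = w - x + y - z" "e = w - x - y + z" by simp_all
      have "4 * (w\<^sup>2 + x\<^sup>2 + y\<^sup>2 + z\<^sup>2) = a\<^sup>2 + b\<^sup>2 + c\<^sup>2 + e\<^sup>2" unfolding abc by (simp add: power2_eq_square algebra_simps)
      also have "\<dots> = 4 * k" using E by (auto simp: E_def odd_quads_def)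
      finally show "((a+b+c+e) div 4, (a+b-c-e) div 4, (a-b+c-e) div 4, (a-b-c+e) div 4) \<in> quads k"
        using wx by (simp add: quads_def)
    qed
  qed (use finite_quads in auto)
  finally show ?thesis by simp
qed

text \<open>
  Fix four coordinates. The other coordinates are chosen freely as small even numbers, except that
  one of them is odd when \<open>l\<close> is even; what remains for the four fixed ones is an odd number
  of size at least \<open>l / 2\<close>, to which the four-square bound applies.
\<close>

lemma card_lattice_sphere_ge:
  fixes l :: int and m :: nat
  assumes d: "CARD('d::finite) \<ge> 5" and m: "8 * int CARD('d) * int m ^ 2 \<le> l" and "m \<ge> 1"
  shows "real m ^ (CARD('d) - 4) * (real_of_int l / 4) \<le> real (card (lattice_sphere l :: (int ^ 'd) set))"
proof -
  obtain xs :: "'d list" where xs: "set xs = UNIV" "distinct xs"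
    using finite_distinct_list[of "UNIV :: 'd set"] by auto
  then have len: "length xs \<ge> 5" using d distinct_card[of xs] by simp
  define i0 i1 i2 i3 i4 where "i0 = xs ! 0" "i1 = xs ! 1" "i2 = xs ! 2" "i3 = xs ! 3" "i4 = xs ! 4"
  note i_def = this
  have neq: "i0 \<noteq> i1" "i0 \<noteq> i2" "i0 \<noteq> i3" "i0 \<noteq> i4" "i1 \<noteq> i2" "i1 \<noteq> i3" "i1 \<noteq> i4" "i2 \<noteq> i3" "i2 \<noteq> i4" "i3 \<noteq> i4"
  proof -
    have "xs ! i \<noteq> xs ! j" if "i < 5" "j < 5" "i \<noteq> j" for i j
      using nth_eq_iff_index_eq[OF xs(2), of i j] that len by simp
    then show "i0 \<noteq> i1" "i0 \<noteq> i2" "i0 \<noteq> i3" "i0 \<noteq> i4" "i1 \<noteq> i2" "i1 \<noteq> i3" "i1 \<noteq> i4" "i2 \<noteq> i3" "i2 \<noteq> i4" "i3 \<noteq> i4"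
      unfolding i_def by simp_all
  qed
  define I4 where "I4 = {i1, i2, i3, i4}"
  have card4: "card I4 = 4" unfolding I4_def using neq by simp
  have i0: "i0 \<in> - I4" using neq by (auto simp: I4_def)
  define Y where "Y = PiE (- I4) (\<lambda>_. {0..<int m})"
  define b :: int where "b = (if even l then 1 else 0)"
  define w where "w y i = 2 * y i + (if i = i0 then b else 0)" for y :: "'d \<Rightarrow> int" and i
  define s where "s y = (\<Sum>i\<in>-I4. (w y i)\<^sup>2)" for y
  have cardY: "card Y = m ^ (CARD('d) - 4)"
  proof -
    have "card (- I4) = CARD('d) - 4" using card_Diff_subset[of I4 UNIV] card4 by (simp add: Compl_eq_Diff_UNIV)
    then show ?thesis unfolding Y_def by (simp add: card_PiE)
  qed
  have finY: "finite Y" unfolding Y_def by (simp add: finite_PiE)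
  have lpos: "l > 0"
  proof -
    have "0 < 8 * int CARD('d) * int m ^ 2" using \<open>m \<ge> 1\<close> by simp
    then show ?thesis using m by linarith
  qed
  have sle: "2 * s y \<le> l" if "y \<in> Y" for y
  proof -
    have "(w y i)\<^sup>2 \<le> (2 * int m)\<^sup>2" if "i \<in> - I4" for i
    proof -
      have "0 \<le> y i" "y i < int m" using \<open>y \<in> Y\<close> that unfolding Y_def by (auto dest: PiE_mem)
      then show ?thesis unfolding w_def b_def by (intro power_mono) auto
    qed
    then have "s y \<le> (\<Sum>i\<in>-I4. (2 * int m)\<^sup>2)" unfolding s_def by (rule sum_mono)
    also have "\<dots> \<le> (\<Sum>i\<in>(UNIV :: 'd set). (2 * int m)\<^sup>2)" by (rule sum_mono2) auto
    also have "\<dots> = 4 * int CARD('d) * int m ^ 2" by (simp add: power_mult_distrib)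
    finally show ?thesis using m by simp
  qed
  have sodd: "odd (l - s y)" for y
  proof -
    have "s y = (w y i0)\<^sup>2 + (\<Sum>i\<in>-I4-{i0}. (w y i)\<^sup>2)"
      unfolding s_def using i0 by (subst sum.remove[of _ i0]) auto
    also have "(\<Sum>i\<in>-I4-{i0}. (w y i)\<^sup>2) = (\<Sum>i\<in>-I4-{i0}. 2 * (2 * (y i)\<^sup>2))"
      by (intro sum.cong refl) (auto simp: w_def power_mult_distrib)
    also have "\<dots> = 2 * (\<Sum>i\<in>-I4-{i0}. 2 * (y i)\<^sup>2)" by (rule sum_distrib_left[symmetric])
    finally have "even (s y) = even (w y i0)" by simp
    also have "\<dots> = even b" by (simp add: w_def)
    finally show ?thesis by (simp add: b_def split: if_splits)
  qed
  define vec where "vec = (\<lambda>(y, (p, q, r, t)). (\<chi> i. if i = i1 then p else if i = i2 then q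
      else if i = i3 then r else if i = i4 then t else w y i) :: int ^ 'd)"
  have "real m ^ (CARD('d) - 4) * (real_of_int l / 4) = (\<Sum>y\<in>Y. real_of_int l / 4)"
    by (simp add: cardY)
  also have "\<dots> \<le> (\<Sum>y\<in>Y. real (card (quads (l - s y))))"
  proof (rule sum_mono)
    fix y assume "y \<in> Y"
    note sle[OF this]
    moreover have "l - s y \<le> 2 * int (card (quads (l - s y)))"
      by (rule card_quads_ge) (use sodd[of y] calculation lpos in \<open>auto simp: \<close>)
    ultimately show "real_of_int l / 4 \<le> real (card (quads (l - s y)))" by linarith
  qed
  also have "\<dots> = real (card (Sigma Y (\<lambda>y. quads (l - s y))))"
    using finY by (simp add: card_SigmaI finite_quads)
  also have "\<dots> \<le> real (card (lattice_sphere l :: (int ^ 'd) set))"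
  proof (rule of_nat_mono, rule card_inj_on_le[of vec])
    show "inj_on vec (Sigma Y (\<lambda>y. quads (l - s y)))"
    proof (rule inj_onI, clarsimp)
      fix y p q r t y' p' q' r' t'
      assume y: "y \<in> Y" "y' \<in> Y" and eq: "vec (y, p, q, r, t) = vec (y', p', q', r', t')"
      have c: "vec (y, p, q, r, t) $ i = vec (y', p', q', r', t') $ i" for i using eq by simp
      have "p = p' \<and> q = q' \<and> r = r' \<and> t = t'"
        using c[of i1] c[of i2] c[of i3] c[of i4] neq by (simp add: vec_def)
      moreover have "y i = y' i" if "i \<in> - I4" for i
        using c[of i] that by (auto simp: vec_def w_def I4_def split: if_splits)
      then have "y = y'" using y unfolding Y_def by (intro PiE_ext)
      ultimately show "y = y' \<and> p = p' \<and> q = q' \<and> r = r' \<and> t = t'" by simp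
    qed
    show "vec ` Sigma Y (\<lambda>y. quads (l - s y)) \<subseteq> lattice_sphere l"
    proof clarsimp
      fix y p q r t assume "(p, q, r, t) \<in> quads (l - s y)"
      then have q: "p\<^sup>2 + q\<^sup>2 + r\<^sup>2 + t\<^sup>2 = l - s y" by (simp add: quads_def)
      let ?v = "vec (y, p, q, r, t)"
      have "norm_sq ?v = (\<Sum>i\<in>I4. (?v $ i)\<^sup>2) + (\<Sum>i\<in>-I4. (?v $ i)\<^sup>2)"
        unfolding norm_sq_def
        using sum.subset_diff[of I4 UNIV "\<lambda>i. (?v $ i)\<^sup>2"] by (simp add: Compl_eq_Diff_UNIV add.commute)
      also have "(\<Sum>i\<in>I4. (?v $ i)\<^sup>2) = p\<^sup>2 + q\<^sup>2 + r\<^sup>2 + t\<^sup>2"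
        unfolding I4_def using neq by (simp add: vec_def)
      also have "(\<Sum>i\<in>-I4. (?v $ i)\<^sup>2) = s y"
        unfolding s_def by (intro sum.cong refl) (auto simp: vec_def I4_def)
      finally show "?v \<in> lattice_sphere l" using q by (simp add: lattice_sphere_def)
    qed
  qed simp
  finally show ?thesis .
qed

lemma card_lattice_sphere_lower_bound:
  assumes d: "CARD('d::finite) \<ge> 5"
  shows "\<exists>c>0. \<forall>l::int. real_of_int l \<ge> 8 * real CARD('d) \<longrightarrow>
    c * sqrt (real_of_int l) ^ (CARD('d) - 2) \<le> real (card (lattice_sphere l :: (int ^ 'd) set))"
proof (intro exI conjI allI impI)
  let ?d = "real CARD('d)"
  define c where "c = (1 / (2 * sqrt (8 * ?d))) ^ (CARD('d) - 4) / 4"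
  show "0 < c" unfolding c_def by simp
  fix l :: int assume l: "real_of_int l \<ge> 8 * ?d"
  define x where "x = sqrt (real_of_int l) / sqrt (8 * ?d)"
  have x1: "x \<ge> 1" unfolding x_def using l by (simp add: real_sqrt_le_iff)
  define m where "m = nat \<lfloor>x\<rfloor>"
  have m: "m \<ge> 1" "real m \<le> x" "x / 2 \<le> real m" using x1 proof -
    have f: "1 \<le> \<lfloor>x\<rfloor>" using x1 by simp
    then show "m \<ge> 1" "real m \<le> x" unfolding m_def by linarith+
    have "1 \<le> real_of_int \<lfloor>x\<rfloor>" using f by linarith
    moreover have "x < real_of_int \<lfloor>x\<rfloor> + 1" by linarith
    moreover have "real m = real_of_int \<lfloor>x\<rfloor>" using f unfolding m_def by simp
    ultimately show "x / 2 \<le> real m" by linarith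
  qed
  have "x\<^sup>2 = real_of_int l / (8 * ?d)" unfolding x_def using l by (simp add: power_divide)
  then have "8 * ?d * x\<^sup>2 = real_of_int l" by simp
  moreover have "(real m)\<^sup>2 \<le> x\<^sup>2" using m by (intro power_mono) auto
  then have "8 * ?d * (real m)\<^sup>2 \<le> 8 * ?d * x\<^sup>2" by (intro mult_left_mono) auto
  ultimately have "real_of_int (8 * int CARD('d) * int m ^ 2) \<le> real_of_int l" by simp
  then have "8 * int CARD('d) * int m ^ 2 \<le> l" by linarith
  note * = card_lattice_sphere_ge[OF d this m(1)]
  have "c * sqrt (real_of_int l) ^ (CARD('d) - 2)
      = (1 / (2 * sqrt (8 * ?d))) ^ (CARD('d) - 4) / 4 * (sqrt (real_of_int l) ^ (CARD('d) - 4) * sqrt (real_of_int l) ^ 2)"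
  proof -
    have "CARD('d) - 2 = CARD('d) - 4 + 2" using d by simp
    then show ?thesis unfolding c_def by (simp only: power_add)
  qed
  also have "\<dots> = (x / 2) ^ (CARD('d) - 4) * (real_of_int l / 4)"
    using l unfolding x_def by (simp add: power_divide power_mult_distrib)
  also have "\<dots> \<le> real m ^ (CARD('d) - 4) * (real_of_int l / 4)"
    using m x1 l by (intro mult_right_mono power_mono) auto
  also note *
  finally show "c * sqrt (real_of_int l) ^ (CARD('d) - 2) \<le> real (card (lattice_sphere l :: (int ^ 'd) set))" .
qed

section \<open>Weyl sums\<close>

definition expi :: "real \<Rightarrow> complex" where
  "expi x = cis (2 * pi * x)"

lemma norm_expi [simp]: "norm (expi x) = 1" by (simp add: expi_def)
lemma expi_0 [simp]: "expi 0 = 1" by (simp add: expi_def)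
lemma expi_add: "expi (x + y) = expi x * expi y" by (simp add: expi_def cis_mult algebra_simps)
lemma expi_minus: "expi (- x) = cnj (expi x)" by (simp add: expi_def cis_cnj)
lemma expi_diff: "expi (x - y) = expi x * cnj (expi y)"
  using expi_add[of x "- y"] by (simp add: expi_minus)
lemma expi_sum: "expi (\<Sum>i\<in>A. f i) = (\<Prod>i\<in>A. expi (f i))"
  by (induction A rule: infinite_finite_induct) (auto simp: expi_add)
lemma expi_int [simp]: "expi (of_int n) = 1"
  unfolding expi_def by (rule cis_multiple_2pi) simp
lemma expi_add_int: "expi (x + of_int n) = expi x" by (simp add: expi_add)

definition dist_int :: "real \<Rightarrow> real" where
  "dist_int x = \<bar>x - of_int (round x)\<bar>"

lemma dist_int_le: "dist_int x \<le> \<bar>x - of_int n\<bar>"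
  unfolding dist_int_def by (rule round_diff_minimal)
lemma dist_int_nonneg [simp]: "0 \<le> dist_int x" by (simp add: dist_int_def)
lemma dist_int_le_half: "dist_int x \<le> 1 / 2"
  unfolding dist_int_def using of_int_round_abs_le[of x] by (simp add: abs_minus_commute)
lemma dist_int_int_mult_le: "dist_int (of_int n * x) \<le> \<bar>of_int n\<bar> * dist_int x"
proof -
  have "dist_int (of_int n * x) \<le> \<bar>of_int n * x - of_int (n * round x)\<bar>" by (rule dist_int_le)
  also have "\<dots> = \<bar>of_int n\<bar> * dist_int x" unfolding dist_int_def
    by (simp add: abs_mult[symmetric] algebra_simps)
  finally show ?thesis .
qed
lemma dist_int_triangle: "dist_int x \<le> dist_int y + \<bar>x - y\<bar>"
  using dist_int_le[of x "round y"] unfolding dist_int_def by linarith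
lemma dist_int_eq: "\<bar>x\<bar> \<le> 1 / 2 \<Longrightarrow> dist_int x = \<bar>x\<bar>"
proof -
  assume x: "\<bar>x\<bar> \<le> 1 / 2"
  have "dist_int x \<le> \<bar>x\<bar>" using dist_int_le[of x 0] by simp
  moreover have "\<bar>x\<bar> \<le> dist_int x"
  proof (cases "round x = 0")
    case False
    then have "\<bar>of_int (round x) :: real\<bar> \<ge> 1" by linarith
    then show ?thesis unfolding dist_int_def using x by linarith
  qed (simp add: dist_int_def)
  ultimately show ?thesis by simp
qed

lemma norm_expi_minus_one_eq: "norm (expi x - 1) = 2 * \<bar>sin (pi * x)\<bar>"
proof -
  have "cos (2 * pi * x) = 1 - 2 * (sin (pi * x))\<^sup>2"
    using cos_double_sin[of "pi * x"] by (simp add: mult.assoc mult.left_commute)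
  moreover have "(norm (expi x - 1))\<^sup>2 = (cos (2 * pi * x) - 1)\<^sup>2 + (sin (2 * pi * x))\<^sup>2"
    by (simp add: cmod_power2 expi_def)
  ultimately have "(norm (expi x - 1))\<^sup>2 = (2 * \<bar>sin (pi * x)\<bar>)\<^sup>2"
    using sin_cos_squared_add[of "2 * pi * x"] by (simp add: power2_eq_square algebra_simps)
  then show ?thesis by (rule power2_eq_imp_eq) auto
qed

lemma norm_expi_minus_one_le: "norm (expi x - 1) \<le> 7 * \<bar>x\<bar>"
proof -
  have "\<bar>sin (pi * x)\<bar> \<le> \<bar>pi * x\<bar>" by (rule abs_sin_x_le_abs_x)
  also have "\<dots> \<le> 3.2 * \<bar>x\<bar>" unfolding abs_mult using pi_approx by (intro mult_right_mono) auto
  finally show ?thesis unfolding norm_expi_minus_one_eq by simp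
qed

text \<open>
  The third-order Taylor polynomial is a lower bound, and \<open>x\<^sup>2 / 6 \<le> 1 / 2\<close> on this interval.
\<close>

lemma sin_ge_half: "0 \<le> x \<Longrightarrow> x \<le> pi / 2 \<Longrightarrow> x / 2 \<le> sin (x::real)"
proof -
  assume x: "0 \<le> x" "x \<le> pi / 2"
  then have "x \<le> 1.6" using pi_approx by simp
  show ?thesis
  proof (cases "x = 0")
    case False
    have "\<exists>t. 0 < t \<and> t < x \<and> sin x = (\<Sum>m<4. sin_coeff m * x ^ m) + (sin (t + 1 / 2 * real 4 * pi) / fact 4) * x ^ 4"
      using False x(1) by (intro Maclaurin_sin_expansion3) auto
    then obtain t where t: "0 < t" "t < x" and eq: "sin x = (\<Sum>m<4. sin_coeff m * x ^ m) + (sin (t + 1 / 2 * real 4 * pi) / fact 4) * x ^ 4" by blast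
    have "sin (t + 1 / 2 * real 4 * pi) = sin t" by (simp add: sin_add)
    moreover have "sin t \<ge> 0" using t x by (intro sin_ge_zero) auto
    ultimately have "sin x \<ge> (\<Sum>m<4. sin_coeff m * x ^ m)" unfolding eq by simp
    also have "{..<4::nat} = {0, 1, 2, 3}" by auto
    also have "(\<Sum>m\<in>\<dots>. sin_coeff m * x ^ m) = x - x ^ 3 / 6"
      by (simp add: sin_coeff_def fact_numeral)
    finally have "x - x ^ 3 / 6 \<le> sin x" .
    moreover have "x * x \<le> 1.6 * 1.6" using x(1) \<open>x \<le> 1.6\<close> by (intro mult_mono) auto
    then have "x ^ 3 \<le> 1.6\<^sup>2 * x" using mult_right_mono[OF _ x(1), of "x * x" "1.6 * 1.6"]
      by (simp add: power3_eq_cube power2_eq_square)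
    ultimately show ?thesis using x by (simp add: power2_eq_square)
  qed simp
qed

lemma norm_expi_minus_one_ge: "2 * dist_int x \<le> norm (expi x - 1)"
proof -
  define y where "y = x - of_int (round x)"
  have y: "\<bar>y\<bar> \<le> 1 / 2" using dist_int_le_half[of x] by (simp add: y_def dist_int_def)
  have "expi x = expi y" using expi_add_int[of y "round x"] by (simp add: y_def)
  then have "norm (expi x - 1) = 2 * \<bar>sin (pi * y)\<bar>" by (simp add: norm_expi_minus_one_eq)
  also have "\<bar>sin (pi * y)\<bar> = \<bar>sin (pi * \<bar>y\<bar>)\<bar>" by (cases "y \<ge> 0") simp_all
  finally have "norm (expi x - 1) = 2 * \<bar>sin (pi * \<bar>y\<bar>)\<bar>" .
  moreover have "pi * \<bar>y\<bar> / 2 \<le> sin (pi * \<bar>y\<bar>)" using y by (intro sin_ge_half) auto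
  ultimately have "norm (expi x - 1) \<ge> pi * \<bar>y\<bar>" by linarith
  moreover have "pi * \<bar>y\<bar> \<ge> 2 * \<bar>y\<bar>" using pi_ge_two by (intro mult_right_mono) auto
  ultimately show ?thesis by (simp add: y_def dist_int_def)
qed

lemma norm_geometric_expi:
  fixes a b :: int
  shows "norm (\<Sum>m\<in>{a..b}. expi (of_int m * x)) * dist_int x \<le> 1"
proof (cases "a \<le> b")
  case True
  let ?S = "\<Sum>m\<in>{a..b}. expi (of_int m * x)"
  have *: "?S * expi x = (\<Sum>m\<in>{a+1..b+1}. expi (of_int m * x))"
    unfolding sum_distrib_right expi_add[symmetric]
    by (rule sum.reindex_bij_witness[of _ "\<lambda>m. m - 1" "\<lambda>m. m + 1"]) (auto simp: algebra_simps)
  have "{a..b} = insert a {a+1..b}" "{a+1..b+1} = insert (b+1) {a+1..b}" using True by auto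
  then have "?S * expi x - ?S = expi (of_int (b + 1) * x) - expi (of_int a * x)"
    unfolding * by simp
  then have "?S * (expi x - 1) = expi (of_int (b + 1) * x) - expi (of_int a * x)"
    by (simp add: right_diff_distrib)
  then have "norm (?S * (expi x - 1)) \<le> 2"
    using norm_triangle_ineq4[of "expi (of_int (b + 1) * x)" "expi (of_int a * x)"] by simp
  then have "norm ?S * norm (expi x - 1) \<le> 2" by (simp add: norm_mult)
  moreover have "norm ?S * (2 * dist_int x) \<le> norm ?S * norm (expi x - 1)"
    by (intro mult_left_mono norm_expi_minus_one_ge) auto
  ultimately show ?thesis by simp
qed simp

definition weyl_sum :: "nat \<Rightarrow> real \<Rightarrow> real \<Rightarrow> complex" where
  "weyl_sum R \<theta> \<xi> = (\<Sum>m\<in>{- int R..int R}. expi (\<theta> * of_int (m\<^sup>2) + \<xi> * of_int m))"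

lemma norm_weyl_sum_le: "norm (weyl_sum R \<theta> \<xi>) \<le> 2 * real R + 1"
proof -
  have "norm (weyl_sum R \<theta> \<xi>) \<le> (\<Sum>m\<in>{- int R..int R}. 1)"
    unfolding weyl_sum_def by (rule sum_norm_le) simp
  then show ?thesis by simp
qed

text \<open>
  Squaring the Weyl sum and collecting the pairs of indices with difference \<open>h\<close> leaves geometric
  sums with ratio \<open>expi (2 h \<theta>)\<close>. The linear coefficient \<open>\<xi>\<close> appears only in unimodular factors, so
  that the bound is uniform in \<open>\<xi>\<close>. The majorants are indexed by \<open>g = 2 h\<close>.
\<close>

lemma weyl_differencing:
  "\<exists>\<alpha>. (\<forall>g. 0 \<le> \<alpha> g \<and> \<alpha> g \<le> 2 * real R + 1 \<and> \<alpha> g * dist_int (of_int g * \<theta>) \<le> 1) \<and>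
       (\<forall>\<xi>. (norm (weyl_sum R \<theta> \<xi>))\<^sup>2 \<le> (\<Sum>g\<in>{- 4 * int R..4 * int R}. \<alpha> g))"
proof -
  define lo hi where "lo h = max (- int R) (- int R - h)" and "hi h = min (int R) (int R - h)" for h
  define \<beta> where "\<beta> h = norm (\<Sum>n\<in>{lo h..hi h}. expi (of_int n * (of_int (2 * h) * \<theta>)))" for h
  define \<alpha> where "\<alpha> g = (if even g then \<beta> (g div 2) else 0)" for g
  have \<beta>le: "\<beta> h \<le> 2 * real R + 1" for h
  proof -
    have "\<beta> h \<le> (\<Sum>n\<in>{lo h..hi h}. 1)" unfolding \<beta>_def by (rule sum_norm_le) simp
    also have "\<dots> = real (card {lo h..hi h})" by simp
    also have "card {lo h..hi h} \<le> card {- int R..int R}"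
      by (rule card_mono) (auto simp: lo_def hi_def)
    finally show ?thesis by simp
  qed
  have \<alpha>: "0 \<le> \<alpha> g \<and> \<alpha> g \<le> 2 * real R + 1 \<and> \<alpha> g * dist_int (of_int g * \<theta>) \<le> 1" for g
  proof (cases "even g")
    case True
    then have "2 * (g div 2) = g" by simp
    then have "\<alpha> g * dist_int (of_int g * \<theta>) \<le> 1"
      using norm_geometric_expi[of "of_int g * \<theta>" "lo (g div 2)" "hi (g div 2)"] True
      by (simp add: \<alpha>_def \<beta>_def)
    then show ?thesis using True \<beta>le by (simp add: \<alpha>_def) (simp add: \<beta>_def)
  qed (simp add: \<alpha>_def)
  have "(norm (weyl_sum R \<theta> \<xi>))\<^sup>2 \<le> (\<Sum>g\<in>{- 4 * int R..4 * int R}. \<alpha> g)" for \<xi>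
  proof -
    let ?I = "{- int R..int R}" and ?f = "\<lambda>m. expi (\<theta> * of_int (m\<^sup>2) + \<xi> * of_int m)"
    have "complex_of_real ((norm (weyl_sum R \<theta> \<xi>))\<^sup>2) = weyl_sum R \<theta> \<xi> * cnj (weyl_sum R \<theta> \<xi>)"
      by (rule complex_norm_square)
    also have "\<dots> = (\<Sum>(m, n)\<in>?I \<times> ?I. ?f m * cnj (?f n))"
      unfolding weyl_sum_def cnj_sum sum_product sum.cartesian_product ..
    also have "\<dots> = (\<Sum>(h, n)\<in>Sigma {-2 * int R..2 * int R} (\<lambda>h. {lo h..hi h}). ?f (n + h) * cnj (?f n))"
      by (rule sum.reindex_bij_witness[of _ "\<lambda>(h, n). (n + h, n)" "\<lambda>(m, n). (m - n, n)"])
         (auto simp: lo_def hi_def)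
    also have "\<dots> = (\<Sum>h\<in>{-2 * int R..2 * int R}. \<Sum>n\<in>{lo h..hi h}. ?f (n + h) * cnj (?f n))"
      by (rule sum.Sigma[symmetric]) auto
    also have "\<dots> = (\<Sum>h\<in>{-2 * int R..2 * int R}. expi (\<theta> * of_int (h\<^sup>2) + \<xi> * of_int h) *
        (\<Sum>n\<in>{lo h..hi h}. expi (of_int n * (of_int (2 * h) * \<theta>))))"
      unfolding sum_distrib_left expi_diff[symmetric] expi_add[symmetric]
      by (intro sum.cong refl arg_cong[of _ _ expi]) (simp add: power2_eq_square algebra_simps)
    finally have "(norm (weyl_sum R \<theta> \<xi>))\<^sup>2 = norm \<dots>"
      by (metis abs_of_nonneg norm_of_real zero_le_power2)
    also have "\<dots> \<le> (\<Sum>h\<in>{-2 * int R..2 * int R}. \<beta> h)"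
      unfolding \<beta>_def by (rule order.trans[OF norm_sum]) (simp add: norm_mult)
    also have "\<dots> = (\<Sum>g\<in>{g \<in> {- 4 * int R..4 * int R}. even g}. \<alpha> g)"
      by (rule sum.reindex_bij_witness[of _ "\<lambda>g. g div 2" "\<lambda>h. 2 * h"]) (auto simp: \<alpha>_def)
    also have "\<dots> \<le> (\<Sum>g\<in>{- 4 * int R..4 * int R}. \<alpha> g)"
      using \<alpha> by (intro sum_mono2) auto
    finally show ?thesis .
  qed
  then show ?thesis using \<alpha> by blast
qed

lemma harm_le_ln: "n \<ge> 1 \<Longrightarrow> (\<Sum>b=1..n. 1 / real b) \<le> 1 + ln (real n)"
proof -
  assume n: "n \<ge> 1"
  have "harm (Suc (n - 1)) - ln (real (Suc (n - 1))) \<le> harm (Suc 0) - ln (real (Suc 0))"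
    using decseq_harm_diff_ln unfolding decseq_def by blast
  then have "harm n - ln (real n) \<le> 1" using n by (simp add: harm_expand)
  then show ?thesis by (simp add: harm_def inverse_eq_divide)
qed

text \<open>
  The power sum that replaces a logarithmic one: an exponent slightly above \<open>- 1\<close> costs a small
  power instead of a logarithm, and powers can be afforded later.
\<close>

lemma sum_powr_le: "(\<Sum>i=1..n. real i powr (- 9 / 10)) \<le> 10 * real n powr (1 / 10)"
proof (induction n)
  case (Suc n)
  have "real (Suc n) powr (- 9 / 10) \<le> 10 * (real (Suc n) powr (1 / 10) - real n powr (1 / 10))"
  proof -
    define y where "y = (real n / real (Suc n)) powr (1 / 10)"
    have "y ^ 10 = y powr (real 10)" unfolding y_def by (cases "n = 0") (simp_all add: powr_realpow)
    also have "\<dots> = real n / real (Suc n)" unfolding y_def by (simp add: powr_powr)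
    finally have "1 + real 10 * (y - 1) \<le> real n / real (Suc n)"
      using Bernoulli_inequality[of "y - 1" 10] by (simp add: y_def)
    also have "\<dots> = 1 - 1 / real (Suc n)" by (simp add: field_simps)
    finally have "1 / real (Suc n) \<le> 10 * (1 - y)" by simp
    then have "real (Suc n) powr (1 / 10) * (1 / real (Suc n)) \<le> real (Suc n) powr (1 / 10) * (10 * (1 - y))"
      by (intro mult_left_mono) auto
    moreover have "real (Suc n) powr (1 / 10) * (1 / real (Suc n)) = real (Suc n) powr (- 9 / 10)"
      using powr_diff[of "real (Suc n)" "1 / 10" 1] by simp
    moreover have "real (Suc n) powr (1 / 10) * y = real n powr (1 / 10)"
      unfolding y_def by (subst powr_mult[symmetric]) auto
    ultimately show ?thesis by (simp add: algebra_simps)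
  qed
  then show ?case using Suc.IH by simp
qed simp

text \<open>
  Multiplication by \<open>a\<close> permutes the residues modulo \<open>q\<close>, so the set lies in one residue class,
  on which division by \<open>q\<close> is injective.
\<close>

lemma card_residue_class_le:
  fixes a b q :: int
  assumes "coprime a q" "0 < q" and True: "K \<ge> 0"
  shows "real (card {g \<in> {- K..K}. g * a mod q = b}) \<le> 2 * real_of_int K / real_of_int q + 2"
proof -
  let ?A = "{g \<in> {- K..K}. g * a mod q = b}"
  have "card ?A \<le> card {(- K) div q..K div q}"
  proof (rule card_inj_on_le[of "\<lambda>g. g div q"])
    show "inj_on (\<lambda>g. g div q) ?A"
    proof (rule inj_onI)
      fix g g' assume *: "g \<in> ?A" "g' \<in> ?A" "g div q = g' div q"
      then have "g * a mod q = g' * a mod q" by auto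
      then have "q dvd g * a - g' * a" by (simp only: mod_eq_dvd_iff)
      then have "q dvd (g - g') * a" by (simp add: algebra_simps)
      then have "q dvd g - g'" using assms by (simp add: coprime_dvd_mult_left_iff coprime_commute)
      then have "g mod q = g' mod q" by (simp add: mod_eq_dvd_iff)
      then show "g = g'" using *(3) by (metis div_mult_mod_eq)
    qed
    show "(\<lambda>g. g div q) ` ?A \<subseteq> {(- K) div q..K div q}"
      using assms by (auto intro: zdiv_mono1)
  qed simp
  then have "real (card ?A) \<le> real (card {(- K) div q..K div q})" by simp
  also have "\<dots> = real_of_int (K div q) - real_of_int ((- K) div q) + 1"
    using True assms by (simp add: zdiv_mono1)
  finally show ?thesis
    using real_of_int_div4[of K q] real_of_int_div3[of "-K" q] by simp
qed

lemma dist_int_fraction_ge: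
  fixes b q :: int
  assumes "0 < b" "b < q"
  shows "1 / dist_int (of_int b / of_int q) \<le> of_int q * (1 / of_int b + 1 / of_int (q - b))"
    and "1 / of_int q \<le> dist_int (of_int b / of_int q)"
proof -
  let ?x = "real_of_int b / real_of_int q"
  have q: "real_of_int q > 0" using assms by simp
  have *: "dist_int ?x \<ge> of_int b / of_int q \<or> dist_int ?x \<ge> of_int (q - b) / of_int q"
  proof (cases "round ?x \<le> 0")
    case True
    then have "real_of_int (round ?x) \<le> 0" by simp
    then show ?thesis unfolding dist_int_def by linarith
  next
    case False
    then have "real_of_int (round ?x) \<ge> 1" by linarith
    moreover have "of_int (q - b) / of_int q = 1 - ?x" using q by (simp add: field_simps)
    ultimately show ?thesis unfolding dist_int_def by linarith
  qed
  have b1: "1 \<le> real_of_int b" "1 \<le> real_of_int (q - b)" using assms by linarith+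
  then have "1 / real_of_int q \<le> of_int b / of_int q" "1 / real_of_int q \<le> of_int (q - b) / of_int q"
    using q by (simp_all add: divide_right_mono)
  then show ge: "1 / of_int q \<le> dist_int ?x" using * by linarith
  have pos: "0 < dist_int ?x" using ge q by (smt (verit) divide_pos_pos)
  have e: "of_int q * (1 / of_int b + 1 / of_int (q - b)) = of_int q / of_int b + of_int q / (of_int (q - b) :: real)"
    by (simp add: ring_distribs)
  have p: "of_int q / real_of_int b \<ge> 0" "of_int q / real_of_int (q - b) \<ge> 0" using assms by simp_all
  from * show "1 / dist_int ?x \<le> of_int q * (1 / of_int b + 1 / of_int (q - b))"
  proof
    assume "dist_int ?x \<ge> of_int b / of_int q"
    then have "1 / dist_int ?x \<le> 1 / (of_int b / of_int q)" using b1 q by (intro frac_le) auto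
    then show ?thesis unfolding e using p by simp
  next
    assume "dist_int ?x \<ge> of_int (q - b) / of_int q"
    then have "1 / dist_int ?x \<le> 1 / (of_int (q - b) / of_int q)" using b1 q by (intro frac_le) auto
    then show ?thesis unfolding e using p by simp
  qed
qed

text \<open>
  If \<open>q\<close> does not divide \<open>g\<close>, then \<open>g a / q\<close> has distance at least \<open>1 / q\<close> from the integers, whereas
  \<open>g \<theta>\<close> differs from it by at most \<open>1 / (2 q)\<close>. Hence \<open>\<theta>\<close> may be replaced by \<open>a / q\<close>, and the sum over
  each residue class of \<open>g a\<close> is a term of a harmonic sum.
\<close>

lemma sum_non_multiples_le:
  fixes q a :: int and R :: nat and \<alpha> :: "int \<Rightarrow> real"
  assumes "coprime a q" "1 \<le> q" "q \<le> 8 * int R" "R \<ge> 1"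
    and close: "\<bar>of_int q * \<theta> - of_int a\<bar> \<le> 1 / (8 * real R)"
    and \<alpha>: "\<And>g. \<alpha> g \<ge> 0" "\<And>g. \<alpha> g * dist_int (of_int g * \<theta>) \<le> 1"
  shows "(\<Sum>g\<in>{g \<in> {- 4 * int R..4 * int R}. \<not> q dvd g}. \<alpha> g) \<le> 96 * real R * (1 + ln (8 * real R))"
proof -
  define G where "G = {g \<in> {- 4 * int R..4 * int R}. \<not> q dvd g}"
  define \<phi> :: "int \<Rightarrow> real" where "\<phi> b = 2 * (of_int q * (1 / of_int b + 1 / of_int (q - b)))" for b :: int
  have q: "real_of_int q > 0" "q > 0" using assms by auto
  have R: "real R \<ge> 1" using assms by simp
  have b: "0 < g * a mod q" "g * a mod q < q" if "g \<in> G" for g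
  proof -
    have "\<not> q dvd g * a" using that assms(1) by (auto simp: G_def coprime_dvd_mult_left_iff coprime_commute)
    then have "g * a mod q \<noteq> 0" by (simp add: dvd_eq_mod_eq_0)
    then show "0 < g * a mod q" using q pos_mod_sign[of q "g * a"] by linarith
    show "g * a mod q < q" using q by simp
  qed
  have le: "\<alpha> g \<le> \<phi> (g * a mod q)" if g: "g \<in> G" for g
  proof -
    let ?b = "g * a mod q" and ?y = "real_of_int g * of_int a / of_int q"
    have y: "?y = of_int ?b / of_int q + of_int (g * a div q)"
    proof -
      have "real_of_int (g * a) = of_int (g * a div q) * of_int q + of_int ?b"
        by (metis div_mult_mod_eq of_int_add of_int_mult)
      then show ?thesis using q by (simp add: field_simps)
    qed
    have "dist_int (of_int ?b / of_int q) \<le> \<bar>of_int ?b / of_int q - of_int (round ?y - g * a div q)\<bar>"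
      by (rule dist_int_le)
    also have "\<dots> = dist_int ?y" unfolding dist_int_def using y by simp
    finally have 1: "dist_int (of_int ?b / of_int q) \<le> dist_int ?y" .
    note 2 = dist_int_fraction_ge[OF b[OF g]]
    have g4: "\<bar>real_of_int g\<bar> \<le> 4 * real R" using g unfolding G_def by (simp add: abs_le_iff)
    have "\<bar>?y - of_int g * \<theta>\<bar> = \<bar>real_of_int g\<bar> * \<bar>of_int q * \<theta> - of_int a\<bar> / of_int q"
      using q by (simp add: field_simps flip: abs_mult)
    also have "\<dots> \<le> (4 * real R) * (1 / (8 * real R)) / of_int q"
      using g4 close q by (intro divide_right_mono mult_mono) auto
    also have "\<dots> = (1 / of_int q) / 2" using R by simp
    also have "\<dots> \<le> dist_int ?y / 2" using order.trans[OF 2(2) 1] by (rule divide_right_mono) simp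
    finally have "\<bar>?y - of_int g * \<theta>\<bar> \<le> dist_int ?y / 2" .
    then have d: "dist_int ?y / 2 \<le> dist_int (of_int g * \<theta>)"
      using dist_int_triangle[of ?y "of_int g * \<theta>"] by linarith
    have pos: "dist_int ?y > 0" using 1 2(2) q by (smt (verit) divide_pos_pos)
    have "\<alpha> g * (dist_int ?y / 2) \<le> \<alpha> g * dist_int (of_int g * \<theta>)" using d \<alpha> by (intro mult_left_mono)
    then have "\<alpha> g * (dist_int ?y / 2) \<le> 1" using \<alpha>(2)[of g] by linarith
    then have "\<alpha> g \<le> 2 * (1 / dist_int ?y)" using pos by (simp add: field_simps)
    moreover have "1 / dist_int ?y \<le> 1 / dist_int (of_int ?b / of_int q)"
    proof (rule frac_le)
      show "0 < dist_int (of_int ?b / of_int q)" using 2(2) q by (smt (verit) divide_pos_pos)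
    qed (use 1 in auto)
    ultimately show ?thesis unfolding \<phi>_def using 2(1) by linarith
  qed
  have \<phi>0: "\<phi> b \<ge> 0" if "b \<in> {1..q-1}" for b using that q unfolding \<phi>_def by simp
  have "(\<Sum>g\<in>G. \<alpha> g) \<le> (\<Sum>g\<in>G. \<phi> (g * a mod q))" by (rule sum_mono) (rule le)
  also have "\<dots> = (\<Sum>b\<in>{1..q-1}. \<Sum>g\<in>{g\<in>G. g * a mod q = b}. \<phi> (g * a mod q))"
  proof (rule sum.group[symmetric])
    show "finite G" unfolding G_def by (rule finite_subset[of _ "{- 4 * int R..4 * int R}"]) auto
    show "(\<lambda>g. g * a mod q) ` G \<subseteq> {1..q - 1}"
    proof (rule image_subsetI)
      fix g assume "g \<in> G"
      then show "g * a mod q \<in> {1..q - 1}" using b[of g] unfolding atLeastAtMost_iff by linarith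
    qed
  qed simp
  also have "\<dots> = (\<Sum>b\<in>{1..q-1}. real (card {g\<in>G. g * a mod q = b}) * \<phi> b)"
    by (intro sum.cong refl) simp
  also have "\<dots> \<le> (\<Sum>b\<in>{1..q-1}. (24 * real R / of_int q) * \<phi> b)"
  proof (intro sum_mono mult_right_mono \<phi>0)
    fix b assume "b \<in> {1..q-1}"
    have "real (card {g\<in>G. g * a mod q = b}) \<le> real (card {g \<in> {- (4 * int R)..4 * int R}. g * a mod q = b})"
      by (rule of_nat_mono, rule card_mono, rule finite_subset[of _ "{- (4 * int R)..4 * int R}"]) (auto simp: G_def)
    also have "\<dots> \<le> 2 * real_of_int (4 * int R) / of_int q + 2"
      by (rule card_residue_class_le) (use assms q in auto)
    finally show "real (card {g\<in>G. g * a mod q = b}) \<le> 24 * real R / of_int q"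
      using assms q by (simp add: field_simps)
  qed
  also have "\<dots> = (\<Sum>b\<in>{1..q-1}. 48 * real R * (1 / of_int b + 1 / of_int (q - b)))"
    unfolding \<phi>_def using q by (intro sum.cong refl) (simp add: field_simps)
  also have "\<dots> = 48 * real R * ((\<Sum>b\<in>{1..q-1}. 1 / of_int b) + (\<Sum>b\<in>{1..q-1}. 1 / of_int (q - b)))"
    by (simp add: sum_distrib_left[symmetric] sum.distrib)
  finally have G: "(\<Sum>g\<in>G. \<alpha> g) \<le> 48 * real R * ((\<Sum>b\<in>{1..q-1}. 1 / of_int b) + (\<Sum>b\<in>{1..q-1}. 1 / of_int (q - b)))" .
  have sym: "(\<Sum>b\<in>{1..q-1}. 1 / of_int (q - b)) = (\<Sum>b\<in>{1..q-1}. 1 / real_of_int b)"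
    by (rule sum.reindex_bij_witness[of _ "\<lambda>b. q - b" "\<lambda>b. q - b"]) auto
  have "(\<Sum>b\<in>{1..q-1}. 1 / real_of_int b) = (\<Sum>b=1..nat (q-1). 1 / real b)"
    by (rule sum.reindex_bij_witness[of _ int nat]) auto
  also have "\<dots> \<le> (\<Sum>b=1..8*R. 1 / real b)" using assms by (intro sum_mono2) auto
  also have "\<dots> \<le> 1 + ln (real (8 * R))" using assms by (intro harm_le_ln) auto
  finally have "(\<Sum>b\<in>{1..q-1}. 1 / real_of_int b) + (\<Sum>b\<in>{1..q-1}. 1 / of_int (q - b)) \<le> 2 * (1 + ln (8 * real R))"
    unfolding sym by simp
  from mult_left_mono[OF this, of "48 * real R"] G R show ?thesis unfolding G_def by linarith
qed

text \<open>
  For \<open>g = q i\<close> the distance of \<open>g \<theta>\<close> to the integers is exactly \<open>|i| \<beta>\<close>. The first bound is the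
  trivial one. The second interpolates between the bounds \<open>3 R\<close> and \<open>1 / (|i| \<beta>)\<close> with weights
  \<open>1 / 10\<close> and \<open>9 / 10\<close>.
\<close>

lemma sum_multiples_le:
  fixes q a :: int and R :: nat and \<alpha> :: "int \<Rightarrow> real"
  assumes "1 \<le> q" "q \<le> 8 * int R" "R \<ge> 1"
    and close: "\<bar>of_int q * \<theta> - of_int a\<bar> \<le> 1 / (8 * real R)"
    and \<alpha>: "\<And>g. \<alpha> g \<ge> 0" "\<And>g. \<alpha> g \<le> 3 * real R" "\<And>g. \<alpha> g * dist_int (of_int g * \<theta>) \<le> 1"
  defines "\<beta> \<equiv> \<bar>of_int q * \<theta> - of_int a\<bar>"
  shows "(\<Sum>g\<in>{g \<in> {- 4 * int R..4 * int R}. q dvd g}. \<alpha> g) \<le> 72 * (real R)\<^sup>2 / of_int q"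
    and "\<beta> > 0 \<Longrightarrow> (\<Sum>g\<in>{g \<in> {- 4 * int R..4 * int R}. q dvd g}. \<alpha> g)
      \<le> 3 * real R + 40 * (real R)\<^sup>2 * ((real R)\<^sup>2 * \<beta>) powr (- 9 / 10)"
proof -
  let ?G = "{g \<in> {- 4 * int R..4 * int R}. q dvd g}"
  have R: "real R \<ge> 1" using assms by simp
  have q: "real_of_int q \<ge> 1" "q > 0" using assms by auto
  have "(\<Sum>g\<in>?G. \<alpha> g) \<le> real (card ?G) * (3 * real R)" using \<alpha>(2) by (rule sum_bounded_above)
  also have "real (card ?G) \<le> real (card {g \<in> {- (4 * int R)..4 * int R}. g * 1 mod q = 0})"
    by (rule of_nat_mono, rule card_mono, rule finite_subset[of _ "{- (4 * int R)..4 * int R}"]) auto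
  also have "\<dots> \<le> 2 * real_of_int (4 * int R) / of_int q + 2"
    by (rule card_residue_class_le) (use assms q in auto)
  also have "\<dots> \<le> 24 * real R / of_int q" using assms q by (simp add: field_simps)
  finally have "(\<Sum>g\<in>?G. \<alpha> g) \<le> (24 * real R / of_int q) * (3 * real R)"
    using R by (simp add: mult_right_mono)
  also have "\<dots> = 72 * (real R)\<^sup>2 / of_int q" using q by (simp add: field_simps power2_eq_square)
  finally show "(\<Sum>g\<in>?G. \<alpha> g) \<le> 72 * (real R)\<^sup>2 / of_int q" .
  assume \<beta>: "\<beta> > 0"
  define n where "n = 4 * R"
  define f where "f i = (3 * real R) powr (1 / 10) * \<beta> powr (- 9 / 10) * real_of_int \<bar>i\<bar> powr (- 9 / 10)" for i :: int
  have bd: "\<alpha> g \<le> f (g div q)" if g: "g \<in> ?G" "g \<noteq> 0" for g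
  proof -
    define i where "i = g div q"
    have gi: "g = q * i" using g by (simp add: i_def)
    have i0: "i \<noteq> 0" using g gi by auto
    have "\<bar>g\<bar> \<le> 4 * int R" using g by auto
    then have "real_of_int q * real_of_int \<bar>i\<bar> \<le> 4 * real R" unfolding gi abs_mult using q
      by (metis abs_of_pos of_int_le_iff of_int_mult of_int_numeral of_int_of_nat_eq)
    moreover have "1 * real_of_int \<bar>i\<bar> \<le> real_of_int q * real_of_int \<bar>i\<bar>"
      using q by (intro mult_right_mono) auto
    ultimately have "1 * real_of_int \<bar>i\<bar> \<le> 4 * real R" by linarith
    then have "real_of_int \<bar>i\<bar> * \<beta> \<le> (4 * real R) * (1 / (8 * real R))"
      using close by (intro mult_mono) (auto simp: \<beta>_def)
    then have small: "real_of_int \<bar>i\<bar> * \<beta> \<le> 1 / 2" using R by simp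
    let ?x = "of_int i * (of_int q * \<theta> - of_int a)"
    have "dist_int ?x = real_of_int \<bar>i\<bar> * \<beta>"
      using dist_int_eq[of ?x] small by (simp add: abs_mult \<beta>_def)
    moreover have "dist_int ?x \<le> dist_int (of_int g * \<theta>)"
    proof -
      have "dist_int ?x \<le> \<bar>?x - of_int (round (of_int g * \<theta>) - i * a)\<bar>" by (rule dist_int_le)
      also have "\<dots> = dist_int (of_int g * \<theta>)" unfolding dist_int_def gi by (simp add: algebra_simps)
      finally show ?thesis .
    qed
    ultimately have "\<alpha> g * (real_of_int \<bar>i\<bar> * \<beta>) \<le> \<alpha> g * dist_int (of_int g * \<theta>)"
      using \<alpha>(1) by (intro mult_left_mono) auto
    then have "\<alpha> g * (real_of_int \<bar>i\<bar> * \<beta>) \<le> 1" using \<alpha>(3)[of g] by linarith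
    moreover have ib: "real_of_int \<bar>i\<bar> * \<beta> > 0" using i0 \<beta> by simp
    ultimately have a2: "\<alpha> g \<le> (real_of_int \<bar>i\<bar> * \<beta>) powr (-1)" by (simp add: powr_minus field_simps)
    have "\<alpha> g = \<alpha> g powr (1 / 10) * \<alpha> g powr (9 / 10)"
      using \<alpha>(1)[of g] by (simp flip: powr_add)
    also have "\<dots> \<le> (3 * real R) powr (1 / 10) * ((real_of_int \<bar>i\<bar> * \<beta>) powr (-1)) powr (9 / 10)"
      using \<alpha>(1,2)[of g] a2 by (intro mult_mono powr_mono2) auto
    also have "((real_of_int \<bar>i\<bar> * \<beta>) powr (-1)) powr (9 / 10) = real_of_int \<bar>i\<bar> powr (- 9 / 10) * \<beta> powr (- 9 / 10)"
      unfolding powr_powr using \<beta> by (simp add: powr_mult)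
    finally show ?thesis unfolding f_def i_def by (simp add: mult_ac)
  qed
  have S: "(\<Sum>i\<in>{1..int n}. f i) \<le> (3 * real R) powr (1 / 10) * \<beta> powr (- 9 / 10) * (10 * real n powr (1 / 10))"
  proof -
    have "(\<Sum>i\<in>{1..int n}. f i) = (3 * real R) powr (1 / 10) * \<beta> powr (- 9 / 10) * (\<Sum>i\<in>{1..int n}. real_of_int \<bar>i\<bar> powr (- 9 / 10))"
      unfolding f_def sum_distrib_left ..
    also have "(\<Sum>i\<in>{1..int n}. real_of_int \<bar>i\<bar> powr (- 9 / 10)) = (\<Sum>i=1..n. real i powr (- 9 / 10))"
      by (rule sum.reindex_bij_witness[of _ int nat]) auto
    also have "\<dots> \<le> 10 * real n powr (1 / 10)" by (rule sum_powr_le)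
    finally show ?thesis by (simp add: mult_left_mono)
  qed
  have split0: "(\<Sum>g\<in>?G. \<alpha> g) = \<alpha> 0 + (\<Sum>g\<in>?G - {0}. \<alpha> g)"
    by (rule sum.remove[OF finite_subset[of _ "{- 4 * int R..4 * int R}"]]) auto
  have "(\<Sum>g\<in>?G - {0}. \<alpha> g) \<le> (\<Sum>g\<in>?G - {0}. f (g div q))" by (rule sum_mono) (use bd in auto)
  also have "\<dots> = (\<Sum>i\<in>(\<lambda>g. g div q) ` (?G - {0}). f i)"
  proof -
    have "inj_on (\<lambda>g. g div q) (?G - {0})"
    proof (rule inj_onI)
      fix g g' assume "g \<in> ?G - {0}" "g' \<in> ?G - {0}" and eq: "g div q = g' div q"
      then have "q dvd g" "q dvd g'" by simp_all
      then show "g = g'" using eq by (metis dvd_mult_div_cancel)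
    qed
    from sum.reindex[OF this, of f] show ?thesis unfolding o_def by (rule sym)
  qed
  also have "\<dots> \<le> (\<Sum>i\<in>{1..int n} \<union> {- int n..-1}. f i)"
  proof (rule sum_mono2)
    show "(\<lambda>g. g div q) ` (?G - {0}) \<subseteq> {1..int n} \<union> {- int n..-1}"
    proof clarify
      fix g assume g: "g \<in> {- 4 * int R..4 * int R}" "q dvd g" "g \<noteq> 0" "g div q \<notin> {- int n..-1}"
      define i where "i = g div q"
      have gi: "g = q * i" using g by (simp add: i_def)
      have "\<bar>i\<bar> \<le> \<bar>g\<bar>" unfolding gi abs_mult using q by (simp add: mult_le_cancel_right1)
      moreover have "i \<noteq> 0" using gi g by auto
      moreover have "\<bar>g\<bar> \<le> 4 * int R" using g(1) by auto
      moreover have "i \<notin> {- int n..-1}" using g(4) by (simp only: i_def not_False_eq_True)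
      ultimately have "i \<in> {1..int n}" unfolding n_def atLeastAtMost_iff of_nat_mult of_nat_numeral by linarith
      then show "g div q \<in> {1..int n}" by (simp only: i_def)
    qed
  qed (auto simp: f_def)
  also have "\<dots> = (\<Sum>i\<in>{1..int n}. f i) + (\<Sum>i\<in>{- int n..-1}. f i)" by (rule sum.union_disjoint) auto
  also have "(\<Sum>i\<in>{- int n..-1}. f i) = (\<Sum>i\<in>{1..int n}. f i)"
    by (rule sum.reindex_bij_witness[of _ uminus uminus]) (auto simp: f_def)
  finally have "(\<Sum>g\<in>?G - {0}. \<alpha> g) \<le> (\<Sum>i\<in>{1..int n}. f i) + (\<Sum>i\<in>{1..int n}. f i)" .
  then have "(\<Sum>g\<in>?G. \<alpha> g) \<le> 3 * real R + 2 * ((3 * real R) powr (1 / 10) * \<beta> powr (- 9 / 10) * (10 * real n powr (1 / 10)))"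
    using S \<alpha>(2)[of 0] split0 by linarith
  also have "\<dots> = 3 * real R + 20 * (12 powr (1 / 10)) * (real R powr (1 / 5) * \<beta> powr (- 9 / 10))"
  proof -
    have "(3 * real R) powr (1 / 10) * real n powr (1 / 10) = (12 * (real R * real R)) powr (1 / 10)"
      unfolding n_def by (subst powr_mult[symmetric]) (auto simp: algebra_simps)
    also have "\<dots> = 12 powr (1 / 10) * real R powr (1 / 5)"
      using R by (simp add: powr_mult flip: powr_add)
    finally show ?thesis by (simp add: mult_ac)
  qed
  finally have M: "(\<Sum>g\<in>?G. \<alpha> g) \<le> 3 * real R + 20 * (12 powr (1 / 10)) * (real R powr (1 / 5) * \<beta> powr (- 9 / 10))" .
  have "12 powr (1 / 10) \<le> (2 ^ 10) powr (1 / 10 :: real)" by (rule powr_mono2) auto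
  also have "(2 ^ 10) powr (1 / 10 :: real) = (2 powr 10) powr (1 / 10)" by (subst powr_numeral) auto
  also have "\<dots> = 2" unfolding powr_powr by simp
  finally have "20 * (12 powr (1 / 10)) * (real R powr (1 / 5) * \<beta> powr (- 9 / 10)) \<le> 40 * (real R powr (1 / 5) * \<beta> powr (- 9 / 10))"
    by (intro mult_right_mono) auto
  moreover have "real R powr (1 / 5) * \<beta> powr (- 9 / 10) = (real R)\<^sup>2 * ((real R)\<^sup>2 * \<beta>) powr (- 9 / 10)"
  proof -
    have "((real R)\<^sup>2 * \<beta>) powr (- 9 / 10) = (real R powr 2) powr (- 9 / 10) * \<beta> powr (- 9 / 10)"
      using R \<beta> by (simp add: powr_mult)
    also have "(real R powr 2) powr (- 9 / 10) = real R powr (1 / 5 - 2)" by (simp only: powr_powr) simp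
    also have "\<dots> = real R powr (1 / 5) / (real R)\<^sup>2"
      using R powr_diff[of "real R" "1 / 5" 2] by simp
    finally show ?thesis using R by simp
  qed
  ultimately show "(\<Sum>g\<in>?G. \<alpha> g) \<le> 3 * real R + 40 * (real R)\<^sup>2 * ((real R)\<^sup>2 * \<beta>) powr (- 9 / 10)"
    using M unfolding mult.assoc by linarith
qed

text \<open>
  Weyl's inequality with the saving measured by the height \<open>D = q + R\<^sup>2 |q \<theta> - a|\<close> of a Dirichlet
  approximation \<open>a / q\<close> with \<open>q \<le> 8 R\<close>. The exponent \<open>9 / 10\<close> stands for any exponent below 1;
  the application needs one above \<open>4 / 5\<close>. The error \<open>R ln R\<close> from the non-multiples of \<open>q\<close> is
  absorbed because \<open>D \<le> 9 R\<close>.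
\<close>

theorem weyl_sum_bound:
  fixes R :: nat and \<theta> :: real
  assumes "R \<ge> 1"
  shows "\<exists>q a :: int. 1 \<le> q \<and> of_int q + (real R)\<^sup>2 * \<bar>of_int q * \<theta> - of_int a\<bar> \<le> 9 * real R \<and>
    (\<forall>\<xi>. (norm (weyl_sum R \<theta> \<xi>))\<^sup>2 \<le>
      20000 * (real R)\<^sup>2 * (of_int q + (real R)\<^sup>2 * \<bar>of_int q * \<theta> - of_int a\<bar>) powr (- 9 / 10))"
proof -
  have R: "real R \<ge> 1" using assms by simp
  obtain a q :: int where aq: "coprime a q" "0 < q" "q \<le> int (8 * R)" "\<bar>of_int q * \<theta> - of_int a\<bar> < 1 / real (8 * R)"
    using Dirichlet_approx_coprime[of "8 * R" \<theta>] assms by auto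
  define \<beta> where "\<beta> = \<bar>of_int q * \<theta> - of_int a\<bar>"
  define D where "D = of_int q + (real R)\<^sup>2 * \<beta>"
  have close: "\<beta> \<le> 1 / (8 * real R)" using aq(4) by (simp add: \<beta>_def)
  have q: "1 \<le> real_of_int q" "real_of_int q \<le> 8 * real R" using aq by linarith+
  have \<beta>0: "\<beta> \<ge> 0" by (simp add: \<beta>_def)
  have "(real R)\<^sup>2 * \<beta> \<le> (real R)\<^sup>2 * (1 / (8 * real R))" using close by (intro mult_left_mono) auto
  then have "(real R)\<^sup>2 * \<beta> \<le> real R" using R by (simp add: power2_eq_square)
  then have D9: "D \<le> 9 * real R" using q by (simp add: D_def)
  have D1: "1 \<le> D" using q \<beta>0 by (simp add: D_def add_increasing2)
  have R11: "real R powr (11 / 10) \<le> 9 * (real R)\<^sup>2 * D powr (- 9 / 10)"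
  proof -
    have "real R powr (11 / 10) = (real R)\<^sup>2 * real R powr (- 9 / 10)" using R
      by (simp flip: powr_numeral powr_add)
    also have "real R powr (- 9 / 10) = 9 powr (9 / 10) * (9 * real R) powr (- 9 / 10)"
      using R by (simp add: powr_mult powr_minus)
    also have "\<dots> \<le> 9 powr 1 * D powr (- 9 / 10)"
      using D9 D1 by (intro mult_mono powr_mono powr_mono2') auto
    finally show ?thesis using R by simp
  qed
  obtain \<alpha> where \<alpha>: "\<And>g. 0 \<le> \<alpha> g" "\<And>g. \<alpha> g \<le> 2 * real R + 1" "\<And>g. \<alpha> g * dist_int (of_int g * \<theta>) \<le> 1"
    and F: "\<And>\<xi>. (norm (weyl_sum R \<theta> \<xi>))\<^sup>2 \<le> (\<Sum>g\<in>{- 4 * int R..4 * int R}. \<alpha> g)"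
    using weyl_differencing[of R \<theta>] by metis
  have \<alpha>3: "\<alpha> g \<le> 3 * real R" for g using \<alpha>(2)[of g] R by linarith
  let ?M = "\<Sum>g\<in>{g \<in> {- 4 * int R..4 * int R}. q dvd g}. \<alpha> g"
  have M: "?M \<le> 3 * real R + 144 * (real R)\<^sup>2 * D powr (- 9 / 10)"
  proof (cases "(real R)\<^sup>2 * \<beta> \<le> of_int q")
    case True
    have "?M \<le> 72 * (real R)\<^sup>2 / of_int q"
      by (rule sum_multiples_le(1)[where a = a and \<theta> = \<theta>]) (use aq assms \<alpha> \<alpha>3 close in \<open>auto simp: \<beta>_def\<close>)
    also have "\<dots> = 144 * (real R)\<^sup>2 * (1 / (2 * of_int q))" by simp
    also have "1 / (2 * real_of_int q) \<le> 1 / D" using True D1 q unfolding D_def by (intro divide_left_mono) auto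
    also have "1 / D = D powr (-1)" using D1 by (simp add: powr_minus inverse_eq_divide)
    also have "\<dots> \<le> D powr (- 9 / 10)" using D1 by (intro powr_mono) auto
    finally have "?M \<le> 144 * (real R)\<^sup>2 * D powr (- 9 / 10)" by (simp add: mult_left_mono)
    then show ?thesis using R by linarith
  next
    case False
    then have x: "D / 2 \<le> (real R)\<^sup>2 * \<beta>" unfolding D_def not_le
      using field_sum_of_halves[of "(real R)\<^sup>2 * \<beta>"] by (simp only: add_divide_distrib)
    then have pos: "(real R)\<^sup>2 * \<beta> > 0" using D1 by linarith
    then have "\<beta> > 0" using R by (simp add: zero_less_mult_iff)
    then have "?M \<le> 3 * real R + 40 * (real R)\<^sup>2 * ((real R)\<^sup>2 * \<beta>) powr (- 9 / 10)"
      unfolding \<beta>_def by (intro sum_multiples_le(2)) (use aq assms \<alpha> \<alpha>3 close in \<open>auto simp: \<beta>_def\<close>)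
    then have M1: "?M \<le> 3 * real R + 40 * ((real R)\<^sup>2 * ((real R)\<^sup>2 * \<beta>) powr (- 9 / 10))"
      by (simp add: mult.assoc)
    have "((real R)\<^sup>2 * \<beta>) powr (- 9 / 10) \<le> (D / 2) powr (- 9 / 10)"
      using x D1 by (intro powr_mono2') auto
    also have "(D / 2) powr (- 9 / 10) = D powr (- 9 / 10) * 2 powr (9 / 10)"
      using D1 by (simp add: powr_divide powr_minus field_simps)
    also have "\<dots> \<le> D powr (- 9 / 10) * 2 powr 1" by (intro mult_left_mono powr_mono) auto
    finally have "((real R)\<^sup>2 * \<beta>) powr (- 9 / 10) \<le> 2 * D powr (- 9 / 10)" by simp
    then have "(real R)\<^sup>2 * ((real R)\<^sup>2 * \<beta>) powr (- 9 / 10) \<le> (real R)\<^sup>2 * (2 * D powr (- 9 / 10))"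
      by (rule mult_left_mono) simp
    then have "?M \<le> 3 * real R + 80 * ((real R)\<^sup>2 * D powr (- 9 / 10))" using M1 by linarith
    moreover have "0 \<le> (real R)\<^sup>2 * D powr (- 9 / 10)" by simp
    ultimately show ?thesis by linarith
  qed
  have N: "(\<Sum>g\<in>{g \<in> {- 4 * int R..4 * int R}. \<not> q dvd g}. \<alpha> g) \<le> 96 * real R * (1 + ln (8 * real R))"
    by (rule sum_non_multiples_le[where a = a and \<theta> = \<theta>]) (use aq assms \<alpha> close in \<open>auto simp: \<beta>_def\<close>)
  have split: "(\<Sum>g\<in>{- 4 * int R..4 * int R}. \<alpha> g) = ?M + (\<Sum>g\<in>{g \<in> {- 4 * int R..4 * int R}. \<not> q dvd g}. \<alpha> g)"
  proof -
    have "{- 4 * int R..4 * int R} \<inter> {g. q dvd g} = {g \<in> {- 4 * int R..4 * int R}. q dvd g}"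
      "{- 4 * int R..4 * int R} - {g. q dvd g} = {g \<in> {- 4 * int R..4 * int R}. \<not> q dvd g}" by blast+
    then show ?thesis using sum.Int_Diff[of "{- 4 * int R..4 * int R}" \<alpha> "{g. q dvd g}"] by simp
  qed
  have lnR: "1 + ln (8 * real R) \<le> 14 * real R powr (1 / 10)"
  proof -
    have "ln (8 * real R) = ln 8 + ln (real R)" using R by (simp add: ln_mult)
    also have "ln (8::real) \<le> 3"
    proof -
      have "ln (8::real) = 3 * ln 2" using ln_realpow[of 2 3] by simp
      then show ?thesis using ln_2_less_1 by simp
    qed
    also have "ln (real R) \<le> real R powr (1 / 10) / (1 / 10)" using R by (intro ln_powr_bound) auto
    finally have "1 + ln (8 * real R) \<le> 4 + 10 * real R powr (1 / 10)" by simp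
    moreover have "1 \<le> real R powr (1 / 10)" using R by (simp add: ge_one_powr_ge_zero)
    ultimately show ?thesis by linarith
  qed
  have Rp: "real R * real R powr (1 / 10) = real R powr (11 / 10)" using R powr_add[of "real R" 1 "1 / 10"] by simp
  have "real R \<le> real R powr (11 / 10)" using R powr_mono[of 1 "11 / 10" "real R"] by simp
  moreover have "96 * real R * (1 + ln (8 * real R)) \<le> 96 * real R * (14 * real R powr (1 / 10))"
    using lnR R by (intro mult_left_mono) auto
  then have "96 * real R * (1 + ln (8 * real R)) \<le> 1344 * real R powr (11 / 10)" using Rp by (simp add: mult_ac)
  moreover have "0 \<le> (real R)\<^sup>2 * D powr (- 9 / 10)" by simp
  ultimately have "(\<Sum>g\<in>{- 4 * int R..4 * int R}. \<alpha> g) \<le> 20000 * ((real R)\<^sup>2 * D powr (- 9 / 10))"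
    using M N R11 unfolding split by linarith
  then have tot: "(\<Sum>g\<in>{- 4 * int R..4 * int R}. \<alpha> g) \<le> 20000 * (real R)\<^sup>2 * D powr (- 9 / 10)"
    by (simp only: mult.assoc)
  have F': "\<forall>\<xi>. (norm (weyl_sum R \<theta> \<xi>))\<^sup>2 \<le> 20000 * (real R)\<^sup>2 * D powr (- 9 / 10)"
    by (rule allI, rule order.trans[OF F tot])
  have "1 \<le> q" using aq by simp
  then show ?thesis
    using conjI[OF D9[unfolded D_def \<beta>_def] F'[unfolded D_def \<beta>_def]]
    by (intro exI[of _ q] exI[of _ a]) (rule conjI)
qed

section \<open>The circle method for lattice spheres\<close>

lemma sum_expi_roots_of_unity:
  fixes M :: nat and n :: int
  assumes "M > 0"
  shows "(\<Sum>k<M. expi (real k * (of_int n / real M))) = (if int M dvd n then of_nat M else 0)"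
proof (cases "int M dvd n")
  case True
  then obtain j where n: "n = int M * j" by blast
  have "expi (real k * (of_int n / real M)) = 1" for k
  proof -
    have "real k * (of_int n / real M) = of_int (int k * j)" using assms by (simp add: n)
    then show ?thesis by (simp only: expi_int)
  qed
  then show ?thesis using True by simp
next
  case False
  define z where "z = expi (of_int n / real M)"
  have pw: "expi (real k * (of_int n / real M)) = z ^ k" for k
    unfolding z_def by (induction k) (simp_all add: expi_add ring_distribs add_divide_distrib)
  have "z \<noteq> 1"
  proof
    assume "z = 1"
    then have "dist_int (of_int n / real M) \<le> 0" using norm_expi_minus_one_ge[of "of_int n / real M"] by (simp add: z_def)
    then have "of_int n / real M = of_int (round (of_int n / real M))" by (simp add: dist_int_def)
    then have "real_of_int n = of_int (int M * round (of_int n / real M))" using assms by (simp add: field_simps)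
    then have "n = int M * round (of_int n / real M)" by linarith
    then show False using False by (metis dvd_triv_left)
  qed
  moreover have "z ^ M = 1"
  proof -
    have "real M * (of_int n / real M) = of_int n" using assms by simp
    then show ?thesis using pw[of M] by (simp only: expi_int)
  qed
  ultimately have "(\<Sum>k<M. z ^ k) = 0" by (simp add: sum_gp_strict)
  then show ?thesis unfolding pw using False by simp
qed

definition sphere_sum :: "int \<Rightarrow> ('d::finite \<Rightarrow> real) \<Rightarrow> complex" where
  "sphere_sum l \<xi> = (\<Sum>v\<in>(lattice_sphere l :: (int ^ 'd) set). expi (\<Sum>i\<in>UNIV. \<xi> i * of_int (v $ i)))"

lemma prod_weyl_sum:
  fixes \<xi> :: "'d::finite \<Rightarrow> real"
  shows "(\<Prod>i\<in>UNIV. weyl_sum R \<theta> (\<xi> i)) =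
    (\<Sum>v\<in>{v :: int ^ 'd. \<forall>i. v $ i \<in> {- int R..int R}}. expi (\<theta> * of_int (norm_sq v)) * expi (\<Sum>i\<in>UNIV. \<xi> i * of_int (v $ i)))"
proof -
  let ?I = "{- int R..int R}"
  have "(\<Prod>i\<in>UNIV. weyl_sum R \<theta> (\<xi> i)) =
      (\<Sum>g\<in>PiE UNIV (\<lambda>_. ?I). \<Prod>i\<in>UNIV. expi (\<theta> * of_int ((g i)\<^sup>2) + \<xi> i * of_int (g i)))"
    unfolding weyl_sum_def by (rule prod_sum_PiE) auto
  also have "\<dots> = (\<Sum>g\<in>PiE UNIV (\<lambda>_. ?I). expi (\<theta> * of_int (norm_sq (vec_lambda g))) * expi (\<Sum>i\<in>UNIV. \<xi> i * of_int (vec_lambda g $ i)))"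
    unfolding expi_sum[symmetric] expi_add[symmetric]
    by (intro sum.cong refl arg_cong[of _ _ expi]) (simp add: norm_sq_def sum.distrib sum_distrib_left)
  also have "\<dots> = (\<Sum>v\<in>{v :: int ^ 'd. \<forall>i. v $ i \<in> ?I}. expi (\<theta> * of_int (norm_sq v)) * expi (\<Sum>i\<in>UNIV. \<xi> i * of_int (v $ i)))"
    by (rule sum.reindex_bij_betw[OF bij_betw_vec_lambda])
  finally show ?thesis .
qed

text \<open>
  The circle method with the circle replaced by the \<open>M\<close>-th roots of unity: for \<open>v\<close> in the box the
  number \<open>norm_sq v - l\<close> is smaller than \<open>M\<close> in absolute value, so it is divisible by \<open>M\<close> only if it
  is \<open>0\<close>.
\<close>

lemma sphere_sum_eq:
  fixes \<xi> :: "'d::finite \<Rightarrow> real" and l :: int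
  assumes l: "0 \<le> l" "l < (int R + 1)\<^sup>2" "l < int M" and M: "CARD('d) * R\<^sup>2 < M"
  shows "of_nat M * sphere_sum l \<xi> = (\<Sum>k<M. expi (- (real k * (of_int l / real M))) * (\<Prod>i\<in>UNIV. weyl_sum R (real k / real M) (\<xi> i)))"
proof -
  let ?B = "{v :: int ^ 'd. \<forall>i. v $ i \<in> {- int R..int R}}"
  let ?e = "\<lambda>v :: int ^ 'd. expi (\<Sum>i\<in>UNIV. \<xi> i * of_int (v $ i))"
  have finB: "finite ?B" by (rule finite_vec_set) simp
  have sub: "lattice_sphere l \<subseteq> ?B"
  proof (intro subsetI CollectI allI)
    fix v :: "int ^ 'd" and i assume "v \<in> lattice_sphere l"
    then have "(v $ i)\<^sup>2 < (int R + 1)\<^sup>2" using component_sq_le_norm_sq[of v i] l by (simp add: lattice_sphere_def)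
    then have "\<bar>v $ i\<bar> < int R + 1" using power2_less_imp_less[of "\<bar>v $ i\<bar>" "int R + 1"] by simp
    then show "v $ i \<in> {- int R..int R}" by auto
  qed
  have dv: "int M dvd norm_sq v - l \<longleftrightarrow> v \<in> lattice_sphere l" if "v \<in> ?B" for v
  proof
    assume "int M dvd norm_sq v - l"
    moreover have "norm_sq v \<le> (\<Sum>i\<in>(UNIV :: 'd set). (int R)\<^sup>2)"
      unfolding norm_sq_def
    proof (rule sum_mono)
      fix i
      have "\<bar>v $ i\<bar> \<le> \<bar>int R\<bar>" using that by (auto simp: abs_le_iff dest!: spec[of _ i])
      then show "(v $ i)\<^sup>2 \<le> (int R)\<^sup>2" by (simp only: abs_le_square_iff)
    qed
    then have "norm_sq v < int M" using M by (simp flip: of_nat_power of_nat_mult)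
    moreover have "norm_sq v \<ge> 0" by (simp add: norm_sq_def sum_nonneg)
    ultimately have "norm_sq v - l = 0" using l zdvd_imp_le[of "int M" "norm_sq v - l"] zdvd_imp_le[of "int M" "l - norm_sq v"]
      by (smt (verit) dvd_diff_commute)
    then show "v \<in> lattice_sphere l" by (simp add: lattice_sphere_def)
  qed (simp add: lattice_sphere_def)
  have "(\<Sum>k<M. expi (- (real k * (of_int l / real M))) * (\<Prod>i\<in>UNIV. weyl_sum R (real k / real M) (\<xi> i)))
      = (\<Sum>k<M. \<Sum>v\<in>?B. ?e v * expi (real k * (of_int (norm_sq v - l) / real M)))"
    unfolding prod_weyl_sum sum_distrib_left
  proof (intro sum.cong refl)
    fix k and v :: "int ^ 'd"
    have "expi (real k * (of_int (norm_sq v - l) / real M)) = expi (- (real k * (of_int l / real M))) * expi (real k / real M * of_int (norm_sq v))"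
      unfolding expi_add[symmetric] by (rule arg_cong[of _ _ expi]) (simp add: diff_divide_distrib algebra_simps)
    then show "expi (- (real k * (real_of_int l / real M))) * (expi (real k / real M * real_of_int (norm_sq v)) * ?e v) =
         ?e v * expi (real k * (real_of_int (norm_sq v - l) / real M))" by simp
  qed
  also have "\<dots> = (\<Sum>v\<in>?B. ?e v * (\<Sum>k<M. expi (real k * (of_int (norm_sq v - l) / real M))))"
    unfolding sum_distrib_left by (rule sum.swap)
  also have "\<dots> = (\<Sum>v\<in>?B. if v \<in> lattice_sphere l then ?e v * of_nat M else 0)"
  proof (intro sum.cong refl)
    fix v assume v: "v \<in> ?B"
    have M0: "M > 0" using M by simp
    show "?e v * (\<Sum>k<M. expi (real k * (of_int (norm_sq v - l) / real M))) = (if v \<in> lattice_sphere l then ?e v * of_nat M else 0)"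
      unfolding sum_expi_roots_of_unity[OF M0] dv[OF v] by simp
  qed
  also have "\<dots> = (\<Sum>v\<in>lattice_sphere l. ?e v * of_nat M)"
    by (rule sum.mono_neutral_cong_right[OF finB sub]) auto
  also have "\<dots> = of_nat M * sphere_sum l \<xi>"
    unfolding sphere_sum_def sum_distrib_left by (simp add: mult.commute)
  finally show ?thesis by simp
qed

lemma card_nat_interval_le:
  fixes x y :: real
  assumes "y \<ge> 0"
  shows "finite {k::nat. \<bar>real k - x\<bar> \<le> y}" "real (card {k::nat. \<bar>real k - x\<bar> \<le> y}) \<le> 2 * y + 1"
proof -
  let ?A = "{k::nat. \<bar>real k - x\<bar> \<le> y}"
  have sub: "int ` ?A \<subseteq> {\<lceil>x - y\<rceil>..\<lfloor>x + y\<rfloor>}" by (auto simp: ceiling_le_iff le_floor_iff)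
  then have "finite (int ` ?A)" by (rule finite_subset) simp
  then show "finite ?A" by (rule finite_imageD) simp
  have "card ?A = card (int ` ?A)" by (simp add: card_image)
  also have "\<dots> \<le> card {\<lceil>x - y\<rceil>..\<lfloor>x + y\<rfloor>}" using sub by (rule card_mono[rotated]) simp
  also have "\<dots> = nat (\<lfloor>x + y\<rfloor> - \<lceil>x - y\<rceil> + 1)" by simp
  finally have "real (card ?A) \<le> real (nat (\<lfloor>x + y\<rfloor> - \<lceil>x - y\<rceil> + 1))" by simp
  then show "real (card ?A) \<le> 2 * y + 1" using assms by linarith
qed

text \<open>
  A point of height at most \<open>s\<close> lies within \<open>s / (q R\<^sup>2)\<close> of a fraction \<open>c / q\<close> with
  \<open>0 \<le> c \<le> q \<le> s\<close>. There are about \<open>s\<^sup>2\<close> fractions, but the neighbourhoods shrink with \<open>q\<close>, which is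
  why the total is \<open>s\<^sup>2 / R\<^sup>2\<close>.
\<close>

lemma card_major_arcs_le:
  fixes q a :: "nat \<Rightarrow> int" and s :: real and R M :: nat
  assumes q: "\<And>k. 1 \<le> q k" and s: "1 \<le> s" "s < (real R)\<^sup>2" and M: "R\<^sup>2 \<le> M" and R: "R \<ge> 1"
  shows "real (card {k. k < M \<and> of_int (q k) + (real R)\<^sup>2 * \<bar>of_int (q k) * (real k / real M) - of_int (a k)\<bar> \<le> s})
    \<le> 6 * s\<^sup>2 * real M / (real R)\<^sup>2"
proof -
  let ?A = "{k. k < M \<and> of_int (q k) + (real R)\<^sup>2 * \<bar>of_int (q k) * (real k / real M) - of_int (a k)\<bar> \<le> s}"
  define n where "n = nat \<lfloor>s\<rfloor>"
  define K where "K b c = {k::nat. \<bar>real k - real c * real M / real b\<bar> \<le> s * real M / (real b * (real R)\<^sup>2)}" for b c :: nat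
  have R2: "(real R)\<^sup>2 > 0" using R by simp
  have "real (R\<^sup>2) \<le> real M" using M by (rule of_nat_mono)
  then have MR: "real M \<ge> (real R)\<^sup>2" by simp
  then have M0: "real M > 0" using R2 by linarith
  have sub: "?A \<subseteq> (\<Union>b\<in>{1..n}. \<Union>c\<in>{0..b}. K b c)"
  proof
    fix k assume "k \<in> ?A"
    then have k: "k < M" and le: "of_int (q k) + (real R)\<^sup>2 * \<bar>of_int (q k) * (real k / real M) - of_int (a k)\<bar> \<le> s" by auto
    define \<beta> where "\<beta> = \<bar>of_int (q k) * (real k / real M) - of_int (a k)\<bar>"
    define b where "b = nat (q k)"
    have bq: "real_of_int (q k) = real b" "b \<ge> 1" using q[of k] unfolding b_def by simp_all
    have le': "of_int (q k) + (real R)\<^sup>2 * \<beta> \<le> s" using le by (simp only: \<beta>_def)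
    have "(real R)\<^sup>2 * \<beta> \<ge> 0" by (simp add: \<beta>_def)
    then have "real b \<le> s" using le' bq(1) by linarith
    then have "int b \<le> \<lfloor>s\<rfloor>" by (simp add: le_floor_iff)
    then have b: "b \<in> {1..n}" using bq unfolding n_def by simp
    have "(real R)\<^sup>2 * \<beta> \<le> s - 1" using le' bq(1) of_nat_mono[OF bq(2), where 'a = real] by linarith
    then have Rb: "(real R)\<^sup>2 * \<beta> \<le> s" by simp
    then have "(real R)\<^sup>2 * \<beta> < (real R)\<^sup>2 * 1" using s by simp
    then have \<beta>1: "\<beta> < 1" using R2 by (simp only: mult_less_cancel_left_pos)
    have "real k / real M \<le> 1" using k M0 by simp
    then have x: "0 \<le> real b * (real k / real M)" "real b * (real k / real M) \<le> real b"
      using mult_left_mono[of "real k / real M" 1 "real b"] by simp_all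
    have "real_of_int (a k) > -1" "real_of_int (a k) < real b + 1"
      using \<beta>1 x unfolding \<beta>_def bq by linarith+
    then have ak: "0 \<le> a k" "a k \<le> int b" by linarith+
    define c where "c = nat (a k)"
    have c: "c \<in> {0..b}" "real_of_int (a k) = real c" using ak by (auto simp: c_def)
    have "\<beta> \<le> s / (real R)\<^sup>2" using Rb R2 by (simp add: pos_le_divide_eq mult.commute)
    then have "\<beta> * (real M / real b) \<le> s / (real R)\<^sup>2 * (real M / real b)" by (rule mult_right_mono) simp
    moreover have "\<beta> * (real M / real b) = \<bar>(real b * (real k / real M) - real c) * (real M / real b)\<bar>"
      unfolding \<beta>_def bq c abs_mult by simp
    moreover have "(real b * (real k / real M) - real c) * (real M / real b) = real k - real c * real M / real b"
      using M0 bq(2) by (simp add: field_simps)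
    ultimately have "\<bar>real k - real c * real M / real b\<bar> \<le> s / (real R)\<^sup>2 * (real M / real b)"
      by (simp only:)
    moreover have "s / (real R)\<^sup>2 * (real M / real b) = s * real M / (real b * (real R)\<^sup>2)" by simp
    ultimately have "k \<in> K b c" unfolding K_def mem_Collect_eq by (simp only:)
    then show "k \<in> (\<Union>b\<in>{1..n}. \<Union>c\<in>{0..b}. K b c)" using b c by blast
  qed
  have finK: "finite (K b c)" and cardK: "real (card (K b c)) \<le> 2 * (s * real M / (real b * (real R)\<^sup>2)) + 1" for b c
    unfolding K_def using s by (intro card_nat_interval_le; simp)+
  have "card ?A \<le> card (\<Union>b\<in>{1..n}. \<Union>c\<in>{0..b}. K b c)"
    using finK by (intro card_mono sub) auto
  also have "\<dots> \<le> (\<Sum>b\<in>{1..n}. card (\<Union>c\<in>{0..b}. K b c))" by (rule card_UN_le) simp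
  also have "\<dots> \<le> (\<Sum>b\<in>{1..n}. \<Sum>c\<in>{0..b}. card (K b c))" by (intro sum_mono card_UN_le) simp
  finally have "real (card ?A) \<le> real (\<Sum>b\<in>{1..n}. \<Sum>c\<in>{0..b}. card (K b c))" by (rule of_nat_mono)
  also have "\<dots> = (\<Sum>b\<in>{1..n}. \<Sum>c\<in>{0..b}. real (card (K b c)))" by simp
  also have "\<dots> \<le> (\<Sum>b\<in>{1..n}. \<Sum>c\<in>{0..b}. 2 * (s * real M / (real b * (real R)\<^sup>2)) + 1)"
    by (intro sum_mono cardK)
  also have "\<dots> \<le> (\<Sum>b\<in>{1..n}. 6 * s * real M / (real R)\<^sup>2)"
  proof (rule sum_mono)
    fix b assume b: "b \<in> {1..n}"
    then have "real b \<le> real n" by simp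
    also have "real n \<le> s" using s unfolding n_def by simp
    finally have bs: "real b \<le> s" .
    have b1: "real b \<ge> 1" using b by simp
    have "(\<Sum>c\<in>{0..b}. 2 * (s * real M / (real b * (real R)\<^sup>2)) + 1) = (real b + 1) * (2 * (s * real M / (real b * (real R)\<^sup>2)) + 1)" by simp
    also have "\<dots> \<le> (2 * real b) * (2 * (s * real M / (real b * (real R)\<^sup>2)) + 1)"
      using b1 s by (intro mult_right_mono) auto
    also have "\<dots> = 4 * (s * real M / (real R)\<^sup>2) + 2 * real b" using b1 R2 by (simp add: field_simps)
    also have "\<dots> \<le> 4 * (s * real M / (real R)\<^sup>2) + 2 * (s * real M / (real R)\<^sup>2)"
    proof -
      have "s * 1 \<le> s * (real M / (real R)\<^sup>2)" using MR R2 s by (intro mult_left_mono) auto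
      then show ?thesis using bs by simp
    qed
    finally show "(\<Sum>c\<in>{0..b}. 2 * (s * real M / (real b * (real R)\<^sup>2)) + 1) \<le> 6 * s * real M / (real R)\<^sup>2" by simp
  qed
  also have "\<dots> = real n * (6 * s * real M / (real R)\<^sup>2)" by simp
  also have "\<dots> \<le> s * (6 * s * real M / (real R)\<^sup>2)" using s unfolding n_def by (intro mult_right_mono) auto
  also have "\<dots> = 6 * s\<^sup>2 * real M / (real R)\<^sup>2" by (simp add: power2_eq_square)
  finally show ?thesis .
qed

text \<open>
  Points with \<open>D\<close> in \<open>(2 ^ j, 2 ^ (j + 1)]\<close> contribute at most \<open>4 A (2 ^ j) powr (- 1 / 4)\<close>, and the
  geometric series converges because \<open>9 / 4 > 2\<close>. The constant 32 closes the induction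
  downwards in \<open>j\<close>, as \<open>4 + 32 * 7 / 8 = 32\<close> and \<open>2 powr (- 1 / 4) \<le> 7 / 8\<close>.
\<close>

lemma dyadic_sum_bound:
  fixes D :: "'a \<Rightarrow> real" and A X :: real
  assumes "finite K" "A \<ge> 0" and D: "\<And>k. k \<in> K \<Longrightarrow> D k \<le> X"
    and count: "\<And>s. 1 \<le> s \<Longrightarrow> s \<le> 2 * X \<Longrightarrow> real (card {k\<in>K. D k \<le> s}) \<le> A * s\<^sup>2"
  shows "(\<Sum>k\<in>{k\<in>K. D k > 2 ^ j}. D k powr (- 9 / 4)) \<le> 32 * A * (2 ^ j) powr (- 1 / 4)"
proof -
  obtain J where J: "X \<le> 2 ^ J" using real_arch_pow[of 2 X] by (auto intro: less_imp_le)
  define S where "S j = (\<Sum>k\<in>{k\<in>K. D k > 2 ^ j}. D k powr (- 9 / 4))" for j :: nat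
  have base: "S j \<le> 32 * A * (2 ^ j) powr (- 1 / 4)" if "X \<le> 2 ^ j" for j
  proof -
    have "{k\<in>K. D k > 2 ^ j} = {}" using D that by force
    then have "S j = 0" unfolding S_def by (simp only: sum.empty)
    then show ?thesis using assms(2) by simp
  qed
  have step: "S j \<le> 32 * A * (2 ^ j) powr (- 1 / 4)"
    if IH: "S (Suc j) \<le> 32 * A * (2 ^ Suc j) powr (- 1 / 4)" and j: "2 ^ j < X" for j
  proof -
    let ?E = "{k\<in>K. D k > 2 ^ j \<and> D k \<le> 2 ^ Suc j}"
    have sp: "{k\<in>K. D k > 2 ^ j} = ?E \<union> {k\<in>K. D k > 2 ^ Suc j}"
    proof -
      have "D k > 2 ^ j" if "D k > 2 ^ Suc j" for k using that order.strict_trans1[of "2 ^ j" "2 ^ Suc j" "D k"] by simp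
      then show ?thesis by force
    qed
    have "S j = (\<Sum>k\<in>?E. D k powr (- 9 / 4)) + S (Suc j)"
      unfolding S_def sp using assms(1) by (intro sum.union_disjoint) auto
    moreover have "(\<Sum>k\<in>?E. D k powr (- 9 / 4)) \<le> 4 * A * (2 ^ j) powr (- 1 / 4)"
    proof -
      have "(\<Sum>k\<in>?E. D k powr (- 9 / 4)) \<le> real (card ?E) * (2 ^ j) powr (- 9 / 4)"
        by (rule sum_bounded_above) (auto intro!: powr_mono2')
      also have "\<dots> \<le> real (card {k\<in>K. D k \<le> 2 ^ Suc j}) * (2 ^ j) powr (- 9 / 4)"
        using assms(1) by (intro mult_right_mono of_nat_mono card_mono) auto
      also have "\<dots> \<le> (A * (2 ^ Suc j)\<^sup>2) * (2 ^ j) powr (- 9 / 4)"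
        using j one_le_power[of "2::real" "Suc j"] by (intro mult_right_mono count) auto
      also have "\<dots> = 4 * A * ((2 ^ j)\<^sup>2 * (2 ^ j) powr (- 9 / 4))" by (simp add: power_mult_distrib)
      also have "(2 ^ j)\<^sup>2 * (2 ^ j) powr (- 9 / 4) = (2 ^ j) powr (- 1 / 4 :: real)"
        using powr_add[of "2 ^ j :: real" 2 "- 9 / 4"] by simp
      finally show ?thesis .
    qed
    moreover have "(2 ^ Suc j) powr (- 1 / 4) \<le> 7 / 8 * (2 ^ j) powr (- 1 / 4 :: real)"
    proof -
      have "(2 ^ Suc j) powr (- 1 / 4 :: real) = 2 powr (- 1 / 4) * (2 ^ j) powr (- 1 / 4)"
        by (simp add: powr_mult)
      moreover have "(8 / 7) powr 4 \<le> (2 :: real)" by (simp add: power_divide)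
      then have "2 powr (- 1 / 4 :: real) \<le> ((8 / 7) powr 4) powr (- 1 / 4)"
        by (intro powr_mono2') auto
      moreover have "((8 / 7) powr 4) powr (- 1 / 4) = (7 / 8 :: real)" unfolding powr_powr by (simp add: powr_minus)
      ultimately show ?thesis by simp
    qed
    then have "32 * A * (2 ^ Suc j) powr (- 1 / 4) \<le> 32 * A * (7 / 8 * (2 ^ j) powr (- 1 / 4))"
      using assms(2) by (intro mult_left_mono) auto
    ultimately show ?thesis using IH by (simp add: algebra_simps)
  qed
  have "S j \<le> 32 * A * (2 ^ j) powr (- 1 / 4)"
  proof (cases "j \<le> J")
    case True
    then show ?thesis
    proof (induction j rule: inc_induct)
      case base
      show ?case by (rule \<open>\<And>j. X \<le> 2 ^ j \<Longrightarrow> S j \<le> 32 * A * (2 ^ j) powr (- 1 / 4)\<close>[OF J])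
    next
      case (step n)
      show ?case
      proof (cases "X \<le> 2 ^ n")
        case True
        then show ?thesis by (rule \<open>\<And>j. X \<le> 2 ^ j \<Longrightarrow> S j \<le> 32 * A * (2 ^ j) powr (- 1 / 4)\<close>)
      next
        case False
        then show ?thesis using step.IH \<open>\<And>j. S (Suc j) \<le> 32 * A * (2 ^ Suc j) powr (- 1 / 4) \<Longrightarrow> 2 ^ j < X \<Longrightarrow> S j \<le> 32 * A * (2 ^ j) powr (- 1 / 4)\<close> by simp
      qed
    qed
  next
    case False
    then have "(2::real) ^ J \<le> 2 ^ j" by (intro power_increasing) auto
    from base[OF order.trans[OF J this]] show ?thesis .
  qed
  then show ?thesis by (simp add: S_def)
qed

text \<open>
  On a major arc, shifting the summation index by \<open>q\<close> multiplies each term by \<open>expi (q \<xi>)\<close> up to an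
  error \<open>O(s / R)\<close>, while it changes the sum only by boundary terms. Hence the sum is nearly
  invariant under multiplication by \<open>expi (q \<xi>)\<close>, and is small unless \<open>q \<xi>\<close> is near an integer.
\<close>

lemma weyl_sum_major_arc_bound:
  fixes q a :: int and s :: real
  assumes q: "1 \<le> q" "of_int q + (real R)\<^sup>2 * \<bar>of_int q * \<theta> - of_int a\<bar> \<le> s" and R: "s \<le> real R" "R \<ge> 1"
  shows "norm (weyl_sum R \<theta> \<xi>) * dist_int (of_int q * \<xi>) \<le> 33 * s"
proof -
  define f where "f m = expi (\<theta> * of_int (m\<^sup>2) + \<xi> * of_int m)" for m :: int
  define \<gamma> where "\<gamma> = of_int q * \<theta> - of_int a"
  define w where "w = expi (\<xi> * of_int q)"
  let ?I = "{- int R..int R}"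
  have Rpos: "real R > 0" using R by simp
  have pr: "(real R)\<^sup>2 * \<bar>\<gamma>\<bar> \<ge> 0" by simp
  have qs: "real_of_int q \<le> s" using q(2) pr unfolding \<gamma>_def by linarith
  have qR: "q \<le> int R" using qs R(1) by linarith
  have "(real R)\<^sup>2 * \<bar>\<gamma>\<bar> \<le> s" using q unfolding \<gamma>_def by linarith
  then have gR: "real R * \<bar>\<gamma>\<bar> \<le> s / real R" using Rpos by (simp add: field_simps power2_eq_square)
  have F: "weyl_sum R \<theta> \<xi> = (\<Sum>m\<in>?I. f m)" by (simp add: weyl_sum_def f_def)
  have nf: "norm (f m) = 1" for m by (simp add: f_def)
  have step: "norm (f (m + q) - f m * w) \<le> 21 * (s / real R)" if "m \<in> ?I" for m
  proof -
    have "f (m + q) = f m * w * expi (of_int (2 * m + q) * \<gamma>)"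
    proof -
      have e: "\<theta> * of_int ((m + q)\<^sup>2) + \<xi> * of_int (m + q) = (\<theta> * of_int (m\<^sup>2) + \<xi> * of_int m) + \<xi> * of_int q + of_int (2 * m + q) * \<gamma> + of_int ((2 * m + q) * a)"
        unfolding \<gamma>_def by (simp add: power2_eq_square algebra_simps)
      show ?thesis unfolding f_def w_def e expi_add_int by (simp only: expi_add)
    qed
    then have "f (m + q) - f m * w = f m * w * (expi (of_int (2 * m + q) * \<gamma>) - 1)" by (simp add: algebra_simps)
    then have "norm (f (m + q) - f m * w) = norm (expi (of_int (2 * m + q) * \<gamma>) - 1)"
      by (simp add: norm_mult nf w_def)
    also have "\<dots> \<le> 7 * \<bar>of_int (2 * m + q) * \<gamma>\<bar>" by (rule norm_expi_minus_one_le)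
    also have "\<bar>of_int (2 * m + q) * \<gamma>\<bar> \<le> (3 * real R) * \<bar>\<gamma>\<bar>"
    proof -
      have "\<bar>2 * m + q\<bar> \<le> 3 * int R" using that qR q by (auto simp: abs_le_iff)
      then have "real_of_int \<bar>2 * m + q\<bar> \<le> 3 * real R" by linarith
      then show ?thesis unfolding abs_mult of_int_abs[symmetric] by (rule mult_right_mono) simp
    qed
    finally show ?thesis using gR by simp
  qed
  have "norm ((\<Sum>m\<in>?I. f (m + q)) - (\<Sum>m\<in>?I. f m) * w) \<le> (\<Sum>m\<in>?I. 21 * (s / real R))"
    unfolding sum_distrib_right sum_subtractf[symmetric] by (rule sum_norm_le) (rule step)
  also have "\<dots> = (2 * real R + 1) * (21 * (s / real R))" by simp
  also have "\<dots> \<le> (3 * real R) * (21 * (s / real R))"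
    using R qs q by (intro mult_right_mono) auto
  also have "\<dots> = 63 * s" using Rpos by simp
  finally have 1: "norm ((\<Sum>m\<in>?I. f (m + q)) - (\<Sum>m\<in>?I. f m) * w) \<le> 63 * s" .
  have "(\<Sum>m\<in>?I. f (m + q)) = (\<Sum>m\<in>{- int R + q..int R + q}. f m)"
    by (rule sum.reindex_bij_witness[of _ "\<lambda>m. m - q" "\<lambda>m. m + q"]) auto
  moreover have "{- int R..int R + q} = ?I \<union> {int R + 1..int R + q}" "{- int R..int R + q} = {- int R..- int R + q - 1} \<union> {- int R + q..int R + q}"
    using qR q by auto
  then have "(\<Sum>m\<in>?I. f m) + (\<Sum>m\<in>{int R + 1..int R + q}. f m) = (\<Sum>m\<in>{- int R..- int R + q - 1}. f m) + (\<Sum>m\<in>{- int R + q..int R + q}. f m)"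
    by (subst (1 2) sum.union_disjoint[symmetric]) auto
  ultimately have diff: "(\<Sum>m\<in>?I. f (m + q)) - (\<Sum>m\<in>?I. f m) = (\<Sum>m\<in>{int R + 1..int R + q}. f m) - (\<Sum>m\<in>{- int R..- int R + q - 1}. f m)"
    by (simp add: algebra_simps)
  have "norm (\<Sum>m\<in>{int R + 1..int R + q}. f m) \<le> (\<Sum>m\<in>{int R + 1..int R + q}. 1)" by (rule sum_norm_le) (simp add: nf)
  moreover have "norm (\<Sum>m\<in>{- int R..- int R + q - 1}. f m) \<le> (\<Sum>m\<in>{- int R..- int R + q - 1}. 1)" by (rule sum_norm_le) (simp add: nf)
  ultimately have 2: "norm ((\<Sum>m\<in>?I. f (m + q)) - (\<Sum>m\<in>?I. f m)) \<le> 2 * s"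
    unfolding diff using norm_triangle_ineq4[of "\<Sum>m\<in>{int R + 1..int R + q}. f m" "\<Sum>m\<in>{- int R..- int R + q - 1}. f m"] qs q by simp
  have "norm (weyl_sum R \<theta> \<xi>) * (2 * dist_int (of_int q * \<xi>)) \<le> norm (weyl_sum R \<theta> \<xi>) * norm (w - 1)"
    using norm_expi_minus_one_ge[of "of_int q * \<xi>"] unfolding w_def by (intro mult_left_mono) (auto simp: mult.commute)
  also have "\<dots> = norm (((\<Sum>m\<in>?I. f (m + q)) - (\<Sum>m\<in>?I. f m)) - ((\<Sum>m\<in>?I. f (m + q)) - (\<Sum>m\<in>?I. f m) * w))"
    unfolding F norm_mult[symmetric] by (rule arg_cong[of _ _ norm]) (simp add: right_diff_distrib)
  also have "\<dots> \<le> 2 * s + 63 * s" by (rule order.trans[OF norm_triangle_ineq4 add_mono[OF 2 1]])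
  finally show ?thesis using qs q by simp
qed

text \<open>
  On the points of height greater than \<open>s0\<close> the Weyl bound gives \<open>R ^ d D powr (- 9 d / 20)\<close> for the
  product, and \<open>9 d / 20 \<ge> 9 / 4 > 2\<close> since \<open>d \<ge> 5\<close>; so their contribution is a small multiple of
  \<open>R ^ (d - 2)\<close> once \<open>s0\<close> is large. The remaining points form a set of proportion \<open>O(s0\<^sup>2 / R\<^sup>2)\<close>, on
  which the factor of the exceptional coordinate is small once \<open>L\<close> is large in terms of \<open>s0\<close>.
\<close>

theorem sphere_sum_small:
  assumes d: "CARD('d::finite) \<ge> 5" and \<epsilon>: "\<epsilon> > 0"
  shows "\<exists>(s0::nat) (L::real) (\<Lambda>::real). s0 \<ge> 1 \<and> L > 0 \<and> \<Lambda> > 0 \<and>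
    (\<forall>(l::int) (\<xi> :: 'd \<Rightarrow> real). \<Lambda> \<le> of_int l \<longrightarrow>
      (\<exists>i. \<forall>q\<in>{1..s0}. L / sqrt (of_int l) \<le> dist_int (real q * \<xi> i)) \<longrightarrow>
      norm (sphere_sum l \<xi>) \<le> \<epsilon> * sqrt (of_int l) ^ (CARD('d) - 2))"
proof -
  let ?d = "CARD('d)"
  define C :: real where "C = 142 ^ ?d"
  have C: "C > 0" by (simp add: C_def)
  \<comment> \<open>\<open>192 = 32 * 6\<close> is the product of the constants in \<open>dyadic_sum_bound\<close> and \<open>card_major_arcs_le\<close>.\<close>
  have "((\<lambda>j::nat. C * 192 * (2 ^ j) powr (- 1 / 4)) \<longlongrightarrow> 0) sequentially" by real_asymp
  then have "eventually (\<lambda>j::nat. C * 192 * (2 ^ j) powr (- 1 / 4) < \<epsilon> / 2) sequentially"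
    using \<epsilon> by (intro order_tendstoD) auto
  then obtain j0 :: nat where j0: "C * 192 * (2 ^ j0) powr (- 1 / 4) < \<epsilon> / 2"
    by (auto simp: eventually_sequentially)
  define s0 :: nat where "s0 = 2 ^ j0"
  have s01: "s0 \<ge> 1" by (simp add: s0_def)
  define L where "L = 3 ^ (?d - 1) * 66 * real s0 * (6 * (real s0)\<^sup>2) * 2 / \<epsilon>"
  have L: "L > 0" using \<epsilon> s01 by (simp add: L_def)
  define \<Lambda> where "\<Lambda> = (real s0 + 20)\<^sup>2"
  have \<Lambda>: "\<Lambda> > 0" unfolding \<Lambda>_def by (intro zero_less_power) simp
  have main: "norm (sphere_sum l \<xi>) \<le> \<epsilon> * sqrt (of_int l) ^ (?d - 2)"
    if l: "\<Lambda> \<le> of_int l" and i0: "\<forall>q\<in>{1..s0}. L / sqrt (of_int l) \<le> dist_int (real q * \<xi> i0)"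
    for l and \<xi> :: "'d \<Rightarrow> real" and i0
  proof -
    define x where "x = sqrt (real_of_int l)"
    have x20: "x \<ge> real s0 + 20" unfolding x_def using l by (intro real_le_rsqrt) (simp add: \<Lambda>_def)
    define R where "R = nat \<lfloor>x\<rfloor>"
    have fl: "real R = of_int \<lfloor>x\<rfloor>" using x20 by (simp add: R_def)
    have R: "real R \<le> x" "x < real R + 1" unfolding fl by linarith+
    have R19: "real R \<ge> 19 + real s0" using R x20 by linarith
    then have R1: "real R \<ge> 1" "R \<ge> 1" "x \<le> 2 * real R" using R s01 by auto
    have xx: "x\<^sup>2 = of_int l" unfolding x_def using l \<Lambda> by simp
    have l0: "0 \<le> l" using l \<Lambda> by linarith
    have "x\<^sup>2 < (real R + 1)\<^sup>2" using R(2) x20 by (intro power_strict_mono) auto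
    then have "real_of_int l < real_of_int ((int R + 1)\<^sup>2)" unfolding xx by simp
    then have lR: "l < (int R + 1)\<^sup>2" by linarith
    \<comment> \<open>Exceeds \<open>norm_sq v\<close> on the box \<open>{- R..R}\<close> of dimension \<open>d\<close>, and also \<open>l < (R + 1)\<^sup>2 \<le> 4 R\<^sup>2\<close>.\<close>
    define M where "M = (?d + 4) * R\<^sup>2"
    have RR: "R\<^sup>2 \<ge> 1" using R1 by simp
    have dM: "?d * R\<^sup>2 < M" unfolding M_def using R1(2) by (simp add: distrib_right)
    have RM: "R\<^sup>2 \<le> M" unfolding M_def by simp
    have lM: "l < int M"
    proof -
      have "(int R + 1)\<^sup>2 \<le> (2 * int R)\<^sup>2" using R1 by (intro power_mono) auto
      also have "\<dots> = int (4 * R\<^sup>2)" by (simp add: power_mult_distrib)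
      also have "\<dots> \<le> int M" unfolding M_def by (intro of_nat_mono mult_right_mono) auto
      finally show ?thesis using lR by simp
    qed
    have M0: "real M > 0" using RM RR by simp
    have "\<forall>k. \<exists>q a :: int. 1 \<le> q \<and> of_int q + (real R)\<^sup>2 * \<bar>of_int q * (real k / real M) - of_int a\<bar> \<le> 9 * real R \<and>
      (\<forall>\<eta>. (norm (weyl_sum R (real k / real M) \<eta>))\<^sup>2 \<le>
      20000 * (real R)\<^sup>2 * (of_int q + (real R)\<^sup>2 * \<bar>of_int q * (real k / real M) - of_int a\<bar>) powr (- 9 / 10))"
      using weyl_sum_bound[OF R1(2)] by blast
    then obtain q a :: "nat \<Rightarrow> int" where q1: "\<And>k. 1 \<le> q k"
      and D9: "\<And>k. of_int (q k) + (real R)\<^sup>2 * \<bar>of_int (q k) * (real k / real M) - of_int (a k)\<bar> \<le> 9 * real R"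
      and W: "\<And>k \<eta>. (norm (weyl_sum R (real k / real M) \<eta>))\<^sup>2 \<le>
      20000 * (real R)\<^sup>2 * (of_int (q k) + (real R)\<^sup>2 * \<bar>of_int (q k) * (real k / real M) - of_int (a k)\<bar>) powr (- 9 / 10)"
      by metis
    define D where "D k = of_int (q k) + (real R)\<^sup>2 * \<bar>of_int (q k) * (real k / real M) - of_int (a k)\<bar>" for k
    have D1: "D k \<ge> 1" for k
    proof -
      have "real_of_int (q k) \<ge> 1" using q1[of k] by linarith
      moreover have "(real R)\<^sup>2 * \<bar>of_int (q k) * (real k / real M) - of_int (a k)\<bar> \<ge> 0" by simp
      ultimately show ?thesis unfolding D_def by linarith
    qed
    have count: "real (card {k. k < M \<and> D k \<le> s}) \<le> 6 * s\<^sup>2 * real M / (real R)\<^sup>2"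
      if "1 \<le> s" "s < (real R)\<^sup>2" for s
      unfolding D_def by (rule card_major_arcs_le) (use q1 that RM R1 in auto)
    \<comment> \<open>\<open>142\<^sup>2 = 20164\<close> exceeds the constant of the Weyl bound.\<close>
    have W1: "norm (weyl_sum R (real k / real M) \<eta>) \<le> 142 * real R * D k powr (- 9 / 20)" for k \<eta>
    proof (rule power2_le_imp_le)
      have "(D k powr (- 9 / 20))\<^sup>2 = D k powr (- 9 / 10)"
        using D1[of k] by (simp add: power2_eq_square flip: powr_add)
      then have "(142 * real R * D k powr (- 9 / 20))\<^sup>2 = 20164 * (real R)\<^sup>2 * D k powr (- 9 / 10)"
        by (simp add: power_mult_distrib)
      moreover have "20000 * ((real R)\<^sup>2 * D k powr (- 9 / 10)) \<le> 20164 * ((real R)\<^sup>2 * D k powr (- 9 / 10))"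
        by (intro mult_right_mono) auto
      ultimately show "(norm (weyl_sum R (real k / real M) \<eta>))\<^sup>2 \<le> (142 * real R * D k powr (- 9 / 20))\<^sup>2"
        using W[of k \<eta>] unfolding D_def[symmetric] by linarith
    qed (use R1 in simp)
    let ?P = "\<lambda>k. norm (\<Prod>i\<in>UNIV. weyl_sum R (real k / real M) (\<xi> i))"
    have minor: "?P k \<le> C * real R ^ ?d * D k powr (- 9 / 4)" for k
    proof -
      have "?P k \<le> (\<Prod>i\<in>(UNIV::'d set). 142 * real R * D k powr (- 9 / 20))"
        unfolding prod_norm[symmetric] by (intro prod_mono conjI norm_ge_zero W1)
      also have "\<dots> = C * real R ^ ?d * (D k powr (- 9 / 20)) ^ ?d"
        by (simp add: C_def power_mult_distrib)
      also have "\<dots> \<le> C * real R ^ ?d * (D k powr (- 9 / 20)) ^ 5"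
      proof (intro mult_left_mono power_decreasing)
        show "D k powr (- 9 / 20) \<le> 1" using D1[of k] powr_mono[of "- 9 / 20" 0 "D k"] by simp
      qed (use d C in auto)
      also have "(D k powr (- 9 / 20)) ^ 5 = D k powr (- 9 / 4)"
        using D1[of k] by (simp add: powr_powr flip: powr_realpow)
      finally show ?thesis .
    qed
    have major: "?P k \<le> (3 * real R) ^ (?d - 1) * (66 * real s0 * real R / L)" if Dk: "D k \<le> real s0" for k
    proof -
      define b where "b = nat (q k)"
      have bq: "real_of_int (q k) = real b" "b \<ge> 1" using q1[of k] by (simp_all add: b_def)
      have "(real R)\<^sup>2 * \<bar>of_int (q k) * (real k / real M) - of_int (a k)\<bar> \<ge> 0" by simp
      then have "real b \<le> real s0" using Dk unfolding D_def bq by linarith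
      then have "b \<in> {1..s0}" using bq by simp
      then have "L / x \<le> dist_int (real b * \<xi> i0)" using i0 by (auto simp: x_def)
      moreover have "norm (weyl_sum R (real k / real M) (\<xi> i0)) * dist_int (of_int (q k) * \<xi> i0) \<le> 33 * real s0"
        by (rule weyl_sum_major_arc_bound[where a = "a k"]) (use q1 Dk R19 R1 in \<open>auto simp: D_def\<close>)
      ultimately have "norm (weyl_sum R (real k / real M) (\<xi> i0)) * (L / x) \<le> 33 * real s0"
        unfolding bq by (meson mult_left_mono norm_ge_zero order.trans)
      then have "norm (weyl_sum R (real k / real M) (\<xi> i0)) \<le> 33 * real s0 * x / L"
        using L x20 by (simp add: field_simps)
      also have "\<dots> \<le> 33 * real s0 * (2 * real R) / L" using R1 L by (intro divide_right_mono mult_left_mono) auto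
      finally have 1: "norm (weyl_sum R (real k / real M) (\<xi> i0)) \<le> 66 * real s0 * real R / L" by simp
      have "?P k = (\<Prod>i\<in>UNIV - {i0}. norm (weyl_sum R (real k / real M) (\<xi> i))) * norm (weyl_sum R (real k / real M) (\<xi> i0))"
        unfolding prod_norm[symmetric] by (subst prod.remove[of _ i0]) auto
      also have "\<dots> \<le> (\<Prod>i\<in>UNIV - {i0}. 3 * real R) * (66 * real s0 * real R / L)"
      proof (intro mult_mono 1 prod_mono conjI prod_nonneg)
        fix i show "norm (weyl_sum R (real k / real M) (\<xi> i)) \<le> 3 * real R"
          using norm_weyl_sum_le[of R "real k / real M" "\<xi> i"] R1 by linarith
      qed (use R1 in auto)
      also have "\<dots> = (3 * real R) ^ (?d - 1) * (66 * real s0 * real R / L)" by (simp add: card_Diff_singleton)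
      finally show ?thesis .
    qed
    have s0R: "real s0 < (real R)\<^sup>2"
    proof -
      have "real R * 1 \<le> real R * real R" using R1 by (intro mult_left_mono) auto
      then show ?thesis using R19 unfolding power2_eq_square by linarith
    qed
    obtain n where n: "?d = n + 2" using d that[of "?d - 2"] by simp
    have pw1: "real R ^ (?d - 1) * real R = real R ^ (?d - 2) * (real R)\<^sup>2"
      unfolding n by (simp add: power2_eq_square)
    have pw2: "real R ^ ?d / (real R)\<^sup>2 = real R ^ (?d - 2)"
      unfolding n using R1 by (simp add: power2_eq_square)
    have S1: "(\<Sum>k | k < M \<and> D k \<le> real s0. ?P k) \<le> real M * (\<epsilon> / 2 * real R ^ (?d - 2))"
    proof -
      have "(\<Sum>k | k < M \<and> D k \<le> real s0. ?P k) \<le> real (card {k. k < M \<and> D k \<le> real s0}) * ((3 * real R) ^ (?d - 1) * (66 * real s0 * real R / L))"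
        by (rule sum_bounded_above) (use major in auto)
      also have "\<dots> \<le> (6 * (real s0)\<^sup>2 * real M / (real R)\<^sup>2) * ((3 * real R) ^ (?d - 1) * (66 * real s0 * real R / L))"
        using s01 s0R L by (intro mult_right_mono count) auto
      also have "\<dots> = real M * (\<epsilon> / 2) * ((real R ^ (?d - 1) * real R) / (real R)\<^sup>2)"
        unfolding L_def using \<epsilon> s01 R1 by (simp add: power_mult_distrib field_simps)
      also note pw1
      finally show ?thesis using R1 by (simp add: mult_ac)
    qed
    have S2: "(\<Sum>k | k < M \<and> D k > real s0. ?P k) \<le> real M * (\<epsilon> / 2 * real R ^ (?d - 2))"
    proof -
      have "(\<Sum>k | k < M \<and> D k > real s0. ?P k) \<le> (\<Sum>k | k < M \<and> D k > real s0. C * real R ^ ?d * D k powr (- 9 / 4))"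
        by (rule sum_mono) (rule minor)
      also have "\<dots> = C * real R ^ ?d * (\<Sum>k\<in>{k\<in>{..<M}. D k > 2 ^ j0}. D k powr (- 9 / 4))"
        unfolding sum_distrib_left s0_def by (intro sum.cong) auto
      also have "\<dots> \<le> C * real R ^ ?d * (32 * (6 * real M / (real R)\<^sup>2) * (2 ^ j0) powr (- 1 / 4))"
      proof (intro mult_left_mono dyadic_sum_bound[where X = "9 * real R"])
        fix s :: real assume s: "1 \<le> s" "s \<le> 2 * (9 * real R)"
        have "19 * real R \<le> real R * real R" using R19 by (intro mult_right_mono) auto
        then have "s < (real R)\<^sup>2" using s R1 unfolding power2_eq_square by linarith
        from count[OF s(1) this] show "real (card {k \<in> {..<M}. D k \<le> s}) \<le> 6 * real M / (real R)\<^sup>2 * s\<^sup>2"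
          by (simp add: mult_ac)
      qed (use D9 C in \<open>auto simp: D_def\<close>)
      also have "\<dots> = real M * (C * 192 * (2 ^ j0) powr (- 1 / 4)) * (real R ^ ?d / (real R)\<^sup>2)" by (simp add: mult_ac)
      also note pw2
      also have "real M * (C * 192 * (2 ^ j0) powr (- 1 / 4)) * real R ^ (?d - 2) \<le> real M * (\<epsilon> / 2) * real R ^ (?d - 2)"
        using j0 by (intro mult_right_mono mult_left_mono) auto
      finally show ?thesis by (simp add: mult_ac)
    qed
    have "real M * norm (sphere_sum l \<xi>) = norm (of_nat M * sphere_sum l \<xi>)" by (simp add: norm_mult)
    also have "\<dots> \<le> (\<Sum>k<M. ?P k)"
      unfolding sphere_sum_eq[OF l0 lR lM dM] by (rule sum_norm_le) (simp add: norm_mult)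
    also have "\<dots> = (\<Sum>k | k < M \<and> D k \<le> real s0. ?P k) + (\<Sum>k | k < M \<and> D k > real s0. ?P k)"
      by (subst sum.union_disjoint[symmetric]) (auto intro!: sum.cong)
    also have "\<dots> \<le> real M * (\<epsilon> * real R ^ (?d - 2))" using S1 S2 by (simp add: algebra_simps)
    finally have "norm (sphere_sum l \<xi>) \<le> \<epsilon> * real R ^ (?d - 2)" using M0 by simp
    also have "\<dots> \<le> \<epsilon> * x ^ (?d - 2)" using R R1 \<epsilon> by (intro mult_left_mono power_mono) auto
    finally show ?thesis by (simp add: x_def)
  qed
  show ?thesis using s01 L \<Lambda> main by blast
qed

section \<open>Fourier analysis of finite lattice sets\<close>

definition char_vec :: "nat \<Rightarrow> int ^ 'd::finite \<Rightarrow> int ^ 'd \<Rightarrow> complex" where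
  "char_vec L k x = expi (\<Sum>i\<in>UNIV. of_int (k $ i) / real L * of_int (x $ i))"

definition freqs :: "nat \<Rightarrow> (int ^ 'd::finite) set" where
  "freqs L = {k. \<forall>i. k $ i \<in> {0..<int L}}"

definition energy :: "(int ^ 'd::finite) set \<Rightarrow> nat \<Rightarrow> int ^ 'd \<Rightarrow> real" where
  "energy B L k = (norm (\<Sum>x\<in>B. char_vec L k x))\<^sup>2"

lemma finite_freqs: "finite (freqs L :: (int ^ 'd::finite) set)"
  unfolding freqs_def by (rule finite_vec_set) simp

lemma energy_nonneg [simp]: "0 \<le> energy B L k" by (simp add: energy_def)

lemma char_vec_add: "char_vec L k (x + y) = char_vec L k x * char_vec L k y"
  unfolding char_vec_def expi_add[symmetric] by (simp add: distrib_left sum.distrib)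
lemma char_vec_diff: "char_vec L k (x - y) = char_vec L k x * cnj (char_vec L k y)"
  unfolding char_vec_def expi_diff[symmetric] by (simp add: right_diff_distrib sum_subtractf)
lemma char_vec_0 [simp]: "char_vec L k 0 = 1" by (simp add: char_vec_def)

lemma sum_expi_interval:
  fixes z :: int
  assumes "L > 0" "\<bar>z\<bar> < int L"
  shows "(\<Sum>t\<in>{0..<int L}. expi (of_int t / real L * of_int z)) = (if z = 0 then of_nat L else 0)"
proof -
  have "(\<Sum>t\<in>{0..<int L}. expi (of_int t / real L * of_int z)) = (\<Sum>k<L. expi (real k * (of_int z / real L)))"
    by (rule sum.reindex_bij_witness[of _ int nat]) auto
  moreover have "int L dvd z \<longleftrightarrow> z = 0"
    using assms zdvd_imp_le[of "int L" "\<bar>z\<bar>"] by auto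
  ultimately show ?thesis using sum_expi_roots_of_unity[OF assms(1), of z] by simp
qed

lemma sum_char_vec_box:
  fixes x :: "int ^ 'd::finite"
  assumes that: "finite S"
  shows "(\<Sum>k\<in>{k. \<forall>i. k $ i \<in> S}. char_vec L k x) = (\<Prod>i\<in>UNIV. \<Sum>t\<in>S. expi (of_int t / real L * of_int (x $ i)))"
proof -
  have "(\<Prod>i\<in>UNIV. \<Sum>t\<in>S. expi (of_int t / real L * of_int (x $ i))) =
     (\<Sum>g\<in>PiE UNIV (\<lambda>_. S). \<Prod>i\<in>UNIV. expi (of_int (g i) / real L * of_int (x $ i)))"
    using that by (intro prod_sum_PiE) auto
  also have "\<dots> = (\<Sum>g\<in>PiE UNIV (\<lambda>_. S). char_vec L (vec_lambda g) x)"
    unfolding char_vec_def expi_sum[symmetric] by simp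
  also have "\<dots> = (\<Sum>k\<in>{k. \<forall>i. k $ i \<in> S}. char_vec L k x)"
    by (rule sum.reindex_bij_betw[OF bij_betw_vec_lambda])
  finally show ?thesis by simp
qed

lemma char_vec_commute: "char_vec L k x = char_vec L x k"
  by (simp add: char_vec_def mult.commute)

lemma sum_freqs_char_vec:
  fixes x :: "int ^ 'd::finite"
  assumes "L > 0" "\<And>i. \<bar>x $ i\<bar> < int L"
  shows "(\<Sum>k\<in>freqs L. char_vec L k x) = (if x = 0 then of_nat L ^ CARD('d) else 0)"
proof -
  have "(\<Sum>k\<in>freqs L. char_vec L k x) = (\<Prod>i\<in>UNIV. if x $ i = 0 then of_nat L else 0)"
    unfolding freqs_def sum_char_vec_box[OF finite_atLeastLessThan_int]
    by (intro prod.cong refl sum_expi_interval assms)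
  also have "\<dots> = (if x = 0 then of_nat L ^ CARD('d) else 0)"
  proof (cases "x = 0")
    case False
    then obtain i where "x $ i \<noteq> 0" by (auto simp: vec_eq_iff)
    then have "(\<Prod>i\<in>UNIV. if x $ i = 0 then of_nat L else 0) = (0::complex)" by (intro prod_zero) auto
    then show ?thesis using False by simp
  qed simp
  finally show ?thesis .
qed

text \<open>
  Parseval on the group of residues modulo \<open>L\<close>. As \<open>L\<close> exceeds all differences that occur, the
  equation \<open>y = x + u v\<close> modulo \<open>L\<close> is the equation over the integers.
\<close>

lemma translate_count_eq:
  fixes B :: "(int ^ 'd::finite) set" and u :: "'v \<Rightarrow> int ^ 'd"
  assumes "finite B" "finite V" and L: "L > 0"
    and small: "\<And>x y v i. x \<in> B \<Longrightarrow> y \<in> B \<Longrightarrow> v \<in> V \<Longrightarrow> \<bar>x $ i - y $ i + u v $ i\<bar> < int L"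
  shows "(\<Sum>v\<in>V. \<Sum>x\<in>B. of_bool (x + u v \<in> B)) * real L ^ CARD('d) =
    (\<Sum>k\<in>freqs L. energy B L k * Re (\<Sum>v\<in>V. char_vec L k (u v)))"
proof -
  have e: "complex_of_real (energy B L k) = (\<Sum>x\<in>B. \<Sum>y\<in>B. char_vec L k x * cnj (char_vec L k y))" for k
    unfolding energy_def complex_norm_square cnj_sum sum_product ..
  have "(\<Sum>k\<in>freqs L. of_real (energy B L k) * (\<Sum>v\<in>V. char_vec L k (u v)))
     = (\<Sum>k\<in>freqs L. \<Sum>v\<in>V. \<Sum>x\<in>B. \<Sum>y\<in>B. char_vec L k (x - y + u v))"
  proof (rule sum.cong[OF refl])
    fix k
    have "of_real (energy B L k) * (\<Sum>v\<in>V. char_vec L k (u v)) = (\<Sum>v\<in>V. of_real (energy B L k) * char_vec L k (u v))"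
      by (rule sum_distrib_left)
    also have "\<dots> = (\<Sum>v\<in>V. \<Sum>x\<in>B. \<Sum>y\<in>B. char_vec L k (x - y + u v))"
      unfolding e sum_distrib_right char_vec_add char_vec_diff ..
    finally show "of_real (energy B L k) * (\<Sum>v\<in>V. char_vec L k (u v)) = (\<Sum>v\<in>V. \<Sum>x\<in>B. \<Sum>y\<in>B. char_vec L k (x - y + u v))" .
  qed
  also have "\<dots> = (\<Sum>v\<in>V. \<Sum>k\<in>freqs L. \<Sum>x\<in>B. \<Sum>y\<in>B. char_vec L k (x - y + u v))" by (rule sum.swap)
  also have "\<dots> = (\<Sum>v\<in>V. \<Sum>x\<in>B. \<Sum>y\<in>B. \<Sum>k\<in>freqs L. char_vec L k (x - y + u v))"
  proof (rule sum.cong[OF refl])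
    fix v
    have "(\<Sum>k\<in>freqs L. \<Sum>x\<in>B. \<Sum>y\<in>B. char_vec L k (x - y + u v)) = (\<Sum>x\<in>B. \<Sum>k\<in>freqs L. \<Sum>y\<in>B. char_vec L k (x - y + u v))"
      by (rule sum.swap)
    also have "\<dots> = (\<Sum>x\<in>B. \<Sum>y\<in>B. \<Sum>k\<in>freqs L. char_vec L k (x - y + u v))"
      by (intro sum.cong refl sum.swap)
    finally show "(\<Sum>k\<in>freqs L. \<Sum>x\<in>B. \<Sum>y\<in>B. char_vec L k (x - y + u v)) = (\<Sum>x\<in>B. \<Sum>y\<in>B. \<Sum>k\<in>freqs L. char_vec L k (x - y + u v))" .
  qed
  also have "\<dots> = (\<Sum>v\<in>V. \<Sum>x\<in>B. \<Sum>y\<in>B. if y = x + u v then of_nat L ^ CARD('d) else 0)"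
  proof (intro sum.cong refl)
    fix v x y assume "v \<in> V" "x \<in> B" "y \<in> B"
    then have "(\<Sum>k\<in>freqs L. char_vec L k (x - y + u v)) = (if x - y + u v = 0 then of_nat L ^ CARD('d) else 0)"
      using small by (intro sum_freqs_char_vec[OF L]) simp
    also have "x - y + u v = 0 \<longleftrightarrow> y = x + u v" by (auto simp: algebra_simps)
    finally show "(\<Sum>k\<in>freqs L. char_vec L k (x - y + u v)) = (if y = x + u v then of_nat L ^ CARD('d) else 0)" .
  qed
  also have "\<dots> = of_real ((\<Sum>v\<in>V. \<Sum>x\<in>B. of_bool (x + u v \<in> B)) * real L ^ CARD('d))"
    unfolding sum_distrib_right of_real_sum
    by (intro sum.cong refl) (simp add: sum.delta[OF assms(1)])
  finally have "Re (\<Sum>k\<in>freqs L. of_real (energy B L k) * (\<Sum>v\<in>V. char_vec L k (u v))) = (\<Sum>v\<in>V. \<Sum>x\<in>B. of_bool (x + u v \<in> B)) * real L ^ CARD('d)"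
    by (simp only: Re_complex_of_real)
  then show ?thesis by simp
qed

lemma energy_total:
  fixes B :: "(int ^ 'd::finite) set"
  assumes "finite B" "L > 0" "\<And>x y i. x \<in> B \<Longrightarrow> y \<in> B \<Longrightarrow> \<bar>x $ i - y $ i\<bar> < int L"
  shows "(\<Sum>k\<in>freqs L. energy B L k) = real (card B) * real L ^ CARD('d)"
proof -
  have "(\<Sum>v\<in>{()}. \<Sum>x\<in>B. of_bool (x + 0 \<in> B)) * real L ^ CARD('d) = (\<Sum>k\<in>freqs L. energy B L k * Re (\<Sum>v\<in>{()}. char_vec L k 0))"
    by (rule translate_count_eq) (use assms in auto)
  then show ?thesis by simp
qed

text \<open>
  The Cauchy-Schwarz inequality for the number of representations \<open>z = x + a\<close>, which is supported on a
  box of side \<open>2 N + H\<close>.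
\<close>

lemma fejer_lower_bound:
  fixes B :: "(int ^ 'd::finite) set"
  assumes B: "B \<subseteq> lattice_box N" and H: "H \<ge> 1"
  defines "X \<equiv> {a :: int ^ 'd. \<forall>i. a $ i \<in> {0..<int H}}"
  shows "(real (card B) * real H ^ CARD('d))\<^sup>2 \<le> real (2 * N + H) ^ CARD('d) * (\<Sum>(a, b)\<in>X \<times> X. \<Sum>x\<in>B. of_bool (x + (a - b) \<in> B))"
proof -
  have finB: "finite B" using B finite_lattice_box by (rule finite_subset)
  have finX: "finite X" unfolding X_def by (rule finite_vec_set) simp
  have cardX: "card X = H ^ CARD('d)" unfolding X_def by (subst card_vec_set) auto
  define Z where "Z = {z :: int ^ 'd. \<forall>i. z $ i \<in> {- int N..int N + int H - 1}}"
  have finZ: "finite Z" unfolding Z_def by (rule finite_vec_set) simp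
  have cardZ: "card Z = (2 * N + H) ^ CARD('d)"
  proof -
    have "card {- int N..int N + int H - 1} = 2 * N + H" by simp
    then show ?thesis unfolding Z_def by (simp only: card_vec_set finite_atLeastAtMost_int)
  qed
  have inZ: "x + a \<in> Z" if "x \<in> B" "a \<in> X" for x a
    unfolding Z_def
  proof (intro CollectI allI)
    fix i
    have "- int N \<le> x $ i" "x $ i \<le> int N" "0 \<le> a $ i" "a $ i < int H"
      using that B by (auto simp: X_def lattice_box_def subset_iff)
    then show "(x + a) $ i \<in> {- int N..int N + int H - 1}" by simp
  qed
  define f where "f z = real (card {(x, a) \<in> B \<times> X. x + a = z})" for z
  have "real (card B) * real H ^ CARD('d) = real (card (B \<times> X))" unfolding card_cartesian_product cardX by simp
  also have "\<dots> = (\<Sum>z\<in>Z. f z)"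
  proof -
    have "card (B \<times> X) = (\<Sum>z\<in>Z. card {y \<in> B \<times> X. (\<lambda>(x, a). x + a) y = z})"
      using sum.group[of "B \<times> X" Z "\<lambda>(x, a). x + a" "\<lambda>_. 1::nat"] finB finX finZ inZ by fastforce
    moreover have "{y \<in> B \<times> X. (\<lambda>(x, a). x + a) y = z} = {(x, a) \<in> B \<times> X. x + a = z}" for z by auto
    ultimately show ?thesis unfolding f_def by simp
  qed
  finally have "(real (card B) * real H ^ CARD('d))\<^sup>2 = (\<Sum>z\<in>Z. 1 * f z)\<^sup>2" by simp
  also have "\<dots> \<le> (\<Sum>z\<in>Z. 1\<^sup>2) * (\<Sum>z\<in>Z. (f z)\<^sup>2)" by (rule Cauchy_Schwarz_ineq_sum)
  also have "(\<Sum>z\<in>Z. (f z)\<^sup>2) = (\<Sum>(a, b)\<in>X \<times> X. \<Sum>x\<in>B. of_bool (x + (a - b) \<in> B))"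
  proof -
    let ?P = "\<lambda>z. {(x, a) \<in> B \<times> X. x + a = z} \<times> {(x, a) \<in> B \<times> X. x + a = z}"
    let ?T = "{((a, b), x) \<in> (X \<times> X) \<times> B. x + (a - b) \<in> B}"
    have finP: "finite {(x, a) \<in> B \<times> X. x + a = z}" for z
      by (rule finite_subset[of _ "B \<times> X"]) (use finB finX in auto)
    have "(\<Sum>z\<in>Z. (f z)\<^sup>2) = real (\<Sum>z\<in>Z. card (?P z))"
      unfolding f_def by (simp add: card_cartesian_product power2_eq_square)
    also have "(\<Sum>z\<in>Z. card (?P z)) = card (Sigma Z ?P)"
      using finZ finP by (simp add: card_SigmaI)
    also have "card (Sigma Z ?P) = card ?T"
    proof (rule bij_betw_same_card[OF bij_betwI[where
        f = "\<lambda>(z, (x, a), (y, b)). ((a, b), x)" and g = "\<lambda>((a, b), x). (x + a, (x, a), (x + (a - b), b))"]])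
      show "(\<lambda>(z, (x, a), (y, b)). ((a, b), x)) \<in> Sigma Z ?P \<rightarrow> ?T"
      proof clarify
        fix z x a y b assume "x \<in> B" "a \<in> X" "y \<in> B" "b \<in> X" and eq: "y + b = x + a"
        moreover have "x + (a - b) = y" using eq by (simp add: algebra_simps)
        ultimately show "((a, b), x) \<in> (X \<times> X) \<times> B \<and> x + (a - b) \<in> B" by simp
      qed
      show "(\<lambda>((a, b), x). (x + a, (x, a), (x + (a - b), b))) \<in> ?T \<rightarrow> Sigma Z ?P"
        using inZ by auto
    qed (auto simp: algebra_simps)
    also have "real (card ?T) = (\<Sum>y\<in>(X \<times> X) \<times> B. of_bool (y \<in> ?T))"
    proof -
      have "?T \<subseteq> (X \<times> X) \<times> B" by auto
      then have "(X \<times> X) \<times> B \<inter> ?T = ?T" by blast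
      then show ?thesis using finX finB by (simp add: of_bool_def sum.If_cases)
    qed
    also have "\<dots> = (\<Sum>(y, x)\<in>(X \<times> X) \<times> B. of_bool (x + (fst y - snd y) \<in> B))"
      by (intro sum.cong refl) auto
    also have "\<dots> = (\<Sum>y\<in>X \<times> X. \<Sum>x\<in>B. of_bool (x + (fst y - snd y) \<in> B))"
      by (rule sum.cartesian_product[symmetric])
    finally show ?thesis by (simp add: case_prod_unfold)
  qed
  also have "(\<Sum>z\<in>Z. 1\<^sup>2 :: real) = real (2 * N + H) ^ CARD('d)" by (simp add: cardZ)
  finally show ?thesis .
qed

text \<open>
  Test the energy against the Fejer kernel of side \<open>N\<close>. In total it is large by the previous lemma;
  outside of the frequencies within \<open>\<eta>\<close> of \<open>0\<close> the kernel is at most \<open>1 / (N \<eta>)\<^sup>2\<close> of its maximum.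
\<close>

lemma low_frequency_energy:
  fixes B :: "(int ^ 'd::finite) set"
  assumes B: "B \<subseteq> lattice_box N" and N: "N \<ge> 1" and L: "3 * N < L" and \<eta>: "\<eta> > 0"
  shows "real L ^ CARD('d) * (real (card B) * (real (card B) / (3 * real N) ^ CARD('d) - 1 / (real N * \<eta>)\<^sup>2))
    \<le> (\<Sum>k | k \<in> freqs L \<and> (\<forall>i. dist_int (of_int (k $ i) / real L) \<le> \<eta>). energy B L k)"
proof -
  let ?d = "CARD('d)"
  define X where "X = {a :: int ^ 'd. \<forall>i. a $ i \<in> {0..<int N}}"
  define g where "g k = norm (\<Sum>a\<in>X. char_vec L k a)" for k
  define G where "G = {k :: int ^ 'd. k \<in> freqs L \<and> (\<forall>i. dist_int (of_int (k $ i) / real L) \<le> \<eta>)}"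
  have Lpos: "L > 0" using L by simp
  have finB: "finite B" using B finite_lattice_box by (rule finite_subset)
  have finX: "finite X" unfolding X_def by (rule finite_vec_set) simp
  have cardX: "card X = N ^ ?d" unfolding X_def by (subst card_vec_set) auto
  have Bi: "- int N \<le> x $ i" "x $ i \<le> int N" if "x \<in> B" for x i using that B by (auto simp: lattice_box_def)
  have total: "(\<Sum>k\<in>freqs L. energy B L k) = real (card B) * real L ^ ?d"
  proof (rule energy_total[OF finB Lpos])
    fix x y i assume "x \<in> B" "y \<in> B"
    then show "\<bar>x $ i - y $ i\<bar> < int L" using Bi[of x i] Bi[of y i] L by linarith
  qed
  have gle: "(g k)\<^sup>2 \<le> (real N ^ ?d)\<^sup>2 * (if k \<in> G then 1 else 1 / (real N * \<eta>)\<^sup>2)" if k: "k \<in> freqs L" for k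
  proof (cases "k \<in> G")
    case True
    have "g k \<le> (\<Sum>a\<in>X. 1)" unfolding g_def by (rule sum_norm_le) (simp add: char_vec_def)
    then have "g k \<le> real N ^ ?d" by (simp add: cardX)
    then show ?thesis using True by (simp add: g_def power_mono)
  next
    case False
    then obtain i where i: "\<eta> < dist_int (of_int (k $ i) / real L)" using k by (auto simp: G_def not_le)
    let ?s = "\<lambda>j. \<Sum>t\<in>{0..<int N}. expi (of_int t / real L * of_int (k $ j))"
    have s1: "norm (?s j) \<le> real N" for j
    proof -
      have "norm (?s j) \<le> (\<Sum>t\<in>{0..<int N}. 1)" by (rule sum_norm_le) simp
      then show ?thesis by simp
    qed
    have int_iv: "{0..int N - 1} = {0..<int N}" by auto
    have si: "norm (?s i) * dist_int (of_int (k $ i) / real L) \<le> 1"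
      using norm_geometric_expi[where a = 0 and b = "int N - 1" and x = "of_int (k $ i) / real L"]
      unfolding int_iv by (simp add: mult_ac)
    have "norm (?s i) * \<eta> \<le> norm (?s i) * dist_int (of_int (k $ i) / real L)" using i by (intro mult_left_mono) auto
    then have "norm (?s i) \<le> 1 / \<eta>" using si \<eta> by (simp add: field_simps)
    then have "norm (?s i) * (\<Prod>j\<in>UNIV - {i}. norm (?s j)) \<le> 1 / \<eta> * (\<Prod>j\<in>UNIV - {i}. real N)"
      using \<eta> by (intro mult_mono prod_mono conjI s1 prod_nonneg) auto
    moreover have "g k = norm (?s i) * (\<Prod>j\<in>UNIV - {i}. norm (?s j))"
    proof -
      have "(\<Sum>a\<in>X. char_vec L k a) = (\<Sum>a\<in>X. char_vec L a k)" by (simp only: char_vec_commute)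
      also have "\<dots> = (\<Prod>j\<in>UNIV. ?s j)" unfolding X_def by (rule sum_char_vec_box) simp
      finally have "g k = (\<Prod>j\<in>UNIV. norm (?s j))" by (simp add: g_def prod_norm)
      also have "\<dots> = norm (?s i) * (\<Prod>j\<in>UNIV - {i}. norm (?s j))" by (rule prod.remove) auto
      finally show ?thesis .
    qed
    ultimately have "g k \<le> 1 / \<eta> * real N ^ (?d - 1)" by (simp add: card_Diff_singleton)
    also have "\<dots> = real N ^ ?d * (1 / (real N * \<eta>))"
    proof -
      have "real N ^ ?d = real N ^ (?d - 1) * real N" using power_minus_mult[of ?d "real N"] by simp
      then show ?thesis using N by simp
    qed
    finally have "(g k)\<^sup>2 \<le> (real N ^ ?d * (1 / (real N * \<eta>)))\<^sup>2" by (intro power_mono) (simp_all add: g_def)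
    then show ?thesis using False by (simp add: power_mult_distrib power_divide)
  qed
  let ?W = "\<Sum>(a, b)\<in>X \<times> X. \<Sum>x\<in>B. of_bool (x + (a - b) \<in> B) :: real"
  have "?W * real L ^ ?d = (\<Sum>k\<in>freqs L. energy B L k * Re (\<Sum>v\<in>X \<times> X. char_vec L k (fst v - snd v)))"
    unfolding case_prod_unfold
  proof (rule translate_count_eq)
    fix x y v i assume "x \<in> B" "y \<in> B" "v \<in> X \<times> X"
    then have "fst v $ i \<in> {0..<int N}" "snd v $ i \<in> {0..<int N}" by (auto simp: X_def)
    then have "\<bar>fst v $ i - snd v $ i\<bar> < int N" unfolding atLeastLessThan_iff by linarith
    moreover have "\<bar>x $ i - y $ i\<bar> \<le> 2 * int N" using Bi[OF \<open>x \<in> B\<close>, of i] Bi[OF \<open>y \<in> B\<close>, of i] by linarith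
    ultimately show "\<bar>x $ i - y $ i + (fst v - snd v) $ i\<bar> < int L" using L unfolding vector_minus_component by linarith
  qed (use finB finX Lpos in auto)
  also have "\<dots> = (\<Sum>k\<in>freqs L. energy B L k * (g k)\<^sup>2)"
  proof (intro sum.cong refl arg_cong[of _ _ "\<lambda>t. energy B L _ * t"])
    fix k
    have "complex_of_real ((g k)\<^sup>2) = (\<Sum>a\<in>X. \<Sum>b\<in>X. char_vec L k a * cnj (char_vec L k b))"
      unfolding g_def complex_norm_square cnj_sum sum_product ..
    also have "\<dots> = (\<Sum>v\<in>X \<times> X. char_vec L k (fst v - snd v))"
      unfolding sum.cartesian_product char_vec_diff by (simp add: case_prod_unfold)
    finally show "Re (\<Sum>v\<in>X \<times> X. char_vec L k (fst v - snd v)) = (g k)\<^sup>2" by (metis Re_complex_of_real)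
  qed
  also have "\<dots> \<le> (\<Sum>k\<in>freqs L. energy B L k * ((real N ^ ?d)\<^sup>2 * (if k \<in> G then 1 else 1 / (real N * \<eta>)\<^sup>2)))"
    by (intro sum_mono mult_left_mono gle) auto
  also have "\<dots> \<le> (\<Sum>k\<in>freqs L. (real N ^ ?d)\<^sup>2 * ((if k \<in> G then energy B L k else 0) + energy B L k * (1 / (real N * \<eta>)\<^sup>2)))"
    by (intro sum_mono) (auto simp: mult_ac distrib_left)
  also have "\<dots> = (real N ^ ?d)\<^sup>2 * ((\<Sum>k\<in>freqs L. if k \<in> G then energy B L k else 0) + (\<Sum>k\<in>freqs L. energy B L k) * (1 / (real N * \<eta>)\<^sup>2))"
    unfolding sum_distrib_left[symmetric] sum.distrib sum_distrib_right[symmetric] ..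
  also have "(\<Sum>k\<in>freqs L. if k \<in> G then energy B L k else 0) = (\<Sum>k\<in>G. energy B L k)"
    using finite_freqs by (intro sum.mono_neutral_cong_right) (auto simp: G_def)
  finally have W: "?W * real L ^ ?d \<le> (real N ^ ?d)\<^sup>2 * ((\<Sum>k\<in>G. energy B L k) + real (card B) * real L ^ ?d * (1 / (real N * \<eta>)\<^sup>2))"
    unfolding total .
  have "(real (card B) * real N ^ ?d)\<^sup>2 \<le> (3 * real N) ^ ?d * ?W"
    using fejer_lower_bound[OF B N] unfolding X_def[symmetric] by simp
  then have "(real N ^ ?d)\<^sup>2 * ((real (card B))\<^sup>2 / (3 * real N) ^ ?d) \<le> ?W"
    using N by (simp add: power_mult_distrib field_simps)
  then have "(real N ^ ?d)\<^sup>2 * ((real (card B))\<^sup>2 / (3 * real N) ^ ?d) * real L ^ ?d \<le> ?W * real L ^ ?d"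
    by (rule mult_right_mono) simp
  then have "(real N ^ ?d)\<^sup>2 * ((real (card B))\<^sup>2 / (3 * real N) ^ ?d * real L ^ ?d) \<le>
     (real N ^ ?d)\<^sup>2 * ((\<Sum>k\<in>G. energy B L k) + real (card B) * real L ^ ?d * (1 / (real N * \<eta>)\<^sup>2))"
    using W unfolding mult.assoc by linarith
  then have "(real (card B))\<^sup>2 / (3 * real N) ^ ?d * real L ^ ?d \<le> (\<Sum>k\<in>G. energy B L k) + real (card B) * real L ^ ?d * (1 / (real N * \<eta>)\<^sup>2)"
    using N by (simp only: mult_le_cancel_left_pos zero_less_power of_nat_0_less_iff)
  then show ?thesis unfolding G_def[symmetric] by (simp add: algebra_simps power2_eq_square)
qed

section \<open>Supersaturation in dense sets\<close>

text \<open>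
  The set of good indices is an upper segment. Every index below it is negligible, except possibly
  the last one before it (or \<open>J\<close> if no index is good), which costs at most 1.
\<close>

lemma sum_gap_lower_bound:
  fixes a :: "nat \<Rightarrow> real" and G :: "nat \<Rightarrow> bool"
  assumes mono: "\<And>j. j < J \<Longrightarrow> G j \<Longrightarrow> G (Suc j)"
    and good: "\<And>j. j \<le> J \<Longrightarrow> G j \<Longrightarrow> 1 / 2 \<le> a j"
    and small: "\<And>j. j < J \<Longrightarrow> \<not> G (Suc j) \<Longrightarrow> - \<epsilon> \<le> a j"
    and triv: "\<And>j. -1 \<le> a j" and \<epsilon>: "0 \<le> \<epsilon>"
  shows "real (J + 1) / 2 * of_bool (G 0) - 1 - \<epsilon> * real (J + 1) \<le> (\<Sum>j=0..J. a j)"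
proof -
  have mono': "G j'" if "j \<le> j'" "j' \<le> J" "G j" for j j'
    using that by (induction j' rule: dec_induct) (auto intro: mono)
  show ?thesis
  proof (cases "G 0")
    case True
    have "(\<Sum>j=0..J. 1 / 2) \<le> (\<Sum>j=0..J. a j)"
    proof (rule sum_mono)
      fix j assume "j \<in> {0..J}"
      then have "j \<le> J" by simp
      show "1 / 2 \<le> a j" by (rule good[OF \<open>j \<le> J\<close> mono'[OF le0 \<open>j \<le> J\<close> True]])
    qed
    then have "real (J + 1) / 2 \<le> (\<Sum>j=0..J. a j)" by simp
    moreover have "0 \<le> \<epsilon> * real (J + 1)" using \<epsilon> by simp
    moreover have g: "of_bool (G 0) = (1::real)" using True by simp
    ultimately show ?thesis unfolding g mult_1_right by linarith
  next
    case False
    define E where "E = {j\<in>{0..J}. \<not> G j \<and> (j = J \<or> G (Suc j))}"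
    \<comment> \<open>\<open>E\<close> holds the only index that may be neither good nor negligible.\<close>
    have "card E \<le> 1"
    proof -
      have "i = j" if "i \<in> E" "j \<in> E" "i \<le> j" for i j
      proof (rule ccontr)
        assume "i \<noteq> j"
        then have "Suc i \<le> j" "i \<noteq> J" using that by (auto simp: E_def)
        then have "G j" using that mono'[of "Suc i" j] by (auto simp: E_def)
        then show False using that by (simp add: E_def)
      qed
      then have "\<forall>i\<in>E. \<forall>j\<in>E. i = j" by (metis nat_le_linear)
      then show ?thesis using card_le_Suc0_iff_eq[of E] by (simp add: E_def)
    qed
    have "(\<Sum>j=0..J. - \<epsilon> - of_bool (j \<in> E)) \<le> (\<Sum>j=0..J. a j)"
    proof (rule sum_mono)
      fix j assume j: "j \<in> {0..J}"
      show "- \<epsilon> - of_bool (j \<in> E) \<le> a j"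
      proof (cases "j \<in> E")
        case True then show ?thesis using triv[of j] \<epsilon> by simp
      next
        case nE: False
        show ?thesis
        proof (cases "G j")
          case True then show ?thesis using good[of j] j nE \<epsilon> by simp
        next
          case F: False
          then have "j < J" "\<not> G (Suc j)" using nE j by (auto simp: E_def)
          then show ?thesis using small[of j] nE by simp
        qed
      qed
    qed
    moreover have "(\<Sum>j=0..J. - \<epsilon> - of_bool (j \<in> E)) = - (\<epsilon> * real (J + 1)) - real (card E)"
    proof -
      have "E \<subseteq> {0..J}" by (auto simp: E_def)
      then have "{0..J} \<inter> E = E" by blast
      then have "(\<Sum>j=0..J. of_bool (j \<in> E)) = real (card E)" by (simp add: of_bool_def sum.If_cases)
      then show ?thesis by (simp add: sum_subtractf)
    qed
    ultimately show ?thesis using False \<open>card E \<le> 1\<close> by simp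
  qed
qed

lemma Re_expi_ge_half: "dist_int x \<le> 1 / 8 \<Longrightarrow> 1 / 2 \<le> Re (expi x)"
proof -
  assume x: "dist_int x \<le> 1 / 8"
  define y where "y = x - of_int (round x)"
  have y: "\<bar>y\<bar> \<le> 1 / 8" using x by (simp add: y_def dist_int_def)
  have "expi x = expi y" using expi_add_int[of y "round x"] by (simp add: y_def)
  then have "Re (expi x) = cos (2 * pi * \<bar>y\<bar>)" by (cases "y \<ge> 0") (simp_all add: expi_def)
  moreover have "cos (pi / 3) \<le> cos (2 * pi * \<bar>y\<bar>)"
  proof (rule cos_monotone_0_pi_le)
    have "\<bar>y\<bar> * pi \<le> 1 / 8 * pi" using y by (intro mult_right_mono) auto
    then show "2 * pi * \<bar>y\<bar> \<le> pi / 3" using pi_gt_zero by (simp add: mult_ac)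
  qed auto
  ultimately show ?thesis by (simp add: cos_60)
qed

lemma dist_int_sum_le:
  "dist_int (\<Sum>i\<in>A. of_int (n i) * x i) \<le> (\<Sum>i\<in>A. \<bar>of_int (n i)\<bar> * dist_int (x i))"
proof (cases "finite A")
  case True
  have "dist_int (\<Sum>i\<in>A. of_int (n i) * x i) \<le> \<bar>(\<Sum>i\<in>A. of_int (n i) * x i) - of_int (\<Sum>i\<in>A. n i * round (x i))\<bar>"
    by (rule dist_int_le)
  also have "\<dots> = \<bar>\<Sum>i\<in>A. of_int (n i) * (x i - of_int (round (x i)))\<bar>"
    by (simp add: sum_subtractf right_diff_distrib)
  also have "\<dots> \<le> (\<Sum>i\<in>A. \<bar>of_int (n i) * (x i - of_int (round (x i)))\<bar>)" by (rule sum_abs)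
  finally show ?thesis by (simp add: dist_int_def abs_mult)
qed (simp add: dist_int_def)

lemma sphere_component_le: "v \<in> lattice_sphere l \<Longrightarrow> \<bar>of_int (v $ i)\<bar> \<le> sqrt (of_int l)"
proof -
  assume "v \<in> lattice_sphere l"
  then have "(v $ i)\<^sup>2 \<le> l" using component_sq_le_norm_sq[of v i] by (simp add: lattice_sphere_def)
  then have "real_of_int ((v $ i)\<^sup>2) \<le> real_of_int l" by (simp only: of_int_le_iff)
  then have "sqrt ((real_of_int (v $ i))\<^sup>2) \<le> sqrt (of_int l)" by (intro real_sqrt_le_mono) simp
  then show ?thesis by simp
qed

lemma norm_sphere_sum_le:
  fixes \<xi> :: "'d::finite \<Rightarrow> real"
  shows "norm (sphere_sum l \<xi>) \<le> real (card (lattice_sphere l :: (int ^ 'd) set))"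
proof -
  have "norm (sphere_sum l \<xi>) \<le> (\<Sum>v\<in>(lattice_sphere l :: (int ^ 'd) set). 1)"
    unfolding sphere_sum_def by (rule sum_norm_le) simp
  then show ?thesis by simp
qed

text \<open>
  Each phase is within \<open>1 / 8\<close> of an integer, as a coordinate of \<open>v\<close> is at most the radius.
\<close>

lemma Re_sphere_sum_ge_half:
  fixes \<xi> :: "'d::finite \<Rightarrow> real"
  assumes "\<And>i. dist_int (\<xi> i) \<le> 1 / (8 * real CARD('d)) / sqrt (of_int l)" "l > 0"
  shows "1 / 2 * real (card (lattice_sphere l :: (int ^ 'd) set)) \<le> Re (sphere_sum l \<xi>)"
proof -
  have "(\<Sum>v\<in>(lattice_sphere l :: (int ^ 'd) set). 1 / 2) \<le> (\<Sum>v\<in>(lattice_sphere l :: (int ^ 'd) set). Re (expi (\<Sum>i\<in>UNIV. \<xi> i * of_int (v $ i))))"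
  proof (rule sum_mono)
    fix v :: "int ^ 'd" assume v: "v \<in> lattice_sphere l"
    have "dist_int (\<Sum>i\<in>UNIV. of_int (v $ i) * \<xi> i) \<le> (\<Sum>i\<in>UNIV. \<bar>of_int (v $ i)\<bar> * dist_int (\<xi> i))"
      by (rule dist_int_sum_le)
    also have "\<dots> \<le> (\<Sum>i\<in>(UNIV :: 'd set). sqrt (of_int l) * (1 / (8 * real CARD('d)) / sqrt (of_int l)))"
      using sphere_component_le[OF v] assms by (intro sum_mono mult_mono) auto
    also have "\<dots> = 1 / 8" using assms(2) by simp
    finally show "1 / 2 \<le> Re (expi (\<Sum>i\<in>UNIV. \<xi> i * of_int (v $ i)))"
      by (intro Re_expi_ge_half) (simp add: mult.commute)
  qed
  then show ?thesis by (simp add: sphere_sum_def)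
qed

text \<open>
  The Fourier multiplier of the average over the sphere dilated by \<open>q\<close> is the normalised sphere sum
  at \<open>q \<xi>\<close>.
\<close>

lemma sum_sphere_avg_eq:
  fixes B :: "(int ^ 'd::finite) set"
  assumes B: "B \<subseteq> lattice_box N" and L: "2 * int N + int q * l < int L" and l: "l > 0"
  shows "(\<Sum>x\<in>B. sphere_avg q l (indicator B) x) * real L ^ CARD('d) =
    (\<Sum>k\<in>freqs L. energy B L k * (Re (sphere_sum l (\<lambda>i. real q * (of_int (k $ i) / real L))) / real (card (lattice_sphere l :: (int ^ 'd) set))))"
proof -
  let ?S = "lattice_sphere l :: (int ^ 'd) set" and ?d = "CARD('d)"
  have finB: "finite B" using B finite_lattice_box by (rule finite_subset)
  have "0 \<le> int q * l" using l by simp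
  then have "0 < int L" using L by linarith
  then have Lpos: "L > 0" by simp
  have "(\<Sum>x\<in>B. sphere_avg q l (indicator B) x) = (\<Sum>v\<in>?S. \<Sum>x\<in>B. of_bool (x + int q *s v \<in> B)) / real (card ?S)"
  proof -
    have "(\<Sum>x\<in>B. sphere_avg q l (indicator B) x) = (\<Sum>x\<in>B. \<Sum>v\<in>?S. of_bool (x + int q *s v \<in> B)) / real (card ?S)"
      unfolding sphere_avg_def by (simp add: sum_divide_distrib indicator_def of_bool_def)
    also have "(\<Sum>x\<in>B. \<Sum>v\<in>?S. of_bool (x + int q *s v \<in> B) :: real) = (\<Sum>v\<in>?S. \<Sum>x\<in>B. of_bool (x + int q *s v \<in> B))"
      by (rule sum.swap)
    finally show ?thesis .
  qed
  moreover have "(\<Sum>v\<in>?S. \<Sum>x\<in>B. of_bool (x + int q *s v \<in> B)) * real L ^ ?d =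
      (\<Sum>k\<in>freqs L. energy B L k * Re (\<Sum>v\<in>?S. char_vec L k (int q *s v)))"
  proof (rule translate_count_eq)
    fix x y v i assume "x \<in> B" "y \<in> B" and v: "v \<in> ?S"
    then have "- int N \<le> x $ i" "x $ i \<le> int N" "- int N \<le> y $ i" "y $ i \<le> int N" using B by (auto simp: lattice_box_def)
    moreover have "(v $ i)\<^sup>2 \<le> l" using component_sq_le_norm_sq[of v i] v by (simp add: lattice_sphere_def)
    then have "\<bar>v $ i\<bar> \<le> l" by (rule abs_le_of_square_le)
    then have "int q * \<bar>v $ i\<bar> \<le> int q * l" by (rule mult_left_mono) simp
    then have "\<bar>(int q *s v) $ i\<bar> \<le> int q * l" by (simp add: abs_mult)
    ultimately show "\<bar>x $ i - y $ i + (int q *s v) $ i\<bar> < int L" using L by linarith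
  qed (use finB Lpos in auto)
  moreover have "(\<Sum>v\<in>?S. char_vec L k (int q *s v)) = sphere_sum l (\<lambda>i. real q * (of_int (k $ i) / real L))" for k :: "int ^ 'd"
    unfolding sphere_sum_def char_vec_def by (simp add: mult_ac)
  ultimately have "(\<Sum>x\<in>B. sphere_avg q l (indicator B) x) * real L ^ ?d =
      (\<Sum>k\<in>freqs L. energy B L k * Re (sphere_sum l (\<lambda>i. real q * (of_int (k $ i) / real L)))) / real (card ?S)"
    by simp
  then show ?thesis by (simp add: sum_divide_distrib)
qed

text \<open>
  Order of choices: \<open>J\<close> from the proportion \<open>\<kappa>1\<close> of low-frequency energy, then the tolerance \<open>\<epsilon>\<close>,
  then the bound \<open>s0\<close> on denominators and the width \<open>L0\<close> given by the circle method, then \<open>r\<close> as a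
  common multiple of the denominators, and finally \<open>s\<close>, large enough for a frequency that is not
  negligible at one scale to be good at the next.
\<close>

theorem dense_supersaturation:
  assumes d: "CARD('d::finite) \<ge> 5" and \<delta>: "\<delta> > 0"
  shows "\<exists>(r::nat) (s::nat) (J::nat) (\<kappa>::real) (c2::real) (\<Lambda>::real). 2 \<le> r \<and> r < s \<and> \<kappa> > 0 \<and> c2 > 0 \<and> \<Lambda> > 0 \<and>
    (\<forall>N (l::int) (B :: (int ^ 'd) set). B \<subseteq> lattice_box N \<longrightarrow>
      \<delta> * real (card (lattice_box N :: (int ^ 'd) set)) \<le> real (card B) \<longrightarrow>
      \<Lambda> \<le> of_int l \<longrightarrow> of_int l \<le> c2 * (real N)\<^sup>2 \<longrightarrow>
      \<kappa> * real (card (lattice_box N :: (int ^ 'd) set)) \<le>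
        (\<Sum>x\<in>B. \<Sum>j=0..J. sphere_avg (r ^ j) (int s ^ (2 * (J - j)) * l) (indicator B) x))"
proof -
  let ?d = "CARD('d)"
  define \<kappa>1 where "\<kappa>1 = \<delta> * (2 / 3) ^ ?d"
  have \<kappa>1: "\<kappa>1 > 0" using \<delta> by (simp add: \<kappa>1_def)
  \<comment> \<open>With \<open>\<epsilon> = \<kappa>1 / 16\<close> this gives \<open>(J + 1) (\<kappa>1 / 4 - \<epsilon>) \<ge> 3 / 2\<close>, against a loss of 1.\<close>
  obtain J :: nat where J: "8 / \<kappa>1 \<le> real J" using real_arch_simple by blast
  define \<epsilon> where "\<epsilon> = \<kappa>1 / 16"
  have \<epsilon>: "\<epsilon> > 0" using \<kappa>1 by (simp add: \<epsilon>_def)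
  obtain cS where cS: "cS > 0" and S: "\<And>l::int. real_of_int l \<ge> 8 * real ?d \<Longrightarrow>
    cS * sqrt (real_of_int l) ^ (?d - 2) \<le> real (card (lattice_sphere l :: (int ^ 'd) set))"
    using card_lattice_sphere_lower_bound[OF d] by blast
  have "\<epsilon> * cS > 0" using \<epsilon> cS by simp
  from sphere_sum_small[OF d this] obtain s0 :: nat and L0 \<Lambda>0 :: real where s0: "s0 \<ge> 1" and L0: "L0 > 0" and \<Lambda>0: "\<Lambda>0 > 0"
    and small0: "\<forall>(l::int) (\<xi> :: 'd \<Rightarrow> real). \<Lambda>0 \<le> of_int l \<longrightarrow>
      (\<exists>i. \<forall>q\<in>{1..s0}. L0 / sqrt (of_int l) \<le> dist_int (real q * \<xi> i)) \<longrightarrow>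
      norm (sphere_sum l \<xi>) \<le> \<epsilon> * cS * sqrt (of_int l) ^ (?d - 2)" by blast
  define \<eta> where "\<eta> = 1 / (8 * real ?d)"
  have \<eta>: "\<eta> > 0" by (simp add: \<eta>_def)
  \<comment> \<open>The factor 2 only ensures \<open>r \<ge> 2\<close>.\<close>
  define r :: nat where "r = 2 * fact s0"
  have r: "2 \<le> r" using fact_ge_1[of s0, where 'a = nat] by (simp add: r_def)
  have rpos: "real r > 0" using r by simp
  define s :: nat where "s = nat \<lceil>real r * L0 / \<eta>\<rceil> + r + 1"
  have s: "r < s" "real r * L0 / \<eta> \<le> real s" unfolding s_def by linarith+
  have spos: "real s > 0" "real s \<ge> 1" using s r by linarith+
  \<comment> \<open>Keeps the largest radius so small that the Fejer kernel of side \<open>N\<close> resolves the frequencies good for \<open>j = 0\<close>.\<close>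
  define c2 where "c2 = \<eta>\<^sup>2 * \<kappa>1 / (2 * real s ^ (2 * J))"
  have c2: "c2 > 0" using \<eta> \<kappa>1 spos by (simp add: c2_def)
  define \<Lambda> where "\<Lambda> = max \<Lambda>0 (8 * real ?d)"
  have \<Lambda>: "\<Lambda> > 0" using \<Lambda>0 by (simp add: \<Lambda>_def)
  have main: "\<delta> / 2 * real (card (lattice_box N :: (int ^ 'd) set)) \<le>
        (\<Sum>x\<in>B. \<Sum>j=0..J. sphere_avg (r ^ j) (int s ^ (2 * (J - j)) * l) (indicator B) x)"
    if B: "B \<subseteq> lattice_box N" and dens: "\<delta> * real (card (lattice_box N :: (int ^ 'd) set)) \<le> real (card B)"
      and l: "\<Lambda> \<le> of_int l" "of_int l \<le> c2 * (real N)\<^sup>2"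
    for N and l :: int and B :: "(int ^ 'd) set"
  proof -
    have l0: "real_of_int l > 0" using l \<Lambda> by linarith
    then have l1: "l > 0" by simp
    have N: "N \<ge> 1" using l l0 by (cases "N = 0") auto
    define lj where "lj j = int s ^ (2 * (J - j)) * l" for j
    define \<rho> where "\<rho> j = real s ^ (J - j) * sqrt (of_int l)" for j
    have lj1: "lj j > 0" for j using l1 spos by (simp add: lj_def)
    have ljl: "l \<le> lj j" for j
    proof -
      have "1 * l \<le> int s ^ (2 * (J - j)) * l" using s r l1 by (intro mult_right_mono) auto
      then show ?thesis by (simp add: lj_def)
    qed
    have \<rho>: "sqrt (of_int (lj j)) = \<rho> j" for j
    proof -
      have "of_int (lj j) = (real s ^ (J - j))\<^sup>2 * of_int l" by (simp add: lj_def power_mult mult.commute flip: power_mult)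
      then show ?thesis by (simp add: \<rho>_def real_sqrt_mult)
    qed
    have \<rho>pos: "\<rho> j > 0" for j using spos l0 by (simp add: \<rho>_def)
    have \<rho>Suc: "\<rho> j = real s * \<rho> (Suc j)" if "j < J" for j
    proof -
      have "J - j = Suc (J - Suc j)" using that by simp
      then show ?thesis by (simp add: \<rho>_def)
    qed
    have cardS: "cS * \<rho> j ^ (?d - 2) \<le> real (card (lattice_sphere (lj j) :: (int ^ 'd) set))"
      "real (card (lattice_sphere (lj j) :: (int ^ 'd) set)) > 0" for j
    proof -
      have "real_of_int l \<le> real_of_int (lj j)" using ljl by simp
      then have "8 * real ?d \<le> real_of_int (lj j)" using l(1) unfolding \<Lambda>_def by linarith
      from S[OF this] show *: "cS * \<rho> j ^ (?d - 2) \<le> real (card (lattice_sphere (lj j) :: (int ^ 'd) set))" unfolding \<rho> .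
      have "cS * \<rho> j ^ (?d - 2) > 0" using cS \<rho>pos[of j] by simp
      then show "real (card (lattice_sphere (lj j) :: (int ^ 'd) set)) > 0" using * by linarith
    qed
    \<comment> \<open>A modulus so large that nothing wraps around at any of the scales.\<close>
    define L where "L = 3 * N + 1 + nat (\<Sum>j=0..J. int (r ^ j) * lj j)"
    have Lj: "2 * int N + int (r ^ j) * lj j < int L" if "j \<le> J" for j
    proof -
      have nn: "0 \<le> int (r ^ i) * lj i" for i using lj1[of i] by simp
      have "int (r ^ j) * lj j \<le> (\<Sum>j=0..J. int (r ^ j) * lj j)"
        by (rule member_le_sum) (use that nn in auto)
      then show ?thesis unfolding L_def by simp
    qed
    have Lpos: "real L > 0" by (simp add: L_def)
    define \<xi> where "\<xi> k i = real_of_int (k $ i) / real L" for k :: "int ^ 'd" and i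
    define m where "m j k = Re (sphere_sum (lj j) (\<lambda>i. real (r ^ j) * \<xi> k i)) / real (card (lattice_sphere (lj j) :: (int ^ 'd) set))" for j and k :: "int ^ 'd"
    define G where "G k j \<longleftrightarrow> (\<forall>i. dist_int (real (r ^ j) * \<xi> k i) \<le> \<eta> / \<rho> j)" for k :: "int ^ 'd" and j
    have point: "real (J + 1) / 2 * of_bool (G k 0) - 1 - \<epsilon> * real (J + 1) \<le> (\<Sum>j=0..J. m j k)" for k
    proof (rule sum_gap_lower_bound)
      fix j assume j: "j < J" and G: "G k j"
      show "G k (Suc j)" unfolding G_def
      proof
        fix i
        have "dist_int (real (r ^ Suc j) * \<xi> k i) = dist_int (of_int (int r) * (real (r ^ j) * \<xi> k i))" by (simp add: mult.assoc)
        also have "\<dots> \<le> real r * dist_int (real (r ^ j) * \<xi> k i)"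
          using dist_int_int_mult_le[of "int r" "real (r ^ j) * \<xi> k i"] by simp
        also have "\<dots> \<le> real s * (\<eta> / \<rho> j)" using G s r unfolding G_def by (intro mult_mono) auto
        also have "\<dots> = \<eta> / \<rho> (Suc j)" using \<rho>Suc[OF j] \<rho>pos[of "Suc j"] spos by simp
        finally show "dist_int (real (r ^ Suc j) * \<xi> k i) \<le> \<eta> / \<rho> (Suc j)" .
      qed
    next
      fix j assume "G k j"
      then have "1 / 2 * real (card (lattice_sphere (lj j) :: (int ^ 'd) set)) \<le> Re (sphere_sum (lj j) (\<lambda>i. real (r ^ j) * \<xi> k i))"
        by (intro Re_sphere_sum_ge_half lj1) (simp add: G_def \<rho> \<eta>_def)
      then show "1 / 2 \<le> m j k" unfolding m_def using cardS(2)[of j] by (simp add: field_simps)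
    next
      fix j assume j: "j < J" and nG: "\<not> G k (Suc j)"
      then obtain i where i: "\<eta> / \<rho> (Suc j) < dist_int (real (r ^ Suc j) * \<xi> k i)" by (auto simp: G_def not_le)
      have Q: "\<forall>q\<in>{1..s0}. L0 / sqrt (of_int (lj j)) \<le> dist_int (real q * (real (r ^ j) * \<xi> k i))"
      proof
        fix q assume q: "q \<in> {1..s0}"
        have "q dvd fact s0" using q by (intro dvd_fact) auto
        then have "q dvd r" unfolding r_def by simp
        then obtain n where n: "r = q * n" by blast
        then have nr: "n \<le> r" using q by simp
        have eq: "real (r ^ Suc j) * \<xi> k i = of_int (int n) * (real q * (real (r ^ j) * \<xi> k i))"
          by (simp add: n mult_ac)
        have "dist_int (real (r ^ Suc j) * \<xi> k i) \<le> real n * dist_int (real q * (real (r ^ j) * \<xi> k i))"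
          unfolding eq using dist_int_int_mult_le[of "int n" "real q * (real (r ^ j) * \<xi> k i)"] by simp
        also have "\<dots> \<le> real r * dist_int (real q * (real (r ^ j) * \<xi> k i))"
          using nr by (intro mult_right_mono) auto
        finally have 1: "\<eta> / \<rho> (Suc j) \<le> real r * dist_int (real q * (real (r ^ j) * \<xi> k i))" using i by linarith
        have "real r * L0 \<le> real s * \<eta>" using s(2) \<eta> by (simp add: pos_divide_le_eq)
        then have "real r * L0 / \<rho> j \<le> real s * \<eta> / \<rho> j" using \<rho>pos[of j] by (intro divide_right_mono) auto
        also have "\<dots> = \<eta> / \<rho> (Suc j)" using \<rho>Suc[OF j] spos by simp
        finally have "real r * (L0 / \<rho> j) \<le> real r * dist_int (real q * (real (r ^ j) * \<xi> k i))" using 1 by simp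
        then show "L0 / sqrt (of_int (lj j)) \<le> dist_int (real q * (real (r ^ j) * \<xi> k i))"
          unfolding \<rho> using rpos by (simp only: mult_le_cancel_left_pos)
      qed
      have A: "\<Lambda>0 \<le> of_int (lj j)"
      proof -
        have "real_of_int l \<le> real_of_int (lj j)" using ljl by simp
        then show ?thesis using l(1) unfolding \<Lambda>_def by linarith
      qed
      have "norm (sphere_sum (lj j) (\<lambda>i. real (r ^ j) * \<xi> k i)) \<le> \<epsilon> * cS * sqrt (of_int (lj j)) ^ (?d - 2)"
        by (rule small0[THEN spec[where x = "lj j"], THEN spec[where x = "\<lambda>i. real (r ^ j) * \<xi> k i"], THEN mp, THEN mp, OF A])
           (rule exI[where x = i], rule Q)
      also have "\<dots> = \<epsilon> * (cS * \<rho> j ^ (?d - 2))" unfolding \<rho> by simp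
      also have "\<dots> \<le> \<epsilon> * real (card (lattice_sphere (lj j) :: (int ^ 'd) set))" using cardS(1) \<epsilon> by (intro mult_left_mono) auto
      finally have sm: "norm (sphere_sum (lj j) (\<lambda>i. real (r ^ j) * \<xi> k i)) \<le> \<epsilon> * real (card (lattice_sphere (lj j) :: (int ^ 'd) set))" .
      have "\<bar>Re (sphere_sum (lj j) (\<lambda>i. real (r ^ j) * \<xi> k i))\<bar> \<le> \<epsilon> * real (card (lattice_sphere (lj j) :: (int ^ 'd) set))"
        by (rule order.trans[OF abs_Re_le_cmod sm])
      then have "- \<epsilon> * real (card (lattice_sphere (lj j) :: (int ^ 'd) set)) \<le> Re (sphere_sum (lj j) (\<lambda>i. real (r ^ j) * \<xi> k i))" by simp
      then show "- \<epsilon> \<le> m j k" unfolding m_def using cardS(2)[of j] by (simp only: pos_le_divide_eq)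
    next
      fix j
      have "\<bar>Re (sphere_sum (lj j) (\<lambda>i. real (r ^ j) * \<xi> k i))\<bar> \<le> real (card (lattice_sphere (lj j) :: (int ^ 'd) set))"
        by (rule order.trans[OF abs_Re_le_cmod norm_sphere_sum_le])
      then have "- 1 * real (card (lattice_sphere (lj j) :: (int ^ 'd) set)) \<le> Re (sphere_sum (lj j) (\<lambda>i. real (r ^ j) * \<xi> k i))" by simp
      then show "- 1 \<le> m j k" unfolding m_def using cardS(2)[of j] by (simp only: pos_le_divide_eq)
    qed (use \<epsilon> in simp)
    define E0 where "E0 = (\<Sum>k | k \<in> freqs L \<and> (\<forall>i. dist_int (of_int (k $ i) / real L) \<le> \<eta> / \<rho> 0). energy B L k)"
    have finB: "finite B" using B finite_lattice_box by (rule finite_subset)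
    let ?b = "real (card B)"
    have box: "real (card (lattice_box N :: (int ^ 'd) set)) = (2 * real N + 1) ^ ?d" by (simp add: card_lattice_box add.commute)
    have E0: "real L ^ ?d * (?b * (\<kappa>1 / 2)) \<le> E0"
    proof -
      have "real L ^ ?d * (?b * (?b / (3 * real N) ^ ?d - 1 / (real N * (\<eta> / \<rho> 0))\<^sup>2)) \<le> E0"
        unfolding E0_def by (rule low_frequency_energy[OF B N]) (use \<eta> \<rho>pos in \<open>auto simp: L_def\<close>)
      moreover have "\<kappa>1 / 2 \<le> ?b / (3 * real N) ^ ?d - 1 / (real N * (\<eta> / \<rho> 0))\<^sup>2"
      proof -
        have "\<delta> * (2 * real N) ^ ?d \<le> \<delta> * (2 * real N + 1) ^ ?d" using \<delta> by (intro mult_left_mono power_mono) auto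
        then have "\<delta> * (2 * real N) ^ ?d \<le> ?b" using dens unfolding box by linarith
        then have "\<delta> * (2 * real N) ^ ?d / (3 * real N) ^ ?d \<le> ?b / (3 * real N) ^ ?d" by (rule divide_right_mono) simp
        moreover have "\<delta> * (2 * real N) ^ ?d / (3 * real N) ^ ?d = \<kappa>1"
          unfolding \<kappa>1_def using N by (simp add: power_mult_distrib power_divide)
        moreover have "1 / (real N * (\<eta> / \<rho> 0))\<^sup>2 \<le> \<kappa>1 / 2"
        proof -
          have "(\<rho> 0)\<^sup>2 = real s ^ (2 * J) * of_int l" using l0 by (simp add: \<rho>_def power_mult_distrib power_mult mult.commute flip: power_mult)
          also have "\<dots> \<le> real s ^ (2 * J) * (c2 * (real N)\<^sup>2)" using l(2) by (intro mult_left_mono) auto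
          also have "\<dots> = \<eta>\<^sup>2 * \<kappa>1 / 2 * (real N)\<^sup>2" unfolding c2_def using spos by simp
          finally have "(\<rho> 0)\<^sup>2 \<le> \<kappa>1 / 2 * (real N * \<eta>)\<^sup>2" by (simp add: power_mult_distrib mult_ac)
          then have "(\<rho> 0)\<^sup>2 / (real N * \<eta>)\<^sup>2 \<le> \<kappa>1 / 2" using N \<eta> by (subst pos_divide_le_eq) auto
          moreover have "1 / (real N * (\<eta> / \<rho> 0))\<^sup>2 = (\<rho> 0)\<^sup>2 / (real N * \<eta>)\<^sup>2" by (simp add: power_divide)
          ultimately show ?thesis by simp
        qed
        ultimately show ?thesis by linarith
      qed
      then have "real L ^ ?d * (?b * (\<kappa>1 / 2)) \<le> real L ^ ?d * (?b * (?b / (3 * real N) ^ ?d - 1 / (real N * (\<eta> / \<rho> 0))\<^sup>2))"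
        by (intro mult_left_mono) auto
      ultimately show ?thesis by linarith
    qed
    have total: "(\<Sum>k\<in>freqs L. energy B L k) = ?b * real L ^ ?d"
    proof (rule energy_total[OF finB])
      show "L > 0" using Lpos by simp
      fix x y i assume "x \<in> B" "y \<in> B"
      then have "- int N \<le> x $ i" "x $ i \<le> int N" "- int N \<le> y $ i" "y $ i \<le> int N" using B by (auto simp: lattice_box_def)
      moreover have "int L > 2 * int N" by (simp add: L_def)
      ultimately show "\<bar>x $ i - y $ i\<bar> < int L" by linarith
    qed
    let ?T = "\<Sum>x\<in>B. \<Sum>j=0..J. sphere_avg (r ^ j) (lj j) (indicator B) x"
    have "?T * real L ^ ?d = (\<Sum>j=0..J. (\<Sum>x\<in>B. sphere_avg (r ^ j) (lj j) (indicator B) x) * real L ^ ?d)"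
      unfolding sum_distrib_right[symmetric] by (subst sum.swap) simp
    also have "\<dots> = (\<Sum>j=0..J. \<Sum>k\<in>freqs L. energy B L k * m j k)"
    proof (rule sum.cong[OF refl])
      fix j assume "j \<in> {0..J}"
      then have "2 * int N + int (r ^ j) * lj j < int L" using Lj by simp
      from sum_sphere_avg_eq[OF B this lj1] show "(\<Sum>x\<in>B. sphere_avg (r ^ j) (lj j) (indicator B) x) * real L ^ ?d = (\<Sum>k\<in>freqs L. energy B L k * m j k)"
        unfolding m_def \<xi>_def .
    qed
    also have "\<dots> = (\<Sum>k\<in>freqs L. energy B L k * (\<Sum>j=0..J. m j k))"
      unfolding sum_distrib_left by (rule sum.swap)
    finally have T: "?T * real L ^ ?d = (\<Sum>k\<in>freqs L. energy B L k * (\<Sum>j=0..J. m j k))" .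
    have "real (J + 1) / 2 * E0 - (1 + \<epsilon> * real (J + 1)) * (?b * real L ^ ?d)
      = (\<Sum>k\<in>freqs L. energy B L k * (real (J + 1) / 2 * of_bool (G k 0) - 1 - \<epsilon> * real (J + 1)))"
    proof -
      have E0_eq: "E0 = (\<Sum>k\<in>freqs L. energy B L k * of_bool (G k 0))"
        unfolding E0_def using finite_freqs by (intro sum.mono_neutral_cong_left) (auto simp: G_def \<xi>_def)
      show ?thesis unfolding E0_eq total[symmetric] sum_distrib_left sum_subtractf[symmetric]
        by (intro sum.cong refl) (simp add: algebra_simps)
    qed
    also have "\<dots> \<le> ?T * real L ^ ?d" unfolding T by (intro sum_mono mult_left_mono point) simp
    finally have low: "real (J + 1) / 2 * E0 - (1 + \<epsilon> * real (J + 1)) * (?b * real L ^ ?d) \<le> ?T * real L ^ ?d" .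
    have "real (J + 1) / 2 * (real L ^ ?d * (?b * (\<kappa>1 / 2))) \<le> real (J + 1) / 2 * E0" using E0 by (intro mult_left_mono) auto
    then have "(real (J + 1) / 2 * (\<kappa>1 / 2) - (1 + \<epsilon> * real (J + 1))) * ?b * real L ^ ?d \<le> ?T * real L ^ ?d"
      using low by (simp add: algebra_simps)
    then have low': "(real (J + 1) / 2 * (\<kappa>1 / 2) - (1 + \<epsilon> * real (J + 1))) * ?b \<le> ?T"
      using Lpos by simp
    have "8 \<le> real J * \<kappa>1" using J \<kappa>1 by (simp add: pos_divide_le_eq)
    then have "8 \<le> real (J + 1) * \<kappa>1" using \<kappa>1 by (simp add: algebra_simps)
    then have "1 / 2 \<le> real (J + 1) / 2 * (\<kappa>1 / 2) - (1 + \<epsilon> * real (J + 1))" unfolding \<epsilon>_def by (simp add: mult.commute)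
    then have "1 / 2 * ?b \<le> (real (J + 1) / 2 * (\<kappa>1 / 2) - (1 + \<epsilon> * real (J + 1))) * ?b" by (rule mult_right_mono) simp
    then have "1 / 2 * ?b \<le> ?T" using low' by linarith
    then show ?thesis using dens unfolding lj_def by linarith
  qed
  have "\<delta> / 2 > 0" using \<delta> by simp
  show ?thesis
    by (rule exI[of _ r], rule exI[of _ s], rule exI[of _ J], rule exI[of _ "\<delta> / 2"], rule exI[of _ c2], rule exI[of _ \<Lambda>],
        intro conjI r s(1) \<open>\<delta> / 2 > 0\<close> c2 \<Lambda> allI impI)
       (rule main; assumption)
qed

section \<open>Containers and sparse random sets\<close>

text \<open>
  Call \<open>C T\<close> the set of points of degree at most \<open>a\<close> into \<open>T\<close>; it contains all points of \<open>B\<close> that have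
  degree at most \<open>a\<close> into \<open>B\<close>. Take \<open>T\<close> of maximal size among the sets of such points
  with \<open>\<kappa> |T| \<le> \<Phi> T\<close>, where \<open>\<Phi>\<close> is the sum of the degrees into \<open>T\<close> truncated at \<open>a + \<Delta>\<close>. Adding a point
  whose degree from \<open>C T\<close> is at least \<open>\<kappa>\<close> would raise \<open>\<Phi>\<close> by at least \<open>\<kappa>\<close>, since no degree on \<open>C T\<close>
  is truncated after a single step; hence there is none outside of \<open>T\<close>. The size of \<open>T\<close> is bounded
  because \<open>\<Phi>\<close> is.
\<close>

lemma container_exists:
  fixes w :: "'a \<Rightarrow> 'a \<Rightarrow> real"
  assumes fin: "finite Q" and w: "\<And>x y. 0 \<le> w x y" "\<And>x y. w x y \<le> \<Delta>" and a: "0 \<le> a"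
    and BQ: "B \<subseteq> Q"
  defines "C \<equiv> \<lambda>T. {x\<in>Q. (\<Sum>y\<in>T. w x y) \<le> a}"
  shows "\<exists>T\<subseteq>B. \<kappa> * real (card T) \<le> real (card Q) * (a + \<Delta>) \<and>
    {x\<in>B. (\<Sum>y\<in>B. w x y) \<le> a} \<subseteq> T \<union> {y \<in> C T. (\<Sum>x\<in>C T. w x y) < \<kappa>}"
proof -
  define B' where "B' = {x\<in>B. (\<Sum>y\<in>B. w x y) \<le> a}"
  define \<Phi> where "\<Phi> T = (\<Sum>x\<in>Q. min (\<Sum>y\<in>T. w x y) (a + \<Delta>))" for T
  have finB: "finite B" "finite B'" using BQ fin by (auto simp: B'_def dest: finite_subset)
  have \<Delta>: "0 \<le> \<Delta>" using w[of undefined undefined] by linarith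
  define F where "F = {T. T \<subseteq> B' \<and> \<kappa> * real (card T) \<le> \<Phi> T}"
  have "finite F" unfolding F_def using finB(2) by (rule finite_subset[rotated, OF finite_Pow_iff[THEN iffD2]]) auto
  moreover have "{} \<in> F" unfolding F_def \<Phi>_def using a \<Delta> by simp
  ultimately have "Max (card ` F) \<in> card ` F" "\<And>T'. T' \<in> F \<Longrightarrow> card T' \<le> Max (card ` F)"
    by (auto intro!: Max_in Max_ge)
  then have "\<exists>T\<in>F. \<forall>T'\<in>F. card T' \<le> card T" by fastforce
  then obtain T where T: "T \<in> F" and max: "\<And>T'. T' \<in> F \<Longrightarrow> card T' \<le> card T" by blast
  have TB: "T \<subseteq> B'" "T \<subseteq> B" "finite T" and TP: "\<kappa> * real (card T) \<le> \<Phi> T"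
    using T finB unfolding F_def B'_def by (auto dest: finite_subset)
  have "\<Phi> T \<le> (\<Sum>x\<in>Q. a + \<Delta>)" unfolding \<Phi>_def by (rule sum_mono) simp
  then have "\<kappa> * real (card T) \<le> real (card Q) * (a + \<Delta>)" using TP by simp
  moreover have "B' \<subseteq> T \<union> {y \<in> C T. (\<Sum>x\<in>C T. w x y) < \<kappa>}"
  proof (rule subsetI, rule ccontr)
    fix y assume y: "y \<in> B'" "y \<notin> T \<union> {y \<in> C T. (\<Sum>x\<in>C T. w x y) < \<kappa>}"
    have "(\<Sum>z\<in>T. w y z) \<le> (\<Sum>z\<in>B. w y z)" using TB finB w by (intro sum_mono2) auto
    then have "y \<in> C T" using y BQ unfolding C_def B'_def by auto
    then have big: "\<kappa> \<le> (\<Sum>x\<in>C T. w x y)" and yT: "y \<notin> T" using y by auto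
    have "\<Phi> T + (\<Sum>x\<in>C T. w x y) = (\<Sum>x\<in>Q. min (\<Sum>y\<in>T. w x y) (a + \<Delta>) + (if x \<in> C T then w x y else 0))"
    proof -
      have "(\<Sum>x\<in>C T. w x y) = (\<Sum>x\<in>Q. if x \<in> C T then w x y else 0)"
        using fin by (intro sum.mono_neutral_cong_left) (auto simp: C_def)
      then show ?thesis unfolding \<Phi>_def sum.distrib by simp
    qed
    also have "\<dots> \<le> \<Phi> (insert y T)" unfolding \<Phi>_def
    proof (rule sum_mono)
      fix x assume "x \<in> Q"
      have e: "(\<Sum>z\<in>insert y T. w x z) = w x y + (\<Sum>z\<in>T. w x z)" using yT TB(3) by simp
      show "min (\<Sum>y\<in>T. w x y) (a + \<Delta>) + (if x \<in> C T then w x y else 0) \<le> min (\<Sum>z\<in>insert y T. w x z) (a + \<Delta>)"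
        unfolding e using w[of x y] \<Delta> by (auto simp: C_def min_def)
    qed
    finally have "\<kappa> * real (card (insert y T)) \<le> \<Phi> (insert y T)"
      using big TP yT TB(3) by (simp add: algebra_simps)
    then have "insert y T \<in> F" using y(1) TB(1) by (simp add: F_def)
    from max[OF this] show False using yT TB(3) by simp
  qed
  ultimately show ?thesis using TB(2) unfolding B'_def by blast
qed

lemma set_pmf_binomial_subset: "finite A \<Longrightarrow> set_pmf (binomial_subset_pmf A p) \<subseteq> Pow A"
  by (auto simp: binomial_subset_pmf_def)

text \<open>
  The mixed moment generating function factorises over the points; both tail bounds follow from it by
  Markov's inequality.
\<close>

lemma expectation_binomial_subset:
  assumes "finite A" "T \<subseteq> A" "D \<subseteq> A" "T \<inter> D = {}" "0 \<le> p" "p \<le> 1" "0 \<le> (z::real)"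
  shows "measure_pmf.expectation (binomial_subset_pmf A p) (\<lambda>\<Omega>. of_bool (T \<subseteq> \<Omega>) * z ^ card (\<Omega> \<inter> D))
    = p ^ card T * (1 - p + p * z) ^ card D"
proof -
  define g where "g x b = (if x \<in> T then of_bool b else if x \<in> D then (if b then z else 1) else 1)" for x and b :: bool
  have fin: "finite T" "finite D" using assms by (auto dest: finite_subset)
  have "measure_pmf.expectation (binomial_subset_pmf A p) (\<lambda>\<Omega>. of_bool (T \<subseteq> \<Omega>) * z ^ card (\<Omega> \<inter> D))
     = measure_pmf.expectation (Pi_pmf A False (\<lambda>_. bernoulli_pmf p)) (\<lambda>f. \<Prod>x\<in>A. g x (f x))"
    unfolding binomial_subset_pmf_def integral_map_pmf
  proof (rule arg_cong[where f = "measure_pmf.expectation _"], rule ext)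
    fix f
    have "D \<subseteq> A - T" using assms by blast
    have "(\<Prod>x\<in>A. g x (f x)) = (\<Prod>x\<in>T. g x (f x)) * ((\<Prod>x\<in>D. g x (f x)) * (\<Prod>x\<in>A - T - D. g x (f x)))"
      using assms \<open>D \<subseteq> A - T\<close> prod.subset_diff[of T A "\<lambda>x. g x (f x)"] prod.subset_diff[of D "A - T" "\<lambda>x. g x (f x)"]
      by (simp add: mult_ac)
    also have "(\<Prod>x\<in>A - T - D. g x (f x)) = 1" by (rule prod.neutral) (auto simp: g_def)
    also have "(\<Prod>x\<in>T. g x (f x)) = of_bool (T \<subseteq> {x \<in> A. f x})"
    proof (cases "T \<subseteq> {x \<in> A. f x}")
      case True
      then have "(\<Prod>x\<in>T. g x (f x)) = 1" by (intro prod.neutral) (auto simp: g_def)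
      then show ?thesis using True by simp
    next
      case False
      then obtain x where "x \<in> T" "\<not> f x" using assms by auto
      then have "(\<Prod>x\<in>T. g x (f x)) = 0" using fin by (intro prod_zero) (auto simp: g_def)
      then show ?thesis using False by simp
    qed
    also have "(\<Prod>x\<in>D. g x (f x)) = z ^ card ({x \<in> A. f x} \<inter> D)"
    proof -
      have "(\<Prod>x\<in>D. g x (f x)) = (\<Prod>x\<in>D. if x \<in> {x \<in> A. f x} \<inter> D then z else 1)"
        using assms by (intro prod.cong) (auto simp: g_def)
      also have "\<dots> = (\<Prod>x\<in>{x \<in> A. f x} \<inter> D. z)"
        using fin by (intro prod.mono_neutral_cong_right) auto
      finally show ?thesis by simp
    qed
    finally show "of_bool (T \<subseteq> {x \<in> A. f x}) * z ^ card ({x \<in> A. f x} \<inter> D) = (\<Prod>x\<in>A. g x (f x))" by simp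
  qed
  also have "\<dots> = (\<Prod>x\<in>A. measure_pmf.expectation (bernoulli_pmf p) (g x))"
    using assms by (intro expectation_prod_Pi_pmf integrable_measure_pmf_finite) (auto simp: g_def)
  also have "\<dots> = (\<Prod>x\<in>A. (if x \<in> T then p else 1) * (if x \<in> D then 1 - p + p * z else 1))"
  proof (rule prod.cong[OF refl])
    fix x assume "x \<in> A"
    show "measure_pmf.expectation (bernoulli_pmf p) (g x) = (if x \<in> T then p else 1) * (if x \<in> D then 1 - p + p * z else 1)"
      using assms by (subst integral_bernoulli_pmf) (auto simp: g_def)
  qed
  also have "\<dots> = p ^ card T * (1 - p + p * z) ^ card D"
  proof -
    have "(\<Prod>x\<in>A. if x \<in> T then p else 1) = (\<Prod>x\<in>T. p)"
      using assms by (intro prod.mono_neutral_cong_right) auto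
    moreover have "(\<Prod>x\<in>A. if x \<in> D then 1 - p + p * z else 1) = (\<Prod>x\<in>D. 1 - p + p * z)"
      using assms by (intro prod.mono_neutral_cong_right) auto
    ultimately show ?thesis unfolding prod.distrib by simp
  qed
  finally show ?thesis .
qed

lemma markov_pmf:
  fixes f :: "'a \<Rightarrow> real"
  assumes "finite (set_pmf M)" "\<And>x. x \<in> set_pmf M \<Longrightarrow> x \<in> E \<Longrightarrow> 1 \<le> f x" "\<And>x. 0 \<le> f x"
  shows "measure_pmf.prob M E \<le> measure_pmf.expectation M f"
proof -
  have "measure_pmf.prob M E = measure_pmf.expectation M (indicator E)" by simp
  also have "\<dots> \<le> measure_pmf.expectation M f"
    using assms by (intro integral_mono_AE integrable_measure_pmf_finite) (auto simp: AE_measure_pmf_iff indicator_def)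
  finally show ?thesis .
qed

lemma prob_binomial_subset_upper:
  assumes "finite A" "T \<subseteq> A" "D \<subseteq> A" "T \<inter> D = {}" "0 \<le> p" "p \<le> 1"
  shows "measure_pmf.prob (binomial_subset_pmf A p) {\<Omega>. T \<subseteq> \<Omega> \<and> m \<le> real (card (\<Omega> \<inter> D))}
    \<le> p ^ card T * exp (2 * p * real (card D) - m)"
proof -
  let ?M = "binomial_subset_pmf A p"
  have "measure_pmf.prob ?M {\<Omega>. T \<subseteq> \<Omega> \<and> m \<le> real (card (\<Omega> \<inter> D))}
    \<le> measure_pmf.expectation ?M (\<lambda>\<Omega>. exp (- m) * (of_bool (T \<subseteq> \<Omega>) * exp 1 ^ card (\<Omega> \<inter> D)))"
  proof (rule markov_pmf)
    show "finite (set_pmf ?M)" using set_pmf_binomial_subset[OF assms(1)] assms(1) by (auto intro: finite_subset)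
  qed (auto simp: exp_of_nat_mult[symmetric] simp flip: exp_add)
  also have "\<dots> = exp (- m) * (p ^ card T * (1 - p + p * exp 1) ^ card D)"
    using assms by (simp add: expectation_binomial_subset)
  also have "\<dots> \<le> exp (- m) * (p ^ card T * exp (2 * p) ^ card D)"
  proof (intro mult_left_mono power_mono)
    have "1 - p + p * exp 1 \<le> 1 + 2 * p" using mult_left_mono[OF exp_le assms(5)] by simp
    also have "\<dots> \<le> exp (2 * p)" by (rule exp_ge_add_one_self)
    finally show "1 - p + p * exp 1 \<le> exp (2 * p)" .
    show "0 \<le> 1 - p + p * exp 1" using assms by simp
  qed (use assms in auto)
  also have "\<dots> = p ^ card T * exp (2 * p * real (card D) - m)"
    by (simp add: exp_of_nat_mult[symmetric] exp_diff exp_minus field_simps)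
  finally show ?thesis .
qed

lemma prob_binomial_subset_lower:
  assumes "finite A" "0 \<le> p" "p \<le> 1"
  shows "measure_pmf.prob (binomial_subset_pmf A p) {\<Omega>. real (card \<Omega>) < p * real (card A) / 2}
    \<le> exp (- (p * real (card A) / 10))"
proof -
  let ?M = "binomial_subset_pmf A p" and ?m = "p * real (card A) / 2"
  have sp: "set_pmf ?M \<subseteq> Pow A" by (rule set_pmf_binomial_subset[OF assms(1)])
  have "measure_pmf.prob ?M {\<Omega>. real (card \<Omega>) < ?m}
    \<le> measure_pmf.expectation ?M (\<lambda>\<Omega>. exp ?m * (of_bool ({} \<subseteq> \<Omega>) * exp (- 1) ^ card (\<Omega> \<inter> A)))"
  proof (rule markov_pmf)
    show "finite (set_pmf ?M)" using sp assms(1) by (auto intro: finite_subset)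
    fix \<Omega> assume "\<Omega> \<in> set_pmf ?M" "\<Omega> \<in> {\<Omega>. real (card \<Omega>) < ?m}"
    then have "\<Omega> \<inter> A = \<Omega>" "real (card \<Omega>) < ?m" using sp by auto
    then show "1 \<le> exp ?m * (of_bool ({} \<subseteq> \<Omega>) * exp (- 1) ^ card (\<Omega> \<inter> A))"
      by (simp add: exp_of_nat_mult[symmetric] flip: exp_add)
  qed auto
  also have "\<dots> = exp ?m * (1 - p + p * exp (- 1)) ^ card A"
    using assms expectation_binomial_subset[of A "{}" A p "exp (-1)"] by simp
  also have "\<dots> \<le> exp ?m * exp (- (3 / 5) * p) ^ card A"
  proof (intro mult_left_mono power_mono)
    have "exp (- 1) \<le> (2 / 5 :: real)"
    proof -
      have "(5 / 2 :: real) \<le> exp 1" using exp_lower_Taylor_quadratic[of 1] by simp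
      then show ?thesis by (simp add: exp_minus field_simps)
    qed
    then have "1 - p + p * exp (- 1) \<le> 1 + (- (3 / 5) * p)" using mult_left_mono[OF _ assms(2), of "exp (-1)" "2 / 5"] by simp
    also have "\<dots> \<le> exp (- (3 / 5) * p)" by (rule exp_ge_add_one_self)
    finally show "1 - p + p * exp (- 1) \<le> exp (- (3 / 5) * p)" .
    show "0 \<le> 1 - p + p * exp (- 1)" using assms by simp
  qed auto
  also have "\<dots> = exp (- (p * real (card A) / 10))"
    by (simp add: exp_of_nat_mult[symmetric] flip: exp_add)
  finally show ?thesis .
qed

lemma sum_power_card_Pow:
  fixes c :: real
  assumes "finite A"
  shows "(\<Sum>T\<in>Pow A. c ^ card T) = (1 + c) ^ card A"
proof -
  have "(1 + c) ^ card A = (\<Prod>x\<in>A. c + 1)" by (simp add: add.commute)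
  also have "\<dots> = (\<Sum>T\<in>Pow A. (\<Prod>x\<in>T. c) * (\<Prod>x\<in>A - T. 1))" by (rule prod_add[OF assms])
  finally show ?thesis by simp
qed

text \<open>
  A bad random set either has fewer than half of its expected number \<open>p n\<close> of points, or it contains a
  fingerprint \<open>T\<close> with at most \<open>\<tau> p n\<close> points and at least \<open>\<delta> p n / 4\<close> points of \<open>D T\<close>, a set of density
  at most \<open>\<delta> / 16\<close>. For fixed \<open>T\<close> the latter has probability at most
  \<open>p ^ |T| exp (- \<delta> p n / 8)\<close>. The sum of \<open>p ^ |T|\<close> over all fingerprints is at most
  \<open>exp (\<delta> p n / 16)\<close>: compare it with the sum of \<open>(u p) ^ |T|\<close> over all subsets.
\<close>

theorem sparse_supersaturation:
  fixes \<delta> \<kappa> :: real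
  assumes \<delta>: "0 < \<delta>" "\<delta> \<le> 1" and \<kappa>: "\<kappa> > 0"
  shows "\<exists>\<nu>>0. \<exists>c0>0. \<exists>c>0. \<forall>(Q :: 'a set) w p.
    finite Q \<longrightarrow> Q \<noteq> {} \<longrightarrow> 0 < p \<longrightarrow> p \<le> 1 \<longrightarrow> (\<forall>x y. 0 \<le> w x y \<and> w x y \<le> \<nu> * p) \<longrightarrow>
    (\<forall>C\<subseteq>Q. \<delta> / 16 * real (card Q) \<le> real (card C) \<longrightarrow> \<kappa> * real (card Q) \<le> (\<Sum>x\<in>C. \<Sum>y\<in>C. w x y)) \<longrightarrow>
    measure_pmf.prob (binomial_subset_pmf Q p)
      {\<Omega>. \<exists>B\<subseteq>\<Omega>. \<delta> * real (card \<Omega>) \<le> real (card B) \<and> (\<Sum>x\<in>B. \<Sum>y\<in>B. w x y) < c0 * p\<^sup>2 * real (card Q)}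
    \<le> 2 * exp (- c * (p * real (card Q)))"
proof -
  define u where "u = \<delta> / 32"
  have u: "0 < u" "u \<le> 1" using \<delta> by (simp_all add: u_def)
  have ln1: "1 \<le> ln (1 / u)"
  proof -
    have "exp 1 \<le> (3 :: real)" by (rule exp_le)
    also have "3 \<le> 1 / u" using \<delta> by (simp add: u_def field_simps)
    finally show ?thesis using u by (simp add: ln_ge_iff)
  qed
  \<comment> \<open>Chosen such that \<open>(1 / u) powr (\<tau> p n)\<close> is \<open>exp (\<delta> p n / 32)\<close>.\<close>
  define \<tau> where "\<tau> = \<delta> / (32 * ln (1 / u))"
  have \<tau>: "0 < \<tau>" "\<tau> * ln (1 / u) = \<delta> / 32" using \<delta> ln1 by (simp_all add: \<tau>_def)
  have \<tau>8: "\<tau> \<le> \<delta> / 8"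
  proof -
    have "\<tau> * 1 \<le> \<tau> * ln (1 / u)" using \<tau>(1) ln1 by (intro mult_left_mono) auto
    then show ?thesis using \<tau>(2) \<delta> by linarith
  qed
  \<comment> \<open>With \<open>a = \<Delta> = \<theta> p\<close> and threshold \<open>\<kappa> / 2\<close>, the fingerprints have at most \<open>\<tau> p n\<close> points.\<close>
  define \<theta> where "\<theta> = \<tau> * \<kappa> / 4"
  have \<theta>: "\<theta> > 0" using \<tau> \<kappa> by (simp add: \<theta>_def)
  have main: "measure_pmf.prob (binomial_subset_pmf Q p)
      {\<Omega>. \<exists>B\<subseteq>\<Omega>. \<delta> * real (card \<Omega>) \<le> real (card B) \<and> (\<Sum>x\<in>B. \<Sum>y\<in>B. w x y) < (\<theta> * \<delta> / 8) * p\<^sup>2 * real (card Q)}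
    \<le> 2 * exp (- (\<delta> / 16) * (p * real (card Q)))"
    if Q: "finite Q" "Q \<noteq> {}" and p: "0 < p" "p \<le> 1" and w: "\<forall>x y. 0 \<le> w x y \<and> w x y \<le> \<theta> * p"
      and dense: "\<forall>C\<subseteq>Q. \<delta> / 16 * real (card Q) \<le> real (card C) \<longrightarrow> \<kappa> * real (card Q) \<le> (\<Sum>x\<in>C. \<Sum>y\<in>C. w x y)"
    for Q :: "'a set" and w p
  proof -
    let ?M = "binomial_subset_pmf Q p"
    define n where "n = real (card Q)"
    have n: "n > 0" using Q by (simp add: n_def card_gt_0_iff)
    have pn: "p * n > 0" using p n by simp
    define C where "C T = {x\<in>Q. (\<Sum>y\<in>T. w x y) \<le> \<theta> * p}" for T
    define Cs where "Cs T = {y \<in> C T. (\<Sum>x\<in>C T. w x y) < \<kappa> / 2}" for T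
    define D where "D T = Cs T - T" for T
    define \<T> where "\<T> = {T. T \<subseteq> Q \<and> real (card T) \<le> \<tau> * p * n}"
    define m where "m = \<delta> / 4 * p * n"
    have CQ: "C T \<subseteq> Q" "Cs T \<subseteq> Q" "D T \<subseteq> Q" for T by (auto simp: C_def Cs_def D_def)
    have cardD: "real (card (D T)) \<le> \<delta> / 16 * n" for T
    proof -
      have finC: "finite (C T)" "finite (Cs T)" using finite_subset[OF CQ(1) Q(1)] finite_subset[OF CQ(2) Q(1)] by auto
      have "(\<Sum>x\<in>Cs T. \<Sum>y\<in>Cs T. w x y) = (\<Sum>y\<in>Cs T. \<Sum>x\<in>Cs T. w x y)" by (rule sum.swap)
      also have "\<dots> \<le> (\<Sum>y\<in>Cs T. \<Sum>x\<in>C T. w x y)"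
        using w finC by (intro sum_mono sum_mono2) (auto simp: Cs_def)
      also have "\<dots> \<le> (\<Sum>y\<in>Cs T. \<kappa> / 2)" by (rule sum_mono) (auto simp: Cs_def)
      also have "\<dots> = real (card (Cs T)) * (\<kappa> / 2)" by simp
      also have "\<dots> \<le> n * (\<kappa> / 2)"
        unfolding n_def using \<kappa> by (intro mult_right_mono of_nat_mono card_mono CQ Q(1)) auto
      also have "\<dots> < \<kappa> * n" using n \<kappa> by simp
      finally have "\<not> \<kappa> * real (card Q) \<le> (\<Sum>x\<in>Cs T. \<Sum>y\<in>Cs T. w x y)" unfolding n_def by simp
      then have "real (card (Cs T)) < \<delta> / 16 * n"
        using dense[rule_format, OF CQ(2)[of T]] unfolding n_def not_le[symmetric] by blast
      moreover have "real (card (D T)) \<le> real (card (Cs T))"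
        using finC by (intro of_nat_mono card_mono) (auto simp: D_def)
      ultimately show ?thesis by linarith
    qed
    let ?bad = "{\<Omega>. \<exists>B\<subseteq>\<Omega>. \<delta> * real (card \<Omega>) \<le> real (card B) \<and> (\<Sum>x\<in>B. \<Sum>y\<in>B. w x y) < (\<theta> * \<delta> / 8) * p\<^sup>2 * real (card Q)}"
    let ?low = "{\<Omega>. real (card \<Omega>) < p * real (card Q) / 2}"
    let ?E = "\<lambda>T. {\<Omega>. T \<subseteq> \<Omega> \<and> m \<le> real (card (\<Omega> \<inter> D T))}"
    have sub: "?bad \<inter> set_pmf ?M \<subseteq> ?low \<union> (\<Union>T\<in>\<T>. ?E T)"
    proof
      fix \<Omega> assume "\<Omega> \<in> ?bad \<inter> set_pmf ?M"
      then obtain B where \<Omega>Q: "\<Omega> \<subseteq> Q" and B: "B \<subseteq> \<Omega>" "\<delta> * real (card \<Omega>) \<le> real (card B)"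
        "(\<Sum>x\<in>B. \<Sum>y\<in>B. w x y) < (\<theta> * \<delta> / 8) * p\<^sup>2 * n"
        using set_pmf_binomial_subset[OF Q(1)] unfolding n_def by blast
      show "\<Omega> \<in> ?low \<union> (\<Union>T\<in>\<T>. ?E T)"
      proof (cases "\<Omega> \<in> ?low")
        case False
        then have big: "p * n / 2 \<le> real (card \<Omega>)" by (simp add: n_def)
        have fin: "finite \<Omega>" "finite B" using \<Omega>Q B(1) Q(1) by (auto intro: finite_subset)
        have "\<delta> * (p * n / 2) \<le> \<delta> * real (card \<Omega>)" using big \<delta> by (intro mult_left_mono) auto
        then have cB: "\<delta> / 2 * (p * n) \<le> real (card B)" using B(2) by simp
        define B' where "B' = {x\<in>B. (\<Sum>y\<in>B. w x y) \<le> \<theta> * p}"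
        have BQ: "B \<subseteq> Q" using B(1) \<Omega>Q by blast
        obtain T where T: "T \<subseteq> B" "\<kappa> / 2 * real (card T) \<le> real (card Q) * (\<theta> * p + \<theta> * p)" "B' \<subseteq> T \<union> Cs T"
          using container_exists[OF Q(1), of w "\<theta> * p" "\<theta> * p" B "\<kappa> / 2"] w p \<theta> BQ
          unfolding Cs_def C_def B'_def by auto
        have "\<kappa> / 2 * real (card T) \<le> \<kappa> / 2 * (\<tau> * p * n)" using T(2) by (simp add: \<theta>_def n_def mult_ac)
        then have cT: "real (card T) \<le> \<tau> * p * n" using \<kappa> by (simp only: mult_le_cancel_left_pos half_gt_zero_iff)
        have "real (card (B - B')) * (\<theta> * p) \<le> (\<Sum>x\<in>B - B'. \<Sum>y\<in>B. w x y)"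
          unfolding sum_constant[symmetric] by (rule sum_mono) (auto simp: B'_def)
        also have "\<dots> \<le> (\<Sum>x\<in>B. \<Sum>y\<in>B. w x y)" using fin w by (intro sum_mono2 sum_nonneg) auto
        also have "\<dots> \<le> (\<delta> / 8 * (p * n)) * (\<theta> * p)" using B(3) by (simp add: power2_eq_square mult_ac)
        finally have cBB: "real (card (B - B')) \<le> \<delta> / 8 * (p * n)"
          using \<theta> p by (simp only: mult_le_cancel_right_pos mult_pos_pos)
        have "B \<subseteq> (B - B') \<union> (T \<union> (\<Omega> \<inter> D T))" using T B(1) by (auto simp: D_def)
        then have "card B \<le> card ((B - B') \<union> (T \<union> (\<Omega> \<inter> D T)))"
          using fin T(1) by (intro card_mono) (auto intro: finite_subset)
        also have "\<dots> \<le> card (B - B') + (card T + card (\<Omega> \<inter> D T))"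
          by (intro order.trans[OF card_Un_le] add_left_mono card_Un_le)
        finally have "real (card B) \<le> real (card (B - B')) + (real (card T) + real (card (\<Omega> \<inter> D T)))" by linarith
        moreover have "\<tau> * p * n \<le> \<delta> / 8 * (p * n)" using mult_right_mono[OF \<tau>8 less_imp_le[OF pn]] by (simp only: mult.assoc)
        ultimately have "m \<le> real (card (\<Omega> \<inter> D T))" using cB cBB cT unfolding m_def mult.assoc by linarith
        moreover have "T \<in> \<T>" using T(1) BQ cT by (auto simp: \<T>_def)
        ultimately show ?thesis using T(1) B(1) by auto
      qed simp
    qed
    have fin\<T>: "finite \<T>" unfolding \<T>_def by (rule finite_subset[of _ "Pow Q"]) (use Q in auto)
    have "measure_pmf.prob ?M ?bad = measure_pmf.prob ?M (?bad \<inter> set_pmf ?M)" by (simp add: measure_Int_set_pmf)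
    also have "\<dots> \<le> measure_pmf.prob ?M (?low \<union> (\<Union>T\<in>\<T>. ?E T))" by (rule measure_pmf.finite_measure_mono[OF sub]) simp
    also have "\<dots> \<le> measure_pmf.prob ?M ?low + measure_pmf.prob ?M (\<Union>T\<in>\<T>. ?E T)"
      by (rule measure_Un_le) auto
    also have "measure_pmf.prob ?M (\<Union>T\<in>\<T>. ?E T) \<le> (\<Sum>T\<in>\<T>. measure_pmf.prob ?M (?E T))"
      by (rule measure_pmf.finite_measure_subadditive_finite[OF fin\<T>]) auto
    finally have bound: "measure_pmf.prob ?M ?bad \<le> measure_pmf.prob ?M ?low + (\<Sum>T\<in>\<T>. measure_pmf.prob ?M (?E T))" by simp
    have "measure_pmf.prob ?M ?low \<le> exp (- (p * n / 10))"
      unfolding n_def using prob_binomial_subset_lower[OF Q(1)] p by simp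
    also have "\<dots> \<le> exp (- (\<delta> / 16) * (p * n))"
    proof -
      have "\<delta> / 16 * (p * n) \<le> 1 / 10 * (p * n)" using \<delta> pn by (intro mult_right_mono) auto
      then show ?thesis by simp
    qed
    finally have low: "measure_pmf.prob ?M ?low \<le> exp (- (\<delta> / 16) * (p * n))" .
    have "(\<Sum>T\<in>\<T>. measure_pmf.prob ?M (?E T)) \<le> (\<Sum>T\<in>\<T>. exp (\<delta> / 32 * (p * n)) * (u * p) ^ card T * exp (- (\<delta> / 8) * (p * n)))"
    proof (rule sum_mono)
      fix T assume T: "T \<in> \<T>"
      have "measure_pmf.prob ?M (?E T) \<le> p ^ card T * exp (2 * p * real (card (D T)) - m)"
        using T p CQ(3) by (intro prob_binomial_subset_upper Q) (auto simp: \<T>_def D_def)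
      also have "\<dots> \<le> p ^ card T * exp (- (\<delta> / 8) * (p * n))"
      proof -
        have "2 * p * real (card (D T)) \<le> 2 * p * (\<delta> / 16 * n)" using cardD[of T] p by (intro mult_left_mono) auto
        then have "2 * p * real (card (D T)) - m \<le> - (\<delta> / 8) * (p * n)" unfolding m_def by (simp add: mult_ac)
        then show ?thesis using p by (intro mult_left_mono) auto
      qed
      also have "p ^ card T \<le> exp (\<delta> / 32 * (p * n)) * (u * p) ^ card T"
      proof -
        have "real (card T) * ln (1 / u) \<le> \<tau> * p * n * ln (1 / u)"
          using T ln1 by (intro mult_right_mono) (auto simp: \<T>_def)
        also have "\<dots> = \<delta> / 32 * (p * n)" using \<tau>(2) by (simp add: mult_ac)
        finally have "exp (real (card T) * ln (1 / u)) \<le> exp (\<delta> / 32 * (p * n))" by simp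
        moreover have "exp (real (card T) * ln (1 / u)) = (1 / u) ^ card T" using u by (simp add: exp_of_nat_mult)
        ultimately have "(1 / u) ^ card T * (u * p) ^ card T \<le> exp (\<delta> / 32 * (p * n)) * (u * p) ^ card T"
          using u p by (intro mult_right_mono) auto
        moreover have "(1 / u) ^ card T * (u * p) ^ card T = p ^ card T" using u by (simp flip: power_mult_distrib)
        ultimately show ?thesis by simp
      qed
      finally show "measure_pmf.prob ?M (?E T) \<le> exp (\<delta> / 32 * (p * n)) * (u * p) ^ card T * exp (- (\<delta> / 8) * (p * n))"
        by (simp add: mult_right_mono)
    qed
    also have "\<dots> = exp (\<delta> / 32 * (p * n)) * exp (- (\<delta> / 8) * (p * n)) * (\<Sum>T\<in>\<T>. (u * p) ^ card T)"
      unfolding sum_distrib_left by (simp add: mult_ac)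
    also have "\<dots> \<le> exp (\<delta> / 32 * (p * n)) * exp (- (\<delta> / 8) * (p * n)) * exp (u * (p * n))"
    proof (intro mult_left_mono)
      have "(\<Sum>T\<in>\<T>. (u * p) ^ card T) \<le> (\<Sum>T\<in>Pow Q. (u * p) ^ card T)"
        using Q u p by (intro sum_mono2) (auto simp: \<T>_def)
      also have "\<dots> = (1 + u * p) ^ card Q" by (rule sum_power_card_Pow[OF Q(1)])
      also have "\<dots> \<le> exp (u * p) ^ card Q" using u p by (intro power_mono exp_ge_add_one_self) auto
      also have "\<dots> = exp (u * (p * n))" by (simp add: exp_of_nat_mult[symmetric] n_def mult_ac)
      finally show "(\<Sum>T\<in>\<T>. (u * p) ^ card T) \<le> exp (u * (p * n))" .
    qed simp
    also have "\<dots> = exp (- (\<delta> / 16) * (p * n))"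
      unfolding exp_add[symmetric] u_def by (rule arg_cong[of _ _ exp]) (simp add: field_simps)
    finally have "(\<Sum>T\<in>\<T>. measure_pmf.prob ?M (?E T)) \<le> exp (- (\<delta> / 16) * (p * n))" .
    then show ?thesis using bound low unfolding n_def by linarith
  qed
  show ?thesis
    by (rule exI[of _ \<theta>], rule conjI, rule \<theta>, rule exI[of _ "\<theta> * \<delta> / 8"], rule conjI, (use \<theta> \<delta> in simp),
        rule exI[of _ "\<delta> / 16"], rule conjI, (use \<delta> in simp)) (intro allI impI, rule main, assumption+)
qed

section \<open>Transference to the random set\<close>

text \<open>
  Edge weights are averages of indicators of points, so the weight from \<open>x\<close> into \<open>B\<close> is the average of
  the indicator of \<open>B\<close>.
\<close>

lemma sphere_avg_indicator_sum:
  fixes B :: "(int ^ 'd::finite) set"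
  assumes "finite B"
  shows "(\<Sum>y\<in>B. sphere_avg q l (indicator {y}) x) = sphere_avg q l (indicator B) x"
proof -
  have "(\<Sum>y\<in>B. \<Sum>v\<in>lattice_sphere l. indicator {y} (x + int q *s v) :: real) = (\<Sum>v\<in>lattice_sphere l. \<Sum>y\<in>B. indicator {y} (x + int q *s v))"
    by (rule sum.swap)
  also have "\<dots> = (\<Sum>v\<in>lattice_sphere l. indicator B (x + int q *s v))"
    by (intro sum.cong refl) (simp add: indicator_def of_bool_def sum.delta'[OF assms])
  finally show ?thesis unfolding sphere_avg_def sum_distrib_left[symmetric] by (simp only:)
qed

lemma sphere_avg_point_bounds:
  fixes x y :: "int ^ 'd::finite"
  assumes "q \<ge> 1"
  shows "0 \<le> sphere_avg q l (indicator {y}) x"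
    and "sphere_avg q l (indicator {y}) x \<le> 1 / real (card (lattice_sphere l :: (int ^ 'd) set))"
proof -
  let ?S = "lattice_sphere l :: (int ^ 'd) set"
  show "0 \<le> sphere_avg q l (indicator {y}) x" unfolding sphere_avg_def by (intro mult_nonneg_nonneg sum_nonneg) auto
  have "(\<Sum>v\<in>?S. indicator {y} (x + int q *s v)) = real (card {v\<in>?S. x + int q *s v = y})"
  proof -
    have "{v\<in>?S. x + int q *s v = y} = ?S \<inter> {v. x + int q *s v = y}" by blast
    then show ?thesis by (simp add: indicator_def sum.If_cases)
  qed
  also have "card {v\<in>?S. x + int q *s v = y} \<le> 1"
  proof -
    have "v = v'" if "x + int q *s v = y" "x + int q *s v' = y" for v v' :: "int ^ 'd"
    proof -
      have e: "int q *s v = int q *s v'" using trans[OF that(1) that(2)[symmetric]] by simp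
      have "int q * v $ i = int q * v' $ i" for i using arg_cong[OF e, of "\<lambda>u. u $ i"] by simp
      then show ?thesis using assms by (simp add: vec_eq_iff)
    qed
    moreover have "finite {v\<in>?S. x + int q *s v = y}" by (rule finite_subset[of _ ?S]) auto
    ultimately show ?thesis by (simp only: One_nat_def card_le_Suc0_iff_eq) blast
  qed
  finally have "(\<Sum>v\<in>?S. indicator {y} (x + int q *s v)) \<le> (1::real)" by simp
  then show "sphere_avg q l (indicator {y}) x \<le> 1 / real (card ?S)"
    unfolding sphere_avg_def by (simp add: divide_right_mono)
qed

lemma sphere_avg_pos_imp_dist:
  fixes B :: "(int ^ 'd::finite) set"
  assumes "x \<in> B" "0 < sphere_avg q l (indicator B) x"
  shows "(int q)\<^sup>2 * l \<in> sq_dist_set B"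
proof -
  have "(\<Sum>v\<in>lattice_sphere l. indicator B (x + int q *s v)) \<noteq> (0::real)"
    using assms(2) unfolding sphere_avg_def by auto
  then obtain v where v: "v \<in> lattice_sphere l" "x + int q *s v \<in> B"
    by (metis (mono_tags, lifting) sum.neutral indicator_simps(2))
  have "norm_sq (x - (x + int q *s v)) = (int q)\<^sup>2 * norm_sq v"
    by (simp add: norm_sq_def power_mult_distrib sum_distrib_left)
  then have "norm_sq (x - (x + int q *s v)) = (int q)\<^sup>2 * l" using v by (simp add: lattice_sphere_def)
  then show ?thesis using assms(1) v(2) unfolding sq_dist_set_def by force
qed

lemma infsum_indicator_mult:
  fixes f :: "'a \<Rightarrow> real"
  assumes "finite B"
  shows "(\<Sum>\<^sub>\<infinity>x\<in>UNIV. indicator B x * f x) = (\<Sum>x\<in>B. f x)"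
proof -
  have "(\<Sum>\<^sub>\<infinity>x\<in>UNIV. indicator B x * f x) = (\<Sum>\<^sub>\<infinity>x\<in>B. f x)"
    by (rule infsum_cong_neutral) auto
  then show ?thesis using assms by simp
qed

text \<open>
  The bad event for one radius. The lower bound on the spheres says that every edge weight is at most
  \<open>\<nu> p\<close>.
\<close>

lemma property_event_probability:
  fixes r s J :: nat and \<delta> \<kappa> \<nu> c0 c p :: real
  assumes r: "2 \<le> r" "r < s" and p: "0 < p" "p \<le> 1" and \<nu>: "\<nu> > 0"
    and dense: "\<And>B :: (int ^ 'd::finite) set. B \<subseteq> lattice_box N \<Longrightarrow>
      \<delta> / 16 * real (card (lattice_box N :: (int ^ 'd) set)) \<le> real (card B) \<Longrightarrow>
      \<kappa> * real (card (lattice_box N :: (int ^ 'd) set)) \<le>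
        (\<Sum>x\<in>B. \<Sum>j=0..J. sphere_avg (r ^ j) (int s ^ (2 * (J - j)) * l) (indicator B) x)"
    and sparse: "\<And>w. (\<forall>x y. 0 \<le> w x y \<and> w x y \<le> \<nu> * p) \<Longrightarrow>
      (\<forall>C\<subseteq>lattice_box N. \<delta> / 16 * real (card (lattice_box N :: (int ^ 'd) set)) \<le> real (card C) \<longrightarrow>
        \<kappa> * real (card (lattice_box N :: (int ^ 'd) set)) \<le> (\<Sum>x\<in>C. \<Sum>y\<in>C. w x y)) \<Longrightarrow>
      measure_pmf.prob (binomial_subset_pmf (lattice_box N) p)
        {\<Omega> :: (int ^ 'd) set. \<exists>B\<subseteq>\<Omega>. \<delta> * real (card \<Omega>) \<le> real (card B) \<and>
          (\<Sum>x\<in>B. \<Sum>y\<in>B. w x y) < c0 * p\<^sup>2 * real (card (lattice_box N :: (int ^ 'd) set))}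
      \<le> 2 * exp (- c * (p * real (card (lattice_box N :: (int ^ 'd) set))))"
    and spheres: "\<And>j. j \<le> J \<Longrightarrow> real (J + 1) \<le> \<nu> * p * real (card (lattice_sphere (int s ^ (2 * (J - j)) * l) :: (int ^ 'd) set))"
  shows "measure_pmf.prob (binomial_subset_pmf (lattice_box N) p)
      {\<Omega> :: (int ^ 'd) set. \<exists>B\<subseteq>\<Omega>. B \<subseteq> lattice_box N \<and> \<delta> * real (card \<Omega>) \<le> real (card B) \<and>
        (\<Sum>x\<in>B. \<Sum>j=0..J. sphere_avg (r ^ j) (int s ^ (2 * (J - j)) * l) (indicator B) x)
          < c0 * p\<^sup>2 * real (card (lattice_box N :: (int ^ 'd) set))}
      \<le> 2 * exp (- c * (p * real (card (lattice_box N :: (int ^ 'd) set))))"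
proof -
  define w where "w x y = (\<Sum>j=0..J. sphere_avg (r ^ j) (int s ^ (2 * (J - j)) * l) (indicator {y}) x)" for x y :: "int ^ 'd"
  have wsum: "(\<Sum>x\<in>B. \<Sum>y\<in>B. w x y) = (\<Sum>x\<in>B. \<Sum>j=0..J. sphere_avg (r ^ j) (int s ^ (2 * (J - j)) * l) (indicator B) x)"
    if "B \<subseteq> lattice_box N" for B
  proof (rule sum.cong[OF refl])
    fix x
    have fin: "finite B" using that finite_lattice_box by (rule finite_subset)
    have "(\<Sum>y\<in>B. w x y) = (\<Sum>j=0..J. \<Sum>y\<in>B. sphere_avg (r ^ j) (int s ^ (2 * (J - j)) * l) (indicator {y}) x)"
      unfolding w_def by (rule sum.swap)
    then show "(\<Sum>y\<in>B. w x y) = (\<Sum>j=0..J. sphere_avg (r ^ j) (int s ^ (2 * (J - j)) * l) (indicator B) x)"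
      by (simp only: sphere_avg_indicator_sum[OF fin])
  qed
  have r1: "1 \<le> r ^ j" for j using r by simp
  have w0: "0 \<le> w x y" for x y unfolding w_def by (intro sum_nonneg sphere_avg_point_bounds r1)
  have w1: "w x y \<le> \<nu> * p" for x y
  proof -
    have "w x y \<le> (\<Sum>j=0..J. \<nu> * p / real (J + 1))" unfolding w_def
    proof (rule sum_mono)
      fix j assume "j \<in> {0..J}"
      then have S: "real (J + 1) \<le> \<nu> * p * real (card (lattice_sphere (int s ^ (2 * (J - j)) * l) :: (int ^ 'd) set))"
        by (intro spheres) simp
      let ?S = "real (card (lattice_sphere (int s ^ (2 * (J - j)) * l) :: (int ^ 'd) set))"
      have "?S \<noteq> 0" using S by (intro notI) simp
      moreover have "0 \<le> ?S" by (rule of_nat_0_le_iff)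
      ultimately have pos: "?S > 0" by linarith
      have "sphere_avg (r ^ j) (int s ^ (2 * (J - j)) * l) (indicator {y}) x \<le> 1 / ?S"
        by (intro sphere_avg_point_bounds r1)
      also have "\<dots> \<le> \<nu> * p / real (J + 1)" using S pos by (simp add: divide_le_eq le_divide_eq mult_ac)
      finally show "sphere_avg (r ^ j) (int s ^ (2 * (J - j)) * l) (indicator {y}) x \<le> \<nu> * p / real (J + 1)" .
    qed
    also have "\<dots> = \<nu> * p" by simp
    finally show ?thesis .
  qed
  have "measure_pmf.prob (binomial_subset_pmf (lattice_box N) p)
      {\<Omega> :: (int ^ 'd) set. \<exists>B\<subseteq>\<Omega>. B \<subseteq> lattice_box N \<and> \<delta> * real (card \<Omega>) \<le> real (card B) \<and>
        (\<Sum>x\<in>B. \<Sum>j=0..J. sphere_avg (r ^ j) (int s ^ (2 * (J - j)) * l) (indicator B) x)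
          < c0 * p\<^sup>2 * real (card (lattice_box N :: (int ^ 'd) set))}
    \<le> measure_pmf.prob (binomial_subset_pmf (lattice_box N) p)
        {\<Omega> :: (int ^ 'd) set. \<exists>B\<subseteq>\<Omega>. \<delta> * real (card \<Omega>) \<le> real (card B) \<and>
          (\<Sum>x\<in>B. \<Sum>y\<in>B. w x y) < c0 * p\<^sup>2 * real (card (lattice_box N :: (int ^ 'd) set))}"
  proof (rule measure_pmf.finite_measure_mono, rule subsetI, unfold mem_Collect_eq, elim exE conjE)
    fix \<Omega> B :: "(int ^ 'd) set"
    assume B: "B \<subseteq> \<Omega>" "B \<subseteq> lattice_box N" "\<delta> * real (card \<Omega>) \<le> real (card B)"
      and lt: "(\<Sum>x\<in>B. \<Sum>j=0..J. sphere_avg (r ^ j) (int s ^ (2 * (J - j)) * l) (indicator B) x)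
          < c0 * p\<^sup>2 * real (card (lattice_box N :: (int ^ 'd) set))"
    show "\<exists>B\<subseteq>\<Omega>. \<delta> * real (card \<Omega>) \<le> real (card B) \<and>
          (\<Sum>x\<in>B. \<Sum>y\<in>B. w x y) < c0 * p\<^sup>2 * real (card (lattice_box N :: (int ^ 'd) set))"
      by (rule exI[of _ B]) (intro conjI B lt[folded wsum[OF B(2)]])
  qed simp
  also have "\<dots> \<le> 2 * exp (- c * (p * real (card (lattice_box N :: (int ^ 'd) set))))"
  proof (rule sparse)
    show "\<forall>x y. 0 \<le> w x y \<and> w x y \<le> \<nu> * p" using w0 w1 by blast
    show "\<forall>C\<subseteq>lattice_box N. \<delta> / 16 * real (card (lattice_box N :: (int ^ 'd) set)) \<le> real (card C) \<longrightarrow>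
        \<kappa> * real (card (lattice_box N :: (int ^ 'd) set)) \<le> (\<Sum>x\<in>C. \<Sum>y\<in>C. w x y)"
    proof (intro allI impI)
      fix C :: "(int ^ 'd) set"
      assume C: "C \<subseteq> lattice_box N" "\<delta> / 16 * real (card (lattice_box N :: (int ^ 'd) set)) \<le> real (card C)"
      show "\<kappa> * real (card (lattice_box N :: (int ^ 'd) set)) \<le> (\<Sum>x\<in>C. \<Sum>y\<in>C. w x y)"
        unfolding wsum[OF C(1)] by (rule dense[OF C])
    qed
  qed
  finally show ?thesis .
qed

theorem corollary1p2:
  fixes \<delta> :: real
  assumes "CARD('d::finite) \<ge> 5" and "0 < \<delta>" and "\<delta> < 1"
  shows "\<exists>(r::nat) (s::nat) (J::nat) (c0::real) (c1::real) (c2::real).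
    2 \<le> r \<and> r < s \<and> 0 < c0 \<and> 0 < c1 \<and> 0 < c2 \<and>
    (\<forall>\<gamma>::real. 0 < \<gamma> \<and> \<gamma> < real CARD('d) - 2 \<longrightarrow>
      (\<exists>c::real. 0 < c \<and>
        property_P TYPE('d) \<delta> \<gamma> r s J c0 c1 c2 c \<and>
        (\<forall>\<^sub>F N in sequentially.
          measure_pmf.prob
            (binomial_subset_pmf (lattice_box N :: (int ^ 'd) set) (retention_prob \<gamma> N))
            {\<Omega>. \<forall>B \<subseteq> \<Omega>. real (card B) \<ge> \<delta> * real (card \<Omega>) \<longrightarrow>
               (\<forall>l. admissible_radius CARD('d) \<gamma> c1 c2 N l \<longrightarrow>
                  sq_dist_set B \<inter> {int r ^ (2 * j) * int s ^ (2 * (J - j)) * l | j. j \<le> J} \<noteq> {})}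
          \<ge> 1 - exp (- c * real N powr (real CARD('d) - \<gamma>))))) \<and>
    (\<forall>(B :: (int ^ 'd) set) (l::int).
       sq_dist_set B \<inter> {int r ^ (2 * j) * int s ^ (2 * (J - j)) * l | j. j \<le> J} \<noteq> {} \<longleftrightarrow>
       sq_dist_set B \<inter> {q\<^sup>2 * l | q. q \<in> {int r ^ j * int s ^ (J - j) | j. j \<le> J}} \<noteq> {})"
proof -
  let ?d = "CARD('d)"
  note d = assms(1)
  have d2: "real ?d - 2 > 0" using d by simp
  have \<delta>16: "\<delta> / 16 > 0" using assms(2) by simp
  obtain r s J :: nat and \<kappa> c2 \<Lambda> :: real where r: "2 \<le> r" "r < s" and \<kappa>: "\<kappa> > 0" and c2: "c2 > 0" and \<Lambda>: "\<Lambda> > 0"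
    and dense': "\<forall>N (l::int) (B :: (int ^ 'd) set). B \<subseteq> lattice_box N \<longrightarrow>
      \<delta> / 16 * real (card (lattice_box N :: (int ^ 'd) set)) \<le> real (card B) \<longrightarrow>
      \<Lambda> \<le> of_int l \<longrightarrow> of_int l \<le> c2 * (real N)\<^sup>2 \<longrightarrow>
      \<kappa> * real (card (lattice_box N :: (int ^ 'd) set)) \<le>
        (\<Sum>x\<in>B. \<Sum>j=0..J. sphere_avg (r ^ j) (int s ^ (2 * (J - j)) * l) (indicator B) x)"
    using dense_supersaturation[OF d \<delta>16] by (elim exE conjE) (rule that; assumption)
  note dense = dense'[rule_format]
  obtain \<nu> c0 c where \<nu>: "\<nu> > 0" and c0: "c0 > 0" and c: "c > 0" and sparse: "\<forall>(Q :: (int ^ 'd) set) w p.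
    finite Q \<longrightarrow> Q \<noteq> {} \<longrightarrow> 0 < p \<longrightarrow> p \<le> 1 \<longrightarrow> (\<forall>x y. 0 \<le> w x y \<and> w x y \<le> \<nu> * p) \<longrightarrow>
    (\<forall>C\<subseteq>Q. \<delta> / 16 * real (card Q) \<le> real (card C) \<longrightarrow> \<kappa> * real (card Q) \<le> (\<Sum>x\<in>C. \<Sum>y\<in>C. w x y)) \<longrightarrow>
    measure_pmf.prob (binomial_subset_pmf Q p)
      {\<Omega>. \<exists>B\<subseteq>\<Omega>. \<delta> * real (card \<Omega>) \<le> real (card B) \<and> (\<Sum>x\<in>B. \<Sum>y\<in>B. w x y) < c0 * p\<^sup>2 * real (card Q)}
    \<le> 2 * exp (- c * (p * real (card Q)))"
    using sparse_supersaturation[OF assms(2) less_imp_le[OF assms(3)] \<kappa>, where 'a = "int ^ 'd"]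
    by (elim exE conjE) (rule that; assumption)
  obtain cS where cS: "cS > 0" and S: "\<And>l::int. real_of_int l \<ge> 8 * real ?d \<Longrightarrow>
    cS * sqrt (real_of_int l) ^ (?d - 2) \<le> real (card (lattice_sphere l :: (int ^ 'd) set))"
    using card_lattice_sphere_lower_bound[OF d] by blast
  \<comment> \<open>The first two terms make \<open>\<lambda>\<close> large enough for the dense statement and for the sphere bound; the third one bounds the edge weights by \<open>\<nu> p\<close>.\<close>
  define c1 where "c1 = max (max \<Lambda> (8 * real ?d)) (real (J + 1) / (cS * \<nu>))"
  have c1: "c1 \<ge> \<Lambda>" "c1 \<ge> 8 * real ?d" "real (J + 1) / (cS * \<nu>) \<le> c1" "c1 > 0" using \<Lambda> by (auto simp: c1_def)
  have c11: "c1 \<ge> 1" using c1(2) d by linarith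
  have per_radius: "measure_pmf.prob (binomial_subset_pmf (lattice_box N) (retention_prob \<gamma> N))
      {\<Omega> :: (int ^ 'd) set. \<exists>B\<subseteq>\<Omega>. B \<subseteq> lattice_box N \<and> \<delta> * real (card \<Omega>) \<le> real (card B) \<and>
        (\<Sum>x\<in>B. \<Sum>j=0..J. sphere_avg (r ^ j) (int s ^ (2 * (J - j)) * l) (indicator B) x)
          < c0 * (retention_prob \<gamma> N)\<^sup>2 * real (card (lattice_box N :: (int ^ 'd) set))}
      \<le> 2 * exp (- c * (retention_prob \<gamma> N * real (card (lattice_box N :: (int ^ 'd) set))))"
    if p: "0 < retention_prob \<gamma> N" "retention_prob \<gamma> N \<le> 1" and adm: "admissible_radius ?d \<gamma> c1 c2 N l" for \<gamma> N l
  proof -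
    define p where "p = retention_prob \<gamma> N"
    have p01: "0 < p" "p \<le> 1" using p by (simp_all add: p_def)
    have l: "c1 * p powr (- 2 / (real ?d - 2)) \<le> of_int l" "of_int l \<le> c2 * (real N)\<^sup>2"
      using adm by (simp_all add: admissible_radius_def p_def)
    have pp: "1 \<le> p powr (- 2 / (real ?d - 2))"
    proof -
      have "p powr 0 \<le> p powr (- 2 / (real ?d - 2))" using p01 d2 by (intro powr_mono') (auto simp: divide_le_0_iff)
      then show ?thesis using p01 by simp
    qed
    have "c1 * 1 \<le> c1 * p powr (- 2 / (real ?d - 2))" using pp c1 by (intro mult_left_mono) auto
    then have lc1: "c1 \<le> of_int l" using l by linarith
    have sq: "c1 / p \<le> sqrt (of_int l) ^ (?d - 2)"
    proof -
      have "sqrt (c1 * p powr (- 2 / (real ?d - 2))) ^ (?d - 2) \<le> sqrt (of_int l) ^ (?d - 2)"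
        using l c1 by (intro power_mono) auto
      moreover have "sqrt (c1 * p powr (- 2 / (real ?d - 2))) ^ (?d - 2) = sqrt c1 ^ (?d - 2) * (1 / p)"
      proof -
        have root: "sqrt (p powr (- 2 / (real ?d - 2))) = p powr (- 1 / (real ?d - 2))"
        proof -
          have "sqrt (p powr (- 2 / (real ?d - 2))) = (p powr (- 2 / (real ?d - 2))) powr (1 / 2)"
            by (subst powr_half_sqrt) auto
          also have "\<dots> = p powr (- 1 / (real ?d - 2))"
          proof -
            have half: "- 2 / t * (1 / 2) = - 1 / t" for t :: real by (cases "t = 0") (simp_all add: field_simps)
            show ?thesis unfolding powr_powr half ..
          qed
          finally show ?thesis .
        qed
        have pw: "(p powr (- 1 / (real ?d - 2))) ^ (?d - 2) = p powr (- 1 / (real ?d - 2) * real (?d - 2))"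
          using p01 by (simp add: powr_powr flip: powr_realpow)
        have dd: "real (?d - 2) = real ?d - 2" using d by simp
        have inv: "(p powr (- 1 / (real ?d - 2))) ^ (?d - 2) = 1 / p"
          unfolding pw dd using d2 p01 by (simp add: powr_minus inverse_eq_divide)
        show ?thesis by (simp only: real_sqrt_mult power_mult_distrib root inv)
      qed
      moreover have "c1 \<le> sqrt c1 ^ (?d - 2)"
      proof -
        have "sqrt c1 ^ 2 \<le> sqrt c1 ^ (?d - 2)" using c11 d by (intro power_increasing) auto
        then show ?thesis using c1 by simp
      qed
      then have "c1 * (1 / p) \<le> sqrt c1 ^ (?d - 2) * (1 / p)" using p01 by (intro mult_right_mono) auto
      ultimately show ?thesis by simp
    qed
    have l0: "l > 0" using lc1 c1(4) by linarith
    show ?thesis unfolding p_def[symmetric]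
    proof (rule property_event_probability[OF r p01 \<nu>])
      fix B :: "(int ^ 'd) set"
      assume "B \<subseteq> lattice_box N" "\<delta> / 16 * real (card (lattice_box N :: (int ^ 'd) set)) \<le> real (card B)"
      then show "\<kappa> * real (card (lattice_box N :: (int ^ 'd) set)) \<le>
        (\<Sum>x\<in>B. \<Sum>j=0..J. sphere_avg (r ^ j) (int s ^ (2 * (J - j)) * l) (indicator B) x)"
        using lc1 c1(1) l(2) by (intro dense) auto
    next
      fix w :: "int ^ 'd \<Rightarrow> int ^ 'd \<Rightarrow> real"
      assume w: "\<forall>x y. 0 \<le> w x y \<and> w x y \<le> \<nu> * p"
        "\<forall>C\<subseteq>lattice_box N. \<delta> / 16 * real (card (lattice_box N :: (int ^ 'd) set)) \<le> real (card C) \<longrightarrow>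
        \<kappa> * real (card (lattice_box N :: (int ^ 'd) set)) \<le> (\<Sum>x\<in>C. \<Sum>y\<in>C. w x y)"
      have ne: "(lattice_box N :: (int ^ 'd) set) \<noteq> {}"
      proof -
        have "(0 :: int ^ 'd) \<in> lattice_box N" by (simp add: lattice_box_def)
        then show ?thesis by blast
      qed
      show "measure_pmf.prob (binomial_subset_pmf (lattice_box N) p)
        {\<Omega> :: (int ^ 'd) set. \<exists>B\<subseteq>\<Omega>. \<delta> * real (card \<Omega>) \<le> real (card B) \<and>
          (\<Sum>x\<in>B. \<Sum>y\<in>B. w x y) < c0 * p\<^sup>2 * real (card (lattice_box N :: (int ^ 'd) set))}
      \<le> 2 * exp (- c * (p * real (card (lattice_box N :: (int ^ 'd) set))))"
        by (rule sparse[THEN spec, THEN spec, THEN spec, THEN mp, THEN mp, THEN mp, THEN mp, THEN mp, THEN mp,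
            OF finite_lattice_box ne p01(1) p01(2) w(1) w(2)])
    next
      fix j
      let ?l = "int s ^ (2 * (J - j)) * l"
      have "1 * l \<le> ?l" using r l0 by (intro mult_right_mono) auto
      then have ll: "real_of_int l \<le> real_of_int ?l" by (simp only: of_int_le_iff mult_1)
      then have "8 * real ?d \<le> real_of_int ?l" using lc1 c1(2) by linarith
      from S[OF this] have "cS * sqrt (real_of_int ?l) ^ (?d - 2) \<le> real (card (lattice_sphere ?l :: (int ^ 'd) set))" .
      moreover have "cS * sqrt (real_of_int l) ^ (?d - 2) \<le> cS * sqrt (real_of_int ?l) ^ (?d - 2)"
        using ll l0 cS by (intro mult_left_mono power_mono real_sqrt_le_mono) auto
      moreover have "cS * (c1 / p) \<le> cS * sqrt (real_of_int l) ^ (?d - 2)" using sq cS by (intro mult_left_mono) auto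
      ultimately have "cS * (c1 / p) \<le> real (card (lattice_sphere ?l :: (int ^ 'd) set))" by linarith
      then have "\<nu> * p * (cS * (c1 / p)) \<le> \<nu> * p * real (card (lattice_sphere ?l :: (int ^ 'd) set))"
        using \<nu> p01 by (intro mult_left_mono) auto
      moreover have "\<nu> * p * (cS * (c1 / p)) = c1 * (cS * \<nu>)" using p01 by simp
      moreover have "real (J + 1) \<le> c1 * (cS * \<nu>)" using c1(3) cS \<nu> by (simp only: pos_divide_le_eq mult_pos_pos)
      ultimately show "real (J + 1) \<le> \<nu> * p * real (card (lattice_sphere ?l :: (int ^ 'd) set))" by linarith
    qed
  qed
  have main: "property_P TYPE('d) \<delta> \<gamma> r s J c0 c1 c2 (c / 2)"
     "\<forall>\<^sub>F N in sequentially.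
          measure_pmf.prob
            (binomial_subset_pmf (lattice_box N :: (int ^ 'd) set) (retention_prob \<gamma> N))
            {\<Omega>. \<forall>B \<subseteq> \<Omega>. real (card B) \<ge> \<delta> * real (card \<Omega>) \<longrightarrow>
               (\<forall>l. admissible_radius CARD('d) \<gamma> c1 c2 N l \<longrightarrow>
                  sq_dist_set B \<inter> {int r ^ (2 * j) * int s ^ (2 * (J - j)) * l | j. j \<le> J} \<noteq> {})}
          \<ge> 1 - exp (- (c / 2) * real N powr (real CARD('d) - \<gamma>))"
    if \<gamma>: "0 < \<gamma>" "\<gamma> < real ?d - 2" for \<gamma>
  proof -
    define e where "e = real ?d - \<gamma>"
    have e: "e > 0" using \<gamma> by (simp add: e_def)
    let ?M = "\<lambda>N. binomial_subset_pmf (lattice_box N :: (int ^ 'd) set) (retention_prob \<gamma> N)"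
    let ?avg = "\<lambda>N B l. 1 / real (card (lattice_box N :: (int ^ 'd) set)) *
                (\<Sum>\<^sub>\<infinity>x\<in>UNIV. indicator B x *
                   (\<Sum>j=0..J. sphere_avg (r ^ j) (int s ^ (2 * (J - j)) * l) (indicator B) x))"
    let ?E = "\<lambda>N. {\<Omega> :: (int ^ 'd) set. \<forall>B \<subseteq> \<Omega>. real (card B) \<ge> \<delta> * real (card \<Omega>) \<longrightarrow>
             (\<forall>l. admissible_radius CARD('d) \<gamma> c1 c2 N l \<longrightarrow> ?avg N B l \<ge> c0 * (retention_prob \<gamma> N)\<^sup>2)}"
    have avg: "?avg N B l = (\<Sum>x\<in>B. \<Sum>j=0..J. sphere_avg (r ^ j) (int s ^ (2 * (J - j)) * l) (indicator B) x) / real (card (lattice_box N :: (int ^ 'd) set))"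
      if "B \<subseteq> lattice_box N" for N and B :: "(int ^ 'd) set" and l
      using infsum_indicator_mult[OF finite_subset[OF that finite_lattice_box], of "\<lambda>x. \<Sum>j=0..J. sphere_avg (r ^ j) (int s ^ (2 * (J - j)) * l) (indicator B) x"] by simp
    have box0: "real (card (lattice_box N :: (int ^ 'd) set)) > 0" for N by (simp add: card_lattice_box)
    have "\<forall>\<^sub>F N :: nat in sequentially. (c2 * (real N)\<^sup>2 + 1) * 2 \<le> exp (c / 2 * real N powr e)"
      using c c2 e by real_asymp
    then have P: "\<forall>\<^sub>F N in sequentially. measure_pmf.prob (?M N) (?E N) \<ge> 1 - exp (- (c / 2) * real N powr e)"
      using eventually_ge_at_top[of 1]
    proof eventually_elim
      case (elim N)
      define p where "p = retention_prob \<gamma> N"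
      have p01: "0 < p" "p \<le> 1"
      proof -
        show "0 < p" using elim(2) by (simp add: p_def retention_prob_def)
        have "real N powr (- \<gamma>) \<le> real N powr 0" using elim(2) \<gamma> by (intro powr_mono) auto
        then show "p \<le> 1" using elim(2) by (simp add: p_def retention_prob_def)
      qed
      let ?n = "real (card (lattice_box N :: (int ^ 'd) set))"
      have pn: "real N powr e \<le> p * ?n"
      proof -
        have "real N ^ ?d \<le> (2 * real N + 1) ^ ?d" by (intro power_mono) auto
        then have "real N powr real ?d \<le> ?n" using elim(2) by (simp add: card_lattice_box powr_realpow add.commute)
        then have "p * real N powr real ?d \<le> p * ?n" using p01 by (intro mult_left_mono) auto
        moreover have "p * real N powr real ?d = real N powr e"
          unfolding p_def retention_prob_def e_def powr_add[symmetric] by simp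
        ultimately show ?thesis by simp
      qed
      define A where "A = {l. admissible_radius ?d \<gamma> c1 c2 N l}"
      have Asub: "A \<subseteq> {0..\<lfloor>c2 * (real N)\<^sup>2\<rfloor>}"
      proof
        fix l assume "l \<in> A"
        then have "c1 * p powr (- 2 / (real ?d - 2)) \<le> of_int l" "of_int l \<le> c2 * (real N)\<^sup>2"
          by (simp_all add: A_def admissible_radius_def p_def)
        moreover have "0 \<le> c1 * p powr (- 2 / (real ?d - 2))" using c1 by simp
        ultimately show "l \<in> {0..\<lfloor>c2 * (real N)\<^sup>2\<rfloor>}" by (simp add: le_floor_iff)
      qed
      have finA: "finite A" using Asub by (rule finite_subset) simp
      have cardA: "real (card A) \<le> c2 * (real N)\<^sup>2 + 1"
      proof -
        have "card A \<le> card {0..\<lfloor>c2 * (real N)\<^sup>2\<rfloor>}" using Asub by (intro card_mono) auto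
        then have "real (card A) \<le> real (nat (\<lfloor>c2 * (real N)\<^sup>2\<rfloor> + 1))" by simp
        also have "\<dots> \<le> c2 * (real N)\<^sup>2 + 1"
        proof -
          have "0 \<le> c2 * (real N)\<^sup>2" using c2 by simp
          then show ?thesis by linarith
        qed
        finally show ?thesis .
      qed
      define bad where "bad l = {\<Omega> :: (int ^ 'd) set. \<exists>B\<subseteq>\<Omega>. B \<subseteq> lattice_box N \<and> \<delta> * real (card \<Omega>) \<le> real (card B) \<and>
        (\<Sum>x\<in>B. \<Sum>j=0..J. sphere_avg (r ^ j) (int s ^ (2 * (J - j)) * l) (indicator B) x) < c0 * p\<^sup>2 * ?n}" for l
      have sub: "(- ?E N) \<inter> set_pmf (?M N) \<subseteq> (\<Union>l\<in>A. bad l)"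
      proof
        fix \<Omega> assume "\<Omega> \<in> (- ?E N) \<inter> set_pmf (?M N)"
        then have nE: "\<Omega> \<notin> ?E N" and \<Omega>: "\<Omega> \<subseteq> lattice_box N"
          using set_pmf_binomial_subset[OF finite_lattice_box, of N "retention_prob \<gamma> N"] by auto
        from nE obtain B l where B: "B \<subseteq> \<Omega>" "\<delta> * real (card \<Omega>) \<le> real (card B)" and l: "l \<in> A"
          and lt: "\<not> ?avg N B l \<ge> c0 * p\<^sup>2" unfolding A_def p_def by blast
        have BQ: "B \<subseteq> lattice_box N" using B \<Omega> by blast
        have "(\<Sum>x\<in>B. \<Sum>j=0..J. sphere_avg (r ^ j) (int s ^ (2 * (J - j)) * l) (indicator B) x) < c0 * p\<^sup>2 * ?n"
          using lt box0[of N] unfolding avg[OF BQ] not_le by (simp only: pos_divide_less_eq)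
        then have "\<Omega> \<in> bad l" unfolding bad_def using B BQ by blast
        then show "\<Omega> \<in> (\<Union>l\<in>A. bad l)" using l by blast
      qed
      have "measure_pmf.prob (?M N) (- ?E N) = measure_pmf.prob (?M N) ((- ?E N) \<inter> set_pmf (?M N))"
        by (simp only: measure_Int_set_pmf)
      also have "\<dots> \<le> measure_pmf.prob (?M N) (\<Union>l\<in>A. bad l)"
        by (rule measure_pmf.finite_measure_mono[OF sub]) simp
      also have "\<dots> \<le> (\<Sum>l\<in>A. measure_pmf.prob (?M N) (bad l))"
        by (rule measure_pmf.finite_measure_subadditive_finite[OF finA]) auto
      also have "\<dots> \<le> (\<Sum>l\<in>A. 2 * exp (- c * (p * ?n)))"
      proof (rule sum_mono)
        fix l assume "l \<in> A"
        then show "measure_pmf.prob (?M N) (bad l) \<le> 2 * exp (- c * (p * ?n))"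
          using per_radius[of \<gamma> N l] p01 unfolding bad_def A_def p_def by simp
      qed
      also have "\<dots> = real (card A) * (2 * exp (- c * (p * ?n)))" by simp
      also have "\<dots> \<le> (c2 * (real N)\<^sup>2 + 1) * (2 * exp (- c * real N powr e))"
        using cardA pn c by (intro mult_mono) auto
      also have "\<dots> = ((c2 * (real N)\<^sup>2 + 1) * 2) * exp (- c * real N powr e)" by simp
      also have "\<dots> \<le> exp (c / 2 * real N powr e) * exp (- c * real N powr e)"
        using elim(1) by (intro mult_right_mono) auto
      also have "\<dots> = exp (- (c / 2) * real N powr e)"
        unfolding exp_add[symmetric] by (rule arg_cong[of _ _ exp]) (simp add: field_simps)
      finally have "measure_pmf.prob (?M N) (- ?E N) \<le> exp (- (c / 2) * real N powr e)" .
      moreover have "measure_pmf.prob (?M N) (- ?E N) = 1 - measure_pmf.prob (?M N) (?E N)"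
        using measure_pmf.prob_compl[of "?E N" "?M N"] by (simp add: Compl_eq_Diff_UNIV)
      ultimately show ?case by linarith
    qed
    then show "property_P TYPE('d) \<delta> \<gamma> r s J c0 c1 c2 (c / 2)"
      unfolding property_P_def e_def .
    let ?F = "\<lambda>N. {\<Omega> :: (int ^ 'd) set. \<forall>B \<subseteq> \<Omega>. real (card B) \<ge> \<delta> * real (card \<Omega>) \<longrightarrow>
               (\<forall>l. admissible_radius CARD('d) \<gamma> c1 c2 N l \<longrightarrow>
                  sq_dist_set B \<inter> {int r ^ (2 * j) * int s ^ (2 * (J - j)) * l | j. j \<le> J} \<noteq> {})}"
    show "\<forall>\<^sub>F N in sequentially. measure_pmf.prob (?M N) (?F N) \<ge> 1 - exp (- (c / 2) * real N powr (real ?d - \<gamma>))"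
      using P eventually_ge_at_top[of 1]
    proof eventually_elim
      case (elim N)
      have p0: "0 < retention_prob \<gamma> N" using elim(2) by (simp add: retention_prob_def)
      have sub: "?E N \<inter> set_pmf (?M N) \<subseteq> ?F N"
      proof
        fix \<Omega> assume "\<Omega> \<in> ?E N \<inter> set_pmf (?M N)"
        then have E: "\<Omega> \<in> ?E N" and \<Omega>: "\<Omega> \<subseteq> lattice_box N"
          using set_pmf_binomial_subset[OF finite_lattice_box, of N "retention_prob \<gamma> N"] by auto
        show "\<Omega> \<in> ?F N"
        proof (rule CollectI, intro allI impI)
          fix B l assume B: "B \<subseteq> \<Omega>" "\<delta> * real (card \<Omega>) \<le> real (card B)" and l: "admissible_radius ?d \<gamma> c1 c2 N l"
          have BQ: "B \<subseteq> lattice_box N" using B \<Omega> by blast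
          have "c0 * (retention_prob \<gamma> N)\<^sup>2 \<le> ?avg N B l" using E B l by blast
          moreover have "0 < c0 * (retention_prob \<gamma> N)\<^sup>2" using c0 p0 by simp
          ultimately have "0 < ?avg N B l" by linarith
          then have "0 < (\<Sum>x\<in>B. \<Sum>j=0..J. sphere_avg (r ^ j) (int s ^ (2 * (J - j)) * l) (indicator B) x)"
            unfolding avg[OF BQ] using box0[of N] by (simp only: zero_less_divide_iff) linarith
          then obtain x where x: "x \<in> B" "0 < (\<Sum>j=0..J. sphere_avg (r ^ j) (int s ^ (2 * (J - j)) * l) (indicator B) x)"
            by (meson not_le sum_nonpos)
          then obtain j where j: "j \<in> {0..J}" "0 < sphere_avg (r ^ j) (int s ^ (2 * (J - j)) * l) (indicator B) x"
            by (meson not_le sum_nonpos)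
          have "(int (r ^ j))\<^sup>2 * (int s ^ (2 * (J - j)) * l) \<in> sq_dist_set B"
            by (rule sphere_avg_pos_imp_dist[OF x(1) j(2)])
          moreover have "(int (r ^ j))\<^sup>2 = int r ^ (2 * j)" by (simp add: mult.commute flip: power_mult)
          ultimately have "int r ^ (2 * j) * int s ^ (2 * (J - j)) * l \<in> sq_dist_set B" by (simp only: mult.assoc)
          moreover have "j \<le> J" using j(1) by simp
          ultimately show "sq_dist_set B \<inter> {int r ^ (2 * j) * int s ^ (2 * (J - j)) * l | j. j \<le> J} \<noteq> {}" by blast
        qed
      qed
      have "measure_pmf.prob (?M N) (?E N) = measure_pmf.prob (?M N) (?E N \<inter> set_pmf (?M N))"
        by (simp only: measure_Int_set_pmf)
      also have "\<dots> \<le> measure_pmf.prob (?M N) (?F N)" by (rule measure_pmf.finite_measure_mono[OF sub]) simp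
      finally show ?case using elim(1) unfolding e_def by linarith
    qed
  qed
  have sets: "{int r ^ (2 * j) * int s ^ (2 * (J - j)) * l | j. j \<le> J} = {q\<^sup>2 * l | q. q \<in> {int r ^ j * int s ^ (J - j) | j. j \<le> J}}" for l
  proof -
    have sq: "(int r ^ j * int s ^ (J - j))\<^sup>2 = int r ^ (2 * j) * int s ^ (2 * (J - j))" for j
      by (simp add: power_mult_distrib mult.commute flip: power_mult)
    show ?thesis unfolding sq[symmetric] by blast
  qed
  have c': "0 < c / 2" using c by simp
  show ?thesis
    by (rule exI[of _ r], rule exI[of _ s], rule exI[of _ J], rule exI[of _ c0], rule exI[of _ c1], rule exI[of _ c2],
        intro conjI allI impI r c0 c1(4) c2, elim conjE, rule exI[of _ "c / 2"], intro conjI c' main, assumption+)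
       (simp only: sets)
qed

end
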